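(* Let $1\leq k<n$ be integers, $p\geq 1$ and $q\in\mathbb{R}$. Let $f$ be a positive and smooth function on $\mathbb{S}^n$ satisfying $$\nabla^{2}\left(f^{-\frac{1}{k+p-1}}\right)+f^{-\frac{1}{k+p-1}}I\geq 0\quad\text{on }\mathbb{S}^n .$$ Assume that $h$ is a positive and smooth solution of $$\sigma_{k}(\nabla^{2}h+hI)=f\,h^{p-1}\,(h^{2}+|\nabla h|^{2})^{\frac{k+1-q}{2}}\quad\text{on }\mathbb{S}^n$$ with $\nabla^{2}h+hI\geq 0$ on $\mathbb{S}^n$. Then $\nabla^{2}h+hI$ is positive definite on $\mathbb{S}^n$.
   Context: $\mathbb{S}^n$ is the unit sphere in $\mathbb{R}^{n+1}$ with its round metric; $\nabla$ and $\nabla^2$ are the spherical gradient and covariant Hessian, and $I$ is the identity matrix (with respect to local orthonormal frames). For a symmetric $n\times n$ matrix $P$ with eigenvalues $\Lambda_1,\dots,\Lambda_n$, $\sigma_k(P)=\sum_{1\le i_1<\dots<i_k\le n}\Lambda_{i_1}\cdots\Lambda_{i_k}$. A matrix inequality $\geq 0$ means positive semidefinite at every point. *)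

theory Defs
  imports "HOL-Analysis.Analysis"
begin

text \<open>
  The sphere is \<^term>\<open>sphere (0::'a::euclidean_space) 1\<close>. A function on it is represented by a
  function on the whole space, of which only the values on the sphere matter.
\<close>

subsection \<open>Smooth functions on the unit sphere\<close>

text \<open>Only meaningful for open \<^term>\<open>U\<close>.\<close>

fun Ck_on :: "nat \<Rightarrow> 'a::euclidean_space set \<Rightarrow> ('a \<Rightarrow> real) \<Rightarrow> bool" where
  "Ck_on 0 U F \<longleftrightarrow> continuous_on U F"
| "Ck_on (Suc m) U F \<longleftrightarrow>
     F differentiable_on U \<and> (\<forall>b\<in>Basis. Ck_on m U (\<lambda>x. frechet_derivative F (at x) b))"

text \<open>Smoothness on a subset of Euclidean space: there is locally a smooth extension.\<close>

definition smooth_on_sphere :: "('a::euclidean_space \<Rightarrow> real) \<Rightarrow> bool" where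
  "smooth_on_sphere h \<longleftrightarrow>
     (\<forall>x\<in>sphere 0 1. \<exists>U F. open U \<and> x \<in> U \<and> (\<forall>m. Ck_on m U F)
        \<and> (\<forall>y\<in>U \<inter> sphere 0 1. F y = h y))"

subsection \<open>Gradient and covariant Hessian for the round metric\<close>

text \<open>
  The tangent space at \<^term>\<open>x\<close> is the orthogonal complement of \<^term>\<open>x\<close>. A derivative within the
  sphere is determined on tangent vectors only, hence the condition \<^term>\<open>g \<bullet> x = 0\<close>, which makes
  the gradient unique.
\<close>

definition sgrad :: "('a::euclidean_space \<Rightarrow> real) \<Rightarrow> 'a \<Rightarrow> 'a" where
  "sgrad h x = (THE g. g \<bullet> x = 0 \<and> (h has_derivative (\<lambda>v. g \<bullet> v)) (at x within sphere 0 1))"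

text \<open>
  The Levi-Civita connection of the metric induced from Euclidean space: differentiate the vector
  field \<^term>\<open>X\<close> in the tangent direction \<^term>\<open>v\<close> and project orthogonally to the tangent
  space. The value is unspecified if \<^term>\<open>v\<close> is not tangent at \<^term>\<open>x\<close>.
\<close>

definition cov_deriv :: "('a::euclidean_space \<Rightarrow> 'a) \<Rightarrow> 'a \<Rightarrow> 'a \<Rightarrow> 'a" where
  "cov_deriv X x v =
     (let w = frechet_derivative X (at x within sphere 0 1) v in w - (w \<bullet> x) *\<^sub>R x)"

definition shess :: "('a::euclidean_space \<Rightarrow> real) \<Rightarrow> 'a \<Rightarrow> 'a \<Rightarrow> 'a \<Rightarrow> real" where
  "shess h x u v = cov_deriv (sgrad h) x u \<bullet> v"

text \<open>
  Orthonormal frames are taken pointwise: no continuity in the base point is required. With as many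
  indices as the dimension of the sphere, \<^term>\<open>e\<close> is a basis of the tangent space at \<^term>\<open>x\<close>.
\<close>

definition orthonormal_frame_at :: "'a::euclidean_space \<Rightarrow> ('n::finite \<Rightarrow> 'a) \<Rightarrow> bool" where
  "orthonormal_frame_at x e \<longleftrightarrow>
     (\<forall>i. e i \<bullet> x = 0) \<and> (\<forall>i j. e i \<bullet> e j = (if i = j then 1 else 0))"

definition hess_matrix ::
  "('n::finite \<Rightarrow> 'a::euclidean_space) \<Rightarrow> ('a \<Rightarrow> real) \<Rightarrow> 'a \<Rightarrow> real^'n^'n" where
  "hess_matrix e h x = (\<chi> i j. shess h x (e i) (e j))"

text \<open>The matrix of \<open>\<nabla>\<^sup>2h + hI\<close> at \<^term>\<open>x\<close> in the frame \<^term>\<open>e\<close>.\<close>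

definition W_matrix ::
  "('n::finite \<Rightarrow> 'a::euclidean_space) \<Rightarrow> ('a \<Rightarrow> real) \<Rightarrow> 'a \<Rightarrow> real^'n^'n" where
  "W_matrix e h x = hess_matrix e h x + h x *\<^sub>R mat 1"

subsection \<open>Eigenvalues and definiteness of symmetric matrices\<close>

text \<open>
  \<^term>\<open>L\<close> enumerates the eigenvalues of \<^term>\<open>P\<close>, repeated according to multiplicity: it
  enumerates the roots of the characteristic polynomial, where \<^term>\<open>mat t\<close> is \<open>t\<close> times the
  identity. It exists for every symmetric \<^term>\<open>P\<close> and is unique up to a permutation, so the
  choice in \<open>sigma_sym\<close> below is immaterial.
\<close>

definition eigenvalue_family :: "real^'n^'n \<Rightarrow> ('n::finite \<Rightarrow> real) \<Rightarrow> bool" where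
  "eigenvalue_family P L \<longleftrightarrow> (\<forall>t. det (mat t - P) = (\<Prod>i\<in>UNIV. t - L i))"

text \<open>Index tuples \<open>i\<^sub>1 < \<dots> < i\<^sub>k\<close> are represented by the \<open>k\<close>-element sets of indices.\<close>

definition sigma_sym :: "nat \<Rightarrow> real^'n^'n \<Rightarrow> real" where
  "sigma_sym k P = (let L = (SOME L. eigenvalue_family P L)
                in \<Sum>I\<in>{I::'n::finite set. card I = k}. \<Prod>i\<in>I. L i)"

text \<open>Symmetry is not part of these notions; they are applied to Hessians, which are symmetric.\<close>

definition pos_semidef :: "real^'n^'n \<Rightarrow> bool" where
  "pos_semidef P \<longleftrightarrow> (\<forall>v. 0 \<le> v \<bullet> (P *v v))"

definition pos_def :: "real^'n^'n \<Rightarrow> bool" where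
  "pos_def P \<longleftrightarrow> (\<forall>v. v \<noteq> 0 \<longrightarrow> 0 < v \<bullet> (P *v v))"

end

theory Submission
  imports Defs
begin

text \<open>
  Extend \<open>h\<close> and \<open>f^(-1/(k+p-1))\<close> to functions \<open>H\<close> and \<open>\<Phi>\<close> that are homogeneous of degree one. On the sphere
  \<open>\<nabla>\<^sup>2h + hI\<close> is the restriction of \<open>D\<^sup>2H\<close> to the tangent space, the hypothesis on \<open>f\<close> says that \<open>\<Phi>\<close> is
  convex, and the equation becomes \<open>\<sigma>\<^sub>k(D\<^sup>2H) = R\<close> with \<open>R = \<Phi>^(-(k+p-1)) H^(p-1) |DH|^(k+1-q)\<close>.

  At a minimum of \<open>h\<close> the form is at least \<open>h > 0\<close>, so it suffices to exclude zeros of the smallest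
  eigenvalue by a strong minimum principle in the viscosity sense. Let a barrier \<open>\<psi>\<close> touch the smallest
  eigenvalue from below at \<open>x\<^sub>0\<close>, with eigenvector \<open>v\<close>. The function \<open>D\<^sup>2H(x)[u, u] - \<psi>(x) |u\<^sub>T|\<^sup>2\<close> of \<open>(x, u)\<close>,
  with \<open>u\<^sub>T\<close> the tangential part of \<open>u\<close>, has a minimum at \<open>(x\<^sub>0, v)\<close>. Its second variation in \<open>x\<close> and \<open>u\<close>
  jointly bounds \<open>D\<^sup>4H[\<xi>, \<xi>, v, v]\<close> from below by \<open>D\<^sup>2\<psi>\<close> and a quadratic expression in \<open>D\<^sup>3H[\<xi>, v, \<cdot>]\<close>. Inserted
  into the second derivative of the equation along \<open>v\<close> this gives, by the inverse concavity of the \<open>k\<close>-th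
  root of \<open>\<sigma>\<^sub>k\<close>, the inequality \<open>R'' - (1 + 1/k) R'\<^sup>2 / R \<ge> L\<psi> - C |D\<psi>|\<close>, where \<open>L\<close> is the linearised operator. On
  the other hand \<open>R^(-1/k)\<close> is convex along \<open>v\<close> up to errors \<open>C (\<psi> + |D\<psi>|)\<close>, so the left-hand side is at most
  such an error. A steep exponential barrier contradicts this.
\<close>

subsection \<open>Iterated directional derivatives\<close>

text \<open>The smallest eigenvalue is only Lipschitz where it is multiple. Minimising over points
  and unit tangent vectors together keeps everything that is differentiated smooth. Varying the
  vector along with the point also produces the positive terms
  \<open>2 * (eta i j)\<^sup>2 / l j\<close> that absorb the negative off-diagonal squares in the
  second derivative of sigma_k. Where the smallest eigenvalue repeats there is no such term, but
  there touching forces \<open>eta i j = 0\<close>; only components along the null direction itself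
  survive, and these are first derivatives of the barrier. The linearised operator has to be
  uniformly elliptic although D^2 H may degenerate: exchanging one index in a product of eigenvalues
  bounds each coefficient \<open>Fd i\<close> below by a multiple of sigma_k, which equals
  \<open>R\<close> and is bounded below by compactness. All constants come from bounds over the
  sphere and never from the barrier, so its steepness \<open>al\<close> can be chosen last. Dividing
  the final inequality by \<open>al * E\<close> bounds
  \<open>al * (1 - (x0 \<bullet> z)\<^sup>2)\<close>. What remains is to keep the touching point
  away from the poles \<open>z\<close> and \<open>- z\<close>, which is a matter of choosing
  \<open>z\<close> by means of the zero set.\<close>

definition dd :: "'a::euclidean_space \<Rightarrow> ('a \<Rightarrow> real) \<Rightarrow> 'a \<Rightarrow> real" where
  "dd v F x = frechet_derivative F (at x) v"

lemma dd_eqI: "(F has_derivative F') (at x) \<Longrightarrow> dd v F x = F' v"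
  unfolding dd_def by (metis frechet_derivative_at)

lemma dd_has_derivative: "F differentiable (at x) \<Longrightarrow> (F has_derivative (\<lambda>v. dd v F x)) (at x)"
  unfolding dd_def by (simp add: frechet_derivative_works)

lemma has_derivative_dd_cong:
  fixes F G :: "'a::euclidean_space \<Rightarrow> real"
  assumes "open U" "x \<in> U" "\<And>y. y \<in> U \<Longrightarrow> F y = G y" "(F has_derivative F') (at x)"
  shows "(G has_derivative F') (at x)"
  using assms(4,1,2,3) by (rule has_derivative_transform_within_open) 

lemma dd_cong:
  assumes "open U" "x \<in> U" "\<And>y. y \<in> U \<Longrightarrow> F y = G y"
  shows "dd v F x = dd v G x"
proof -
  have "(F has_derivative F') (at x) \<longleftrightarrow> (G has_derivative F') (at x)" for F'
    using has_derivative_dd_cong[OF assms(1,2), of F G F'] has_derivative_dd_cong[OF assms(1,2), of G F F'] assms(3)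
    by auto
  then show ?thesis unfolding dd_def frechet_derivative_def by simp
qed

text \<open>On an open set, derivatives within the set are ordinary ones. This form replaces the
  recursive equation, which is removed from the simplifier below.\<close>

lemma Ck_on_Suc:
  assumes "open U"
  shows "Ck_on (Suc m) U F \<longleftrightarrow> (\<forall>x\<in>U. F differentiable (at x)) \<and> (\<forall>b\<in>Basis. Ck_on m U (dd b F))"
  using assms unfolding Ck_on.simps dd_def[abs_def] differentiable_on_def
  by (simp add: at_within_open_NO_MATCH)

declare Ck_on.simps(2) [simp del]

lemma Ck_on_cong:
  assumes "open U" "\<And>x. x \<in> U \<Longrightarrow> F x = G x" "Ck_on m U F"
  shows "Ck_on m U G"
  using assms(2,3)
proof (induction m arbitrary: F G)
  case 0
  then show ?case by (simp cong: continuous_on_cong)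
next
  case (Suc m)
  have "Ck_on m U (dd b G)" if "b \<in> Basis" for b
    using Suc.IH[of "dd b F" "dd b G"] Suc.prems dd_cong[OF assms(1), of _ F G b] that
    by (simp add: Ck_on_Suc[OF assms(1)])
  moreover have "G differentiable (at x)" if "x \<in> U" for x
    using Suc.prems that has_derivative_dd_cong[OF assms(1) that, of F G]
    unfolding Ck_on_Suc[OF assms(1)] differentiable_def by blast
  ultimately show ?case by (simp add: Ck_on_Suc[OF assms(1)])
qed

text \<open>Smoothness is local, so the extensions in \<open>smooth_on_sphere\<close>, which are
  unrelated at different points, can serve for one global function.\<close>

lemma Ck_on_local:
  assumes "open V" "\<And>x. x \<in> V \<Longrightarrow> \<exists>U. open U \<and> x \<in> U \<and> Ck_on m U F"
  shows "Ck_on m V F"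
  using assms(2)
proof (induction m arbitrary: F)
  case 0
  then show ?case
    unfolding Ck_on.simps(1)
    by (intro continuous_at_imp_continuous_on ballI) (use continuous_on_eq_continuous_at in blast)
next
  case (Suc m)
  have "F differentiable (at x)" if "x \<in> V" for x
    using Suc.prems[OF that] by (auto simp: Ck_on_Suc)
  moreover have "Ck_on m V (dd b F)" if b: "b \<in> Basis" for b
  proof (rule Suc.IH)
    fix x assume "x \<in> V"
    then obtain U where "open U" "x \<in> U" "Ck_on (Suc m) U F" using Suc.prems by blast
    then show "\<exists>U. open U \<and> x \<in> U \<and> Ck_on m U (dd b F)" using b by (auto simp: Ck_on_Suc)
  qed
  ultimately show ?case by (simp add: Ck_on_Suc[OF assms(1)])
qed

lemma Ck_on_subset:
  assumes "open V" "open U" "V \<subseteq> U" "Ck_on m U F" shows "Ck_on m V F"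
  by (rule Ck_on_local) (use assms in blast)+

lemma Ck_on_continuous: assumes "open U" "Ck_on m U F" shows "continuous_on U F"
proof (cases m)
  case (Suc k)
  then have "F differentiable (at x)" if "x \<in> U" for x using assms that by (simp add: Ck_on_Suc)
  then show ?thesis
    by (intro continuous_at_imp_continuous_on ballI differentiable_imp_continuous_within)
qed (use assms in auto)

lemma Ck_on_lower: assumes "open U" "Ck_on (Suc m) U F" shows "Ck_on m U F"
  using assms(2)
proof (induction m arbitrary: F)
  case 0
  then show ?case using Ck_on_continuous[OF assms(1)] by simp
next
  case (Suc m)
  then have "Ck_on (Suc m) U (dd b F)" if "b \<in> Basis" for b
    using that by (simp add: Ck_on_Suc[OF assms(1)])
  then have "Ck_on m U (dd b F)" if "b \<in> Basis" for b using Suc.IH that by blast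
  with Suc.prems show ?case by (simp add: Ck_on_Suc[OF assms(1)])
qed

lemma Ck_on_const:
  fixes U :: "'a::euclidean_space set"
  assumes "open U" shows "Ck_on m U (\<lambda>x. c)"
proof (induction m arbitrary: c)
  case (Suc m)
  have "dd b (\<lambda>x::'a. c) = (\<lambda>x. 0)" for b :: 'a by (rule ext) (simp add: dd_def)
  then show ?case using Suc by (simp add: Ck_on_Suc[OF assms])
qed simp

lemma Ck_on_inner: assumes "open U" shows "Ck_on m U (\<lambda>x. x \<bullet> c)"
proof (cases m)
  case (Suc k)
  have "((\<lambda>x. x \<bullet> c) has_derivative (\<lambda>v. v \<bullet> c)) (at x)" for x
    by (auto intro!: derivative_eq_intros)
  then have "dd b (\<lambda>x. x \<bullet> c) = (\<lambda>x. b \<bullet> c)" for b by (intro ext dd_eqI)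
  moreover have "(\<lambda>x. x \<bullet> c) differentiable (at x)" for x by simp
  ultimately show ?thesis using Suc by (simp add: Ck_on_Suc[OF assms] Ck_on_const[OF assms])
qed (auto intro: continuous_intros)

lemma Ck_on_add:
  assumes "open U" "Ck_on m U F" "Ck_on m U G" shows "Ck_on m U (\<lambda>x. F x + G x)"
  using assms(2,3)
proof (induction m arbitrary: F G)
  case (Suc m)
  have d: "F differentiable (at x)" "G differentiable (at x)" if "x \<in> U" for x
    using Suc.prems that by (auto simp: Ck_on_Suc[OF assms(1)])
  have "dd b (\<lambda>x. F x + G x) x = dd b F x + dd b G x" if "x \<in> U" for b x
    by (rule dd_eqI) (auto intro!: derivative_eq_intros dd_has_derivative d that)
  moreover have "Ck_on m U (\<lambda>x. dd b F x + dd b G x)" if "b \<in> Basis" for b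
    using Suc that by (simp add: Ck_on_Suc[OF assms(1)])
  ultimately have "Ck_on m U (dd b (\<lambda>x. F x + G x))" if "b \<in> Basis" for b
    using Ck_on_cong[OF assms(1), of "\<lambda>x. dd b F x + dd b G x" "dd b (\<lambda>x. F x + G x)"] that by simp
  then show ?case using d by (simp add: Ck_on_Suc[OF assms(1)])
qed (auto intro: continuous_intros)

lemma Ck_on_sum:
  assumes "open U" "\<And>i. i \<in> I \<Longrightarrow> Ck_on m U (F i)"
  shows "Ck_on m U (\<lambda>x. \<Sum>i\<in>I. F i x)"
  using assms(2)
  by (induction I rule: infinite_finite_induct)
     (auto intro: Ck_on_const[OF assms(1)] Ck_on_add[OF assms(1)])

lemma Ck_on_mult:
  assumes "open U" "Ck_on m U F" "Ck_on m U G" shows "Ck_on m U (\<lambda>x. F x * G x)"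
  using assms(2,3)
proof (induction m arbitrary: F G)
  case (Suc m)
  have d: "F differentiable (at x)" "G differentiable (at x)" if "x \<in> U" for x
    using Suc.prems that by (auto simp: Ck_on_Suc[OF assms(1)])
  note low = Ck_on_lower[OF assms(1) Suc.prems(1)] Ck_on_lower[OF assms(1) Suc.prems(2)]
  have "dd b (\<lambda>x. F x * G x) x = F x * dd b G x + dd b F x * G x" if "x \<in> U" for b x
    by (rule dd_eqI) (auto intro!: derivative_eq_intros dd_has_derivative d that)
  moreover have "Ck_on m U (\<lambda>x. F x * dd b G x + dd b F x * G x)" if "b \<in> Basis" for b
    by (intro Ck_on_add[OF assms(1)] Suc.IH low)
       (use Suc.prems that in \<open>auto simp: Ck_on_Suc[OF assms(1)]\<close>)
  ultimately have "Ck_on m U (dd b (\<lambda>x. F x * G x))" if "b \<in> Basis" for b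
    using Ck_on_cong[OF assms(1), of "\<lambda>x. F x * dd b G x + dd b F x * G x" "dd b (\<lambda>x. F x * G x)"] that by simp
  then show ?case using d by (simp add: Ck_on_Suc[OF assms(1)])
qed (auto intro: continuous_intros)

text \<open>The exponent varies in the induction because differentiation replaces \<open>r\<close>
  by \<open>r - 1\<close>; positivity keeps the base away from the singularity of the power.\<close>

lemma Ck_on_powr:
  assumes "open U" "Ck_on m U F" "\<And>x. x \<in> U \<Longrightarrow> 0 < F x" shows "Ck_on m U (\<lambda>x. F x powr r)"
  using assms(2)
proof (induction m arbitrary: r)
  case 0
  then show ?case using assms(3) by (auto intro!: continuous_on_powr continuous_on_const simp: less_imp_neq) (metis less_irrefl)
next
  case (Suc m)
  have d: "F differentiable (at x)" if "x \<in> U" for x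
    using Suc.prems that by (auto simp: Ck_on_Suc[OF assms(1)])
  have p: "((\<lambda>x. F x powr r) has_derivative (\<lambda>b. r * (F x powr (r - 1) * dd b F x))) (at x)"
    if "x \<in> U" for x
    by (rule has_derivative_eq_rhs[OF has_derivative_powr[OF dd_has_derivative[OF d] has_derivative_const]])
       (use that assms(3)[OF that] in \<open>auto simp: powr_diff fun_eq_iff\<close>)
  note low = Ck_on_lower[OF assms(1) Suc.prems]
  have "Ck_on m U (\<lambda>x. r * (F x powr (r - 1) * dd b F x))" if "b \<in> Basis" for b
    by (intro Ck_on_mult[OF assms(1)] Ck_on_const[OF assms(1)] Suc.IH low)
       (use Suc.prems that in \<open>auto simp: Ck_on_Suc[OF assms(1)]\<close>)
  then have "Ck_on m U (dd b (\<lambda>x. F x powr r))" if "b \<in> Basis" for b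
    using Ck_on_cong[OF assms(1), of "\<lambda>x. r * (F x powr (r - 1) * dd b F x)" "dd b (\<lambda>x. F x powr r)"]
      dd_eqI[OF p] that by simp
  then show ?case using p by (auto simp: Ck_on_Suc[OF assms(1)] differentiable_def)
qed

lemma Ck_on_compose:
  fixes G :: "'a::euclidean_space \<Rightarrow> 'a"
  assumes "open U" "open V" "Ck_on m U F" "\<And>x. x \<in> V \<Longrightarrow> G x \<in> U"
    "\<And>b. b \<in> Basis \<Longrightarrow> Ck_on m V (\<lambda>x. G x \<bullet> b)"
  shows "Ck_on m V (\<lambda>x. F (G x))"
  using assms(3,5)
proof (induction m arbitrary: F)
  case 0
  have "continuous_on V G"
    using 0 by (subst continuous_on_componentwise) auto
  moreover have "continuous_on U F" using 0 by simp
  ultimately show ?case using assms(4)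
    by (auto intro!: continuous_on_compose2[of U F V G])
next
  case (Suc m)
  have dF: "F differentiable (at x)" if "x \<in> U" for x
    using Suc.prems that by (auto simp: Ck_on_Suc[OF assms(1)])
  have dG: "(\<lambda>x. G x \<bullet> b) differentiable (at x)" if "x \<in> V" "b \<in> Basis" for x b
    using Suc.prems that by (auto simp: Ck_on_Suc[OF assms(2)])
  have G': "(G has_derivative (\<lambda>v. \<Sum>b\<in>Basis. dd v (\<lambda>x. G x \<bullet> b) x *\<^sub>R b)) (at x)" if "x \<in> V" for x
  proof (subst has_derivative_componentwise_within, intro ballI)
    fix i :: 'a assume i: "i \<in> Basis"
    have "(\<Sum>b\<in>Basis. dd v (\<lambda>x. G x \<bullet> b) x *\<^sub>R b) \<bullet> i = dd v (\<lambda>x. G x \<bullet> i) x" for v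
      using i by simp
    then show "((\<lambda>x. G x \<bullet> i) has_derivative
        (\<lambda>v. (\<Sum>b\<in>Basis. dd v (\<lambda>x. G x \<bullet> b) x *\<^sub>R b) \<bullet> i)) (at x)"
      using dd_has_derivative[OF dG[OF that i]] by simp
  qed
  have p: "((\<lambda>x. F (G x)) has_derivative (\<lambda>v. \<Sum>b\<in>Basis. dd v (\<lambda>x. G x \<bullet> b) x * dd b F (G x))) (at x)"
    if "x \<in> V" for x
  proof -
    have lin: "linear (\<lambda>v. dd v F (G x))"
      using dd_has_derivative[OF dF[OF assms(4)[OF that]]] has_derivative_linear by blast
    show ?thesis
      by (rule has_derivative_eq_rhs[OF has_derivative_compose[OF G'[OF that] dd_has_derivative[OF dF[OF assms(4)[OF that]]]]])
         (simp add: linear_sum[OF lin] linear_scale[OF lin])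
  qed
  note low = Ck_on_lower[OF assms(2) Suc.prems(2)]
  have "Ck_on m V (\<lambda>x. \<Sum>b\<in>Basis. dd v (\<lambda>x. G x \<bullet> b) x * dd b F (G x))" if "v \<in> Basis" for v
  proof (intro Ck_on_sum[OF assms(2)] Ck_on_mult[OF assms(2)])
    fix b :: 'a assume b: "b \<in> Basis"
    show "Ck_on m V (dd v (\<lambda>x. G x \<bullet> b))"
      using Suc.prems(2)[OF b] that by (simp add: Ck_on_Suc[OF assms(2)])
    have "Ck_on m U (dd b F)" using Suc.prems(1) b by (simp add: Ck_on_Suc[OF assms(1)])
    then show "Ck_on m V (\<lambda>x. dd b F (G x))" by (rule Suc.IH[OF _ low])
  qed
  then have "Ck_on m V (dd v (\<lambda>x. F (G x)))" if "v \<in> Basis" for v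
    using Ck_on_cong[OF assms(2), of "\<lambda>x. \<Sum>b\<in>Basis. dd v (\<lambda>x. G x \<bullet> b) x * dd b F (G x)" "dd v (\<lambda>x. F (G x))"]
      dd_eqI[OF p] that by simp
  moreover have "(\<lambda>x. F (G x)) differentiable (at x)" if "x \<in> V" for x
    using p[OF that] differentiableI by blast
  ultimately show ?case by (simp add: Ck_on_Suc[OF assms(2)])
qed

text \<open>\<open>Ck_on\<close> controls basis directions only; any other direction is a constant
  linear combination of them.\<close>

lemma Ck_on_dd:
  assumes "open U" "Ck_on (Suc m) U F" shows "Ck_on m U (dd v F)"
proof -
  have eq: "dd v F x = (\<Sum>b\<in>Basis. (v \<bullet> b) * dd b F x)" if "x \<in> U" for x
  proof -
    have lin: "linear (\<lambda>v. dd v F x)"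
      using assms(2) that by (intro has_derivative_linear[OF dd_has_derivative])
        (simp add: Ck_on_Suc[OF assms(1)])
    show ?thesis
      by (subst (1) euclidean_representation[of v, symmetric])
         (simp only: linear_sum[OF lin] linear_scale[OF lin] real_scaleR_def)
  qed
  have C: "Ck_on m U (\<lambda>x. \<Sum>b\<in>Basis. (v \<bullet> b) * dd b F x)"
    using assms(2) by (intro Ck_on_sum[OF assms(1)] Ck_on_mult[OF assms(1)] Ck_on_const[OF assms(1)])
      (simp add: Ck_on_Suc[OF assms(1)])
  show ?thesis by (rule Ck_on_cong[OF assms(1) _ C]) (simp add: eq)
qed

section \<open>Restriction to lines and symmetry of second derivatives\<close>

lemma dd_linear:
  assumes "open U" "Ck_on (Suc m) U F" "x \<in> U" shows "linear (\<lambda>v. dd v F x)"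
  using assms(2,3) by (intro has_derivative_linear[OF dd_has_derivative])
    (simp add: Ck_on_Suc[OF assms(1)])

text \<open>Every later second variation runs along a straight line in the punctured space, so
  calculus in one real variable suffices.\<close>

lemma dd_line:
  assumes "open U" "Ck_on (Suc m) U F" "x + t *\<^sub>R v \<in> U"
  shows "((\<lambda>t. F (x + t *\<^sub>R v)) has_real_derivative dd v F (x + t *\<^sub>R v)) (at t)"
proof -
  have "F differentiable (at (x + t *\<^sub>R v))" using assms by (auto simp: Ck_on_Suc)
  then have "(F has_derivative (\<lambda>w. dd w F (x + t *\<^sub>R v))) (at (x + t *\<^sub>R v))"
    by (rule dd_has_derivative)
  then have "((\<lambda>t. F (x + t *\<^sub>R v)) has_derivative (\<lambda>s. dd (s *\<^sub>R v) F (x + t *\<^sub>R v))) (at t)"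
    by (rule has_derivative_compose[rotated]) (auto intro!: derivative_eq_intros)
  moreover have "dd (s *\<^sub>R v) F (x + t *\<^sub>R v) = dd v F (x + t *\<^sub>R v) * s" for s
    using linear_scale[OF dd_linear[OF assms]] by simp
  ultimately show ?thesis by (simp add: has_field_derivative_def mult_commute_abs)
qed

text \<open>Schwarz's theorem. The mixed second difference is symmetric in \<open>u\<close> and
  \<open>v\<close>; divided by \<open>s * s\<close> it is a value of either mixed derivative near
  \<open>x\<close>, and continuity lets \<open>s\<close> tend to zero.\<close>

lemma dd_commute:
  fixes F :: "'a::euclidean_space \<Rightarrow> real"
  assumes "open U" "Ck_on (Suc (Suc 0)) U F" "x \<in> U"
  shows "dd u (dd v F) x = dd v (dd u F) x"
proof -
  have C1: "Ck_on (Suc 0) U (dd w F)" for w using Ck_on_dd[OF assms(1,2)] .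
  have C0: "isCont (dd w' (dd w F)) x" for w w'
    using Ck_on_dd[OF assms(1) C1] assms(1,3) by (simp add: continuous_on_eq_continuous_at)
  obtain d where d: "d > 0" "ball x d \<subseteq> U" using assms(1,3) openE by blast
  \<comment> \<open>Small enough that \<open>x + s *\<^sub>R u + t *\<^sub>R v\<close> with
    \<open>s\<close> and \<open>t\<close> below \<open>r\<close> stays in the ball; the summand 1
    covers \<open>u = v = 0\<close>.\<close>
  define r where "r = d / (1 + norm u + norm v)"
  have np: "0 < 1 + norm u + norm v" by (smt (verit) norm_ge_zero)
  have r: "r > 0" using d np by (simp add: r_def)
  have small: "norm (a *\<^sub>R u + b *\<^sub>R v) < s * (1 + norm u + norm v)"
    if "0 \<le> a" "a \<le> s" "0 \<le> b" "b \<le> s" "0 < s" for a b s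
  proof -
    have "norm (a *\<^sub>R u + b *\<^sub>R v) \<le> a * norm u + b * norm v"
      using that norm_triangle_ineq[of "a *\<^sub>R u" "b *\<^sub>R v"] by simp
    also have "\<dots> \<le> s * norm u + s * norm v"
      using that by (intro add_mono mult_right_mono) auto
    also have "\<dots> < s * (1 + norm u + norm v)" using that by (simp add: algebra_simps)
    finally show ?thesis .
  qed
  have inb: "x + s *\<^sub>R u + t *\<^sub>R v \<in> U" if "0 \<le> s" "s < r" "0 \<le> t" "t < r" for s t
  proof -
    have "norm (s *\<^sub>R u + t *\<^sub>R v) < d" using small[of s r t] that r np by (simp add: r_def)
    then have "x + s *\<^sub>R u + t *\<^sub>R v \<in> ball x d"
      by (simp add: mem_ball dist_commute[of x] dist_norm[of _ x] add.assoc)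
    with d show ?thesis by blast
  qed
  \<comment> \<open>Two applications of the mean value theorem to the mixed second difference quotient.\<close>
  have mvt: "\<exists>a b. 0 < a \<and> a < s \<and> 0 < b \<and> b < s \<and>
      F (x + s *\<^sub>R w + s *\<^sub>R z) - F (x + s *\<^sub>R w) - F (x + s *\<^sub>R z) + F x = s * s * dd z (dd w F) (x + a *\<^sub>R w + b *\<^sub>R z)"
    if s: "0 < s" "s < r" and inb: "\<And>s t. \<lbrakk>0 \<le> s; s < r; 0 \<le> t; t < r\<rbrakk> \<Longrightarrow> x + s *\<^sub>R w + t *\<^sub>R z \<in> U" for s w z
  proof -
    let ?g = "\<lambda>a. F (x + s *\<^sub>R z + a *\<^sub>R w) - F (x + a *\<^sub>R w)"
    have "\<exists>a. 0 < a \<and> a < s \<and> ?g s - ?g 0 = (s - 0) * (dd w F (x + s *\<^sub>R z + a *\<^sub>R w) - dd w F (x + a *\<^sub>R w))"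
    proof (rule MVT2)
      fix a assume a: "0 \<le> a" "a \<le> s"
      have "x + s *\<^sub>R z + a *\<^sub>R w \<in> U" "x + a *\<^sub>R w \<in> U"
        using inb[of a s] inb[of a 0] a s by (auto simp: algebra_simps)
      then show "DERIV ?g a :> dd w F (x + s *\<^sub>R z + a *\<^sub>R w) - dd w F (x + a *\<^sub>R w)"
        by (intro DERIV_diff dd_line[OF assms(1,2)])
    qed (use s in auto)
    then obtain a where a: "0 < a" "a < s" and ga: "?g s - ?g 0 = s * (dd w F (x + s *\<^sub>R z + a *\<^sub>R w) - dd w F (x + a *\<^sub>R w))" by auto
    let ?k = "\<lambda>b. dd w F (x + a *\<^sub>R w + b *\<^sub>R z)"
    have "\<exists>b. 0 < b \<and> b < s \<and> ?k s - ?k 0 = (s - 0) * dd z (dd w F) (x + a *\<^sub>R w + b *\<^sub>R z)"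
    proof (rule MVT2)
      fix b assume b: "0 \<le> b" "b \<le> s"
      have "x + a *\<^sub>R w + b *\<^sub>R z \<in> U" using inb[of a b] a b s by auto
      then show "DERIV ?k b :> dd z (dd w F) (x + a *\<^sub>R w + b *\<^sub>R z)"
        by (intro dd_line[OF assms(1) C1])
    qed (use s in auto)
    then obtain b where b: "0 < b" "b < s" "?k s - ?k 0 = s * dd z (dd w F) (x + a *\<^sub>R w + b *\<^sub>R z)" by auto
    have "F (x + s *\<^sub>R w + s *\<^sub>R z) - F (x + s *\<^sub>R w) - F (x + s *\<^sub>R z) + F x = ?g s - ?g 0" by (simp add: algebra_simps)
    also have "\<dots> = s * (?k s - ?k 0)" using ga by (simp add: algebra_simps)
    also have "\<dots> = s * s * dd z (dd w F) (x + a *\<^sub>R w + b *\<^sub>R z)" using b by simp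
    finally show ?thesis using a b by blast
  qed
  have "\<bar>dd u (dd v F) x - dd v (dd u F) x\<bar> \<le> e" if "e > 0" for e
  proof -
    obtain d1 where d1: "d1 > 0" "\<And>y. dist y x < d1 \<Longrightarrow> \<bar>dd u (dd v F) y - dd u (dd v F) x\<bar> < e/2"
      using C0[of u v] \<open>e > 0\<close> unfolding continuous_at_eps_delta dist_real_def by (meson half_gt_zero)
    obtain d2 where d2: "d2 > 0" "\<And>y. dist y x < d2 \<Longrightarrow> \<bar>dd v (dd u F) y - dd v (dd u F) x\<bar> < e/2"
      using C0[of v u] \<open>e > 0\<close> unfolding continuous_at_eps_delta dist_real_def by (meson half_gt_zero)
    define s where "s = min (r/2) (min d1 d2 / (1 + norm u + norm v))"
    have s: "0 < s" "s < r" using r d1 d2 np by (auto simp: s_def)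
    have sd: "s * (1 + norm u + norm v) \<le> min d1 d2"
    proof -
      have "s \<le> min d1 d2 / (1 + norm u + norm v)" by (simp add: s_def)
      then show ?thesis using np by (simp add: pos_le_divide_eq)
    qed
    have near: "dist (x + a *\<^sub>R u + b *\<^sub>R v) x < min d1 d2" if "0 < a" "a < s" "0 < b" "b < s" for a b
      using small[of a s b] that s sd by (simp add: dist_norm add.assoc)
    obtain a b where ab: "0 < a" "a < s" "0 < b" "b < s" 
      "F (x + s *\<^sub>R u + s *\<^sub>R v) - F (x + s *\<^sub>R u) - F (x + s *\<^sub>R v) + F x = s * s * dd v (dd u F) (x + a *\<^sub>R u + b *\<^sub>R v)"
      using mvt[OF s inb] by blast
    have inb': "x + s *\<^sub>R v + t *\<^sub>R u \<in> U" if "0 \<le> s" "s < r" "0 \<le> t" "t < r" for s t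
      using inb[of t s] that by (simp add: algebra_simps)
    obtain a' b' where ab': "0 < a'" "a' < s" "0 < b'" "b' < s" 
      "F (x + s *\<^sub>R v + s *\<^sub>R u) - F (x + s *\<^sub>R v) - F (x + s *\<^sub>R u) + F x = s * s * dd u (dd v F) (x + a' *\<^sub>R v + b' *\<^sub>R u)"
      using mvt[OF s inb'] by blast
    have "s * s * dd v (dd u F) (x + a *\<^sub>R u + b *\<^sub>R v) = s * s * dd u (dd v F) (x + b' *\<^sub>R u + a' *\<^sub>R v)"
      using ab(5) ab'(5) by (simp add: algebra_simps)
    then have "dd v (dd u F) (x + a *\<^sub>R u + b *\<^sub>R v) = dd u (dd v F) (x + b' *\<^sub>R u + a' *\<^sub>R v)" using s by simp
    moreover have "\<bar>dd v (dd u F) (x + a *\<^sub>R u + b *\<^sub>R v) - dd v (dd u F) x\<bar> < e/2"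
      using d2(2) near[of a b] ab by simp
    moreover have "\<bar>dd u (dd v F) (x + b' *\<^sub>R u + a' *\<^sub>R v) - dd u (dd v F) x\<bar> < e/2"
      using d1(2) near[of b' a'] ab' by simp
    ultimately show ?thesis by linarith
  qed
  then have "\<bar>dd u (dd v F) x - dd v (dd u F) x\<bar> \<le> 0" by (rule field_le_epsilon) simp
  then show ?thesis by simp
qed

subsection \<open>Elementary symmetric functions as sums of principal minors\<close>

text \<open>The principal minor on the rows and columns \<open>I\<close>, as a Leibniz sum over
  permutations of \<open>I\<close>, so that \<open>I\<close> can range over the subsets of a fixed
  index type.\<close>

definition pminor :: "('i \<Rightarrow> 'i \<Rightarrow> real) \<Rightarrow> 'i set \<Rightarrow> real" where
  "pminor M I = (\<Sum>p | p permutes I. of_int (sign p) * (\<Prod>i\<in>I. M i (p i)))"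

lemma permutes_iff_fixes:
  assumes "p permutes T" "S \<subseteq> T"
  shows "p permutes S \<longleftrightarrow> (\<forall>i\<in>T - S. p i = i)"
  using assms permutes_superset[of p T S] by (auto dest: permutes_not_in)

text \<open>A permutation that moves an index of \<open>I - J\<close> picks up an off-diagonal zero.
  Sets \<open>J\<close> with 0, 1 and 2 elements will give the value, the first and the second
  derivative of a minor at a diagonal matrix; general \<open>J\<close> gives the coefficients of the
  characteristic polynomial.\<close>

lemma sum_permutes_diag:
  fixes s :: "('i \<Rightarrow> 'i) \<Rightarrow> real"
  assumes "finite I" "J \<subseteq> I" and offdiag: "\<And>i j. i \<in> I \<Longrightarrow> j \<in> I \<Longrightarrow> i \<noteq> j \<Longrightarrow> M i j = 0"
  shows "(\<Sum>p | p permutes I. s p * (\<Prod>j\<in>I - J. M j (p j))) = (\<Sum>p | p permutes J. s p * (\<Prod>j\<in>I - J. M j j))"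
proof -
  have "(\<Sum>p | p permutes I. s p * (\<Prod>j\<in>I - J. M j (p j))) = (\<Sum>p | p permutes J. s p * (\<Prod>j\<in>I - J. M j (p j)))"
  proof (rule sum.mono_neutral_right)
    show "\<forall>p\<in>{p. p permutes I} - {p. p permutes J}. s p * (\<Prod>j\<in>I - J. M j (p j)) = 0"
    proof
      fix p assume p: "p \<in> {p. p permutes I} - {p. p permutes J}"
      then obtain j where j: "j \<in> I - J" "p j \<noteq> j"
        using permutes_iff_fixes[OF _ assms(2), of p] by blast
      with p have "p j \<in> I" by (simp add: permutes_in_image)
      then have "M j (p j) = 0" using offdiag[of j "p j"] j by auto
      then have "(\<Prod>j\<in>I - J. M j (p j)) = 0" using j assms(1) by (intro prod_zero) auto
      then show "s p * (\<Prod>j\<in>I - J. M j (p j)) = 0" by simp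
    qed
  qed (use assms(1,2) in \<open>auto intro: finite_permutations permutes_subset\<close>)
  also have "\<dots> = (\<Sum>p | p permutes J. s p * (\<Prod>j\<in>I - J. M j j))"
    by (intro sum.cong refl arg_cong2[of _ _ _ _ "(*)"] prod.cong) (auto dest: permutes_not_in)
  finally show ?thesis .
qed

text \<open>Multiply out the rows of \<open>mat t - P\<close>: \<open>J\<close> collects the rows in
  which the entry of \<open>P\<close> is taken, and every other row contributes \<open>t\<close>
  only if the permutation fixes it.\<close>

lemma det_mat_diff:
  fixes P :: "real^'n^'n"
  shows "det (mat t - P) =
    (\<Sum>J\<in>Pow UNIV. t ^ (CARD('n) - card J) * ((- 1) ^ card J * pminor (\<lambda>i j. P $ i $ j) J))"
proof -
  let ?f = "\<lambda>p J. of_int (sign p) * (\<Prod>i\<in>J. - (P $ i $ p i)) * (\<Prod>i\<in>UNIV - J. if i = p i then t else 0)"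
  have "det (mat t - P) = (\<Sum>p | p permutes (UNIV::'n set). of_int (sign p) *
      (\<Prod>i\<in>UNIV. - (P $ i $ p i) + (if i = p i then t else 0)))"
    unfolding det_def by (simp add: mat_def)
  also have "\<dots> = (\<Sum>p | p permutes (UNIV::'n set). \<Sum>J\<in>Pow UNIV. ?f p J)"
    by (subst prod_add) (auto simp: sum_distrib_left mult.assoc)
  also have "\<dots> = (\<Sum>J\<in>Pow UNIV. \<Sum>p | p permutes (UNIV::'n set). ?f p J)"
    by (rule sum.swap)
  also have "\<dots> = (\<Sum>J\<in>Pow UNIV. t ^ (CARD('n) - card J) * ((- 1) ^ card J * pminor (\<lambda>i j. P $ i $ j) J))"
  proof (rule sum.cong[OF refl])
    fix J :: "'n set"
    have "(\<Sum>p | p permutes (UNIV::'n set). ?f p J) =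
        (\<Sum>p | p permutes J. of_int (sign p) * (\<Prod>i\<in>J. - (P $ i $ p i)) * (\<Prod>i\<in>UNIV - J. if i = i then t else 0))"
      by (rule sum_permutes_diag) auto
    also have "\<dots> = t ^ (CARD('n) - card J) * ((- 1) ^ card J * pminor (\<lambda>i j. P $ i $ j) J)"
      by (simp add: pminor_def sum_distrib_left prod_uminus card_Diff_subset mult_ac)
    finally show "(\<Sum>p | p permutes (UNIV::'n set). ?f p J) =
        t ^ (CARD('n) - card J) * ((- 1) ^ card J * pminor (\<lambda>i j. P $ i $ j) J)" .
  qed
  finally show ?thesis .
qed

lemma prod_diff_expand:
  fixes L :: "'n::finite \<Rightarrow> real"
  shows "(\<Prod>i\<in>UNIV. t - L i) = (\<Sum>J\<in>Pow UNIV. t ^ (CARD('n) - card J) * ((- 1) ^ card J * (\<Prod>i\<in>J. L i)))"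
proof -
  have "(\<Prod>i\<in>UNIV. t - L i) = (\<Prod>i\<in>UNIV. - L i + t)" by simp
  also have "\<dots> = (\<Sum>J\<in>Pow UNIV. (\<Prod>i\<in>J. - L i) * (\<Prod>i\<in>UNIV - J. t))"
    by (rule prod_add) simp
  also have "\<dots> = (\<Sum>J\<in>Pow UNIV. t ^ (CARD('n) - card J) * ((- 1) ^ card J * (\<Prod>i\<in>J. L i)))"
    by (rule sum.cong) (auto simp: prod_uminus card_Diff_subset)
  finally show ?thesis .
qed

text \<open>Vieta's formulas: up to the same sign, both sums are the coefficient of
  \<open>t ^ (CARD('n) - k)\<close> in the characteristic polynomial. For \<open>k\<close> above
  \<open>CARD('n)\<close> both are empty.\<close>

lemma eigenvalue_family_sum:
  fixes P :: "real^'n^'n"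
  assumes "eigenvalue_family P L"
  shows "(\<Sum>I\<in>{I::'n set. card I = k}. \<Prod>i\<in>I. L i) = (\<Sum>I\<in>{I. card I = k}. pminor (\<lambda>i j. P $ i $ j) I)"
proof (cases "k \<le> CARD('n)")
  case True
  have coeffs: "(\<Sum>J\<in>Pow (UNIV::'n set). t ^ (CARD('n) - card J) * ((- 1) ^ card J * g J)) =
      (\<Sum>m\<le>CARD('n). ((- 1) ^ (CARD('n) - m) * (\<Sum>J | card J = CARD('n) - m. g J)) * t ^ m)"
    for g :: "'n set \<Rightarrow> real" and t
  proof -
    have "(\<Sum>J\<in>Pow (UNIV::'n set). t ^ (CARD('n) - card J) * ((- 1) ^ card J * g J)) =
      (\<Sum>m\<le>CARD('n). \<Sum>J\<in>{J\<in>Pow (UNIV::'n set). CARD('n) - card J = m}. t ^ (CARD('n) - card J) * ((- 1) ^ card J * g J))"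
      by (rule sum.group[symmetric]) auto
    also have "\<dots> = (\<Sum>m\<le>CARD('n). ((- 1) ^ (CARD('n) - m) * (\<Sum>J | card J = CARD('n) - m. g J)) * t ^ m)"
    proof (rule sum.cong[OF refl])
      fix m assume "m \<in> {..CARD('n)}"
      then have "{J\<in>Pow (UNIV::'n set). CARD('n) - card J = m} = {J. card J = CARD('n) - m}"
        by (auto simp: card_mono)
      then show "(\<Sum>J\<in>{J\<in>Pow (UNIV::'n set). CARD('n) - card J = m}. t ^ (CARD('n) - card J) * ((- 1) ^ card J * g J)) =
          ((- 1) ^ (CARD('n) - m) * (\<Sum>J | card J = CARD('n) - m. g J)) * t ^ m"
        using \<open>m \<in> {..CARD('n)}\<close> by (simp add: sum_distrib_left sum_distrib_right mult_ac)
    qed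
    finally show ?thesis .
  qed
  have "\<forall>t. (\<Sum>m\<le>CARD('n). ((- 1) ^ (CARD('n) - m) * (\<Sum>J | card J = CARD('n) - m. \<Prod>i\<in>J. L i)) * t ^ m) =
     (\<Sum>m\<le>CARD('n). ((- 1) ^ (CARD('n) - m) * (\<Sum>J | card J = CARD('n) - m. pminor (\<lambda>i j. P $ i $ j) J)) * t ^ m)"
    using assms unfolding eigenvalue_family_def det_mat_diff prod_diff_expand coeffs by simp
  then have "\<forall>m\<le>CARD('n). (- 1) ^ (CARD('n) - m) * (\<Sum>J | card J = CARD('n) - m. \<Prod>i\<in>J. L i) =
      (- 1) ^ (CARD('n) - m) * (\<Sum>J | card J = CARD('n) - m. pminor (\<lambda>i j. P $ i $ j) J)"
    unfolding polyfun_eq_coeffs .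
  from this[rule_format, of "CARD('n) - k"] show ?thesis using True by simp
next
  case False
  then have "{I::'n set. card I = k} = {}"
    by (auto simp: not_le) (metis card_mono finite leD subset_UNIV)
  then show ?thesis by simp
qed

text \<open>One eigenvalue family is enough: the family picked by \<open>SOME\<close> may be another
  one, but its symmetric sums are fixed by the characteristic polynomial.\<close>

lemma sigma_sym_pminor:
  assumes "eigenvalue_family P L"
  shows "sigma_sym k P = (\<Sum>I\<in>{I. card I = k}. pminor (\<lambda>i j. P $ i $ j) I)"
  unfolding sigma_sym_def Let_def
  by (rule eigenvalue_family_sum) (rule someI[of "eigenvalue_family P", OF assms])

section \<open>Minors under scaling and their derivatives at a diagonal matrix\<close>

lemma pminor_scale:
  assumes "finite I"
  shows "pminor (\<lambda>i j. c i * c j * M i j) I = (\<Prod>i\<in>I. c i)\<^sup>2 * pminor M I"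
proof -
  \<comment> \<open>Each index of \<open>I\<close> occurs once as a row and once as a column, hence
    the square.\<close>
  have "(\<Prod>i\<in>I. c i * c (p i) * M i (p i)) = (\<Prod>i\<in>I. c i)\<^sup>2 * (\<Prod>i\<in>I. M i (p i))"
    if "p permutes I" for p
    using prod.permute[OF that, of c] by (simp add: prod.distrib power2_eq_square comp_def)
  then show ?thesis
    unfolding pminor_def sum_distrib_left by (intro sum.cong) (auto simp: mult_ac)
qed

lemma pminor_cong:
  assumes "\<And>i j. i \<in> I \<Longrightarrow> j \<in> I \<Longrightarrow> M i j = M' i j"
  shows "pminor M I = pminor M' I"
  unfolding pminor_def
  by (intro sum.cong prod.cong arg_cong2[of _ _ _ _ "(*)"] refl) (use assms permutes_in_image in fastforce)

lemma pminor_diag: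
  assumes "finite I" "\<And>i j. i \<in> I \<Longrightarrow> j \<in> I \<Longrightarrow> i \<noteq> j \<Longrightarrow> M i j = 0"
  shows "pminor M I = (\<Prod>i\<in>I. M i i)"
  using sum_permutes_diag[where s = "\<lambda>p. of_int (sign p)", OF assms(1) empty_subsetI assms(2)]
  by (simp add: pminor_def)

text \<open>Differentiating one factor leaves only the identity among the permutations.
  Differentiating the factors of rows \<open>i\<close> and \<open>j\<close> leaves the identity and
  the transposition of \<open>i\<close> and \<open>j\<close>, whose sign makes the second-order term
  a 2 by 2 determinant of first derivatives.\<close>

lemma pminor_second_derivative:
  fixes M M1 :: "'i \<Rightarrow> 'i \<Rightarrow> real \<Rightarrow> real"
  assumes "finite I" "0 \<in> T"
    and M: "\<And>i j t. i \<in> I \<Longrightarrow> j \<in> I \<Longrightarrow> t \<in> T \<Longrightarrow> (M i j has_real_derivative M1 i j t) (at t)"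
    and M1: "\<And>i j. i \<in> I \<Longrightarrow> j \<in> I \<Longrightarrow> (M1 i j has_real_derivative M2 i j) (at 0)"
    and offdiag: "\<And>i j. i \<in> I \<Longrightarrow> j \<in> I \<Longrightarrow> i \<noteq> j \<Longrightarrow> M i j 0 = 0"
    and diag: "\<And>i. i \<in> I \<Longrightarrow> M i i 0 = l i"
  shows "\<exists>D. (\<forall>t\<in>T. ((\<lambda>t. pminor (\<lambda>i j. M i j t) I) has_real_derivative D t) (at t)) \<and>
    D 0 = (\<Sum>i\<in>I. prod l (I - {i}) * M1 i i 0) \<and>
    (D has_real_derivative ((\<Sum>i\<in>I. prod l (I - {i}) * M2 i i) +
      (\<Sum>i\<in>I. \<Sum>j\<in>I - {i}. prod l (I - {i} - {j}) * (M1 i i 0 * M1 j j 0 - M1 i j 0 * M1 j i 0)))) (at 0)"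
proof -
  let ?P1 = "\<lambda>p i. \<Prod>j\<in>I - {i}. M j (p j) 0" and ?P2 = "\<lambda>p i j. \<Prod>m\<in>I - {i} - {j}. M m (p m) 0"
  let ?d = "\<lambda>i j. M1 i i 0 * M1 j j 0 - M1 i j 0 * M1 j i 0"
  define D where "D t = (\<Sum>p | p permutes I. of_int (sign p) *
    (\<Sum>i\<in>I. M1 i (p i) t * (\<Prod>j\<in>I - {i}. M j (p j) t)))" for t
  have diag_sum: "(\<Sum>p | p permutes I. s p * (\<Prod>j\<in>I - J. M j (p j) 0)) = (\<Sum>p | p permutes J. s p * prod l (I - J))"
    if "J \<subseteq> I" for J and s :: "_ \<Rightarrow> real"
    using sum_permutes_diag[where s = s and M = "\<lambda>i j. M i j 0", OF assms(1) that offdiag] diag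
    by (simp cong: prod.cong_simp)
  have one: "(\<Sum>p | p permutes I. of_int (sign p) * (a p * ?P1 p i)) = prod l (I - {i}) * a id"
    if i: "i \<in> I" for i and a :: "_ \<Rightarrow> real"
    using diag_sum[where J = "{i}" and s = "\<lambda>p. of_int (sign p) * a p"] i by (simp add: mult_ac)
  have two: "(\<Sum>p | p permutes I. of_int (sign p) * (a p * ?P2 p i j)) =
      prod l (I - {i} - {j}) * (a id - a (Transposition.transpose i j))"
    if ij: "i \<in> I" "j \<in> I" "i \<noteq> j" for i j and a :: "_ \<Rightarrow> real"
  proof -
    have ne: "id \<noteq> Transposition.transpose i j"
      using ij(3) by (metis id_apply transpose_apply_first)
    have set: "I - {i} - {j} = I - {i, j}" "{p. p permutes {i, j}} = {id, Transposition.transpose i j}"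
      by (auto simp: permutes_doubleton_iff)
    show ?thesis
      using diag_sum[where J = "{i, j}" and s = "\<lambda>p. of_int (sign p) * a p"] ij ne
      by (simp add: set sign_swap_id mult.assoc algebra_simps)
  qed
  have d1: "((\<lambda>t. pminor (\<lambda>i j. M i j t) I) has_real_derivative D t) (at t)" if "t \<in> T" for t
  proof -
    have pI: "p i \<in> I" if "p permutes I" "i \<in> I" for p i
      using that by (simp add: permutes_in_image)
    show ?thesis
      unfolding pminor_def D_def
      by (intro DERIV_sum DERIV_cmult has_field_derivative_prod M that) (auto intro: pI)
  qed
  have D0: "D 0 = (\<Sum>i\<in>I. prod l (I - {i}) * M1 i i 0)"
  proof -
    have "D 0 = (\<Sum>i\<in>I. \<Sum>p | p permutes I. of_int (sign p) * (M1 i (p i) 0 * ?P1 p i))"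
      unfolding D_def sum_distrib_left by (rule sum.swap)
    then show ?thesis using one[of _ "\<lambda>p. M1 _ (p _) 0"] by (simp add: one)
  qed
  define S where "S = (\<Sum>p | p permutes I. of_int (sign p) * (\<Sum>i\<in>I. M2 i (p i) * ?P1 p i +
     (\<Sum>j\<in>I - {i}. M1 j (p j) 0 * ?P2 p i j) * M1 i (p i) 0))"
  have d2: "(D has_real_derivative S) (at 0)"
    unfolding D_def S_def
  proof (intro DERIV_sum DERIV_cmult)
    fix p i assume p: "p \<in> {p. p permutes I}" and i: "i \<in> I"
    have pI: "p i \<in> I" if "i \<in> I" for i
      using that p by (simp add: permutes_in_image)
    show "((\<lambda>t. M1 i (p i) t * (\<Prod>j\<in>I - {i}. M j (p j) t)) has_real_derivative
       M2 i (p i) * ?P1 p i +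
       (\<Sum>j\<in>I - {i}. M1 j (p j) 0 * ?P2 p i j) * M1 i (p i) 0) (at 0)"
      by (intro DERIV_mult M1 has_field_derivative_prod M assms(2)) (use i pI in auto)
  qed
  have "S = (\<Sum>p | p permutes I. \<Sum>i\<in>I. of_int (sign p) * (M2 i (p i) * ?P1 p i) +
     (\<Sum>j\<in>I - {i}. of_int (sign p) * (M1 i (p i) 0 * M1 j (p j) 0 * ?P2 p i j)))"
    unfolding S_def by (simp add: sum_distrib_left sum_distrib_right algebra_simps)
  also have "\<dots> = (\<Sum>i\<in>I. (\<Sum>p | p permutes I. of_int (sign p) * (M2 i (p i) * ?P1 p i)) +
     (\<Sum>j\<in>I - {i}. \<Sum>p | p permutes I. of_int (sign p) * (M1 i (p i) 0 * M1 j (p j) 0 * ?P2 p i j)))"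
    by (subst sum.swap, rule sum.cong[OF refl], subst sum.distrib, subst (2) sum.swap) simp
  also have "\<dots> = (\<Sum>i\<in>I. prod l (I - {i}) * M2 i i +
     (\<Sum>j\<in>I - {i}. prod l (I - {i} - {j}) * ?d i j))"
  proof (intro sum.cong arg_cong2[of _ _ _ _ "(+)"] refl)
    fix i assume i: "i \<in> I"
    show "(\<Sum>p | p permutes I. of_int (sign p) * (M2 i (p i) * ?P1 p i)) = prod l (I - {i}) * M2 i i"
      using one[OF i, of "\<lambda>p. M2 i (p i)"] by simp
    fix j assume "j \<in> I - {i}"
    then have j: "j \<in> I" "i \<noteq> j" by auto
    then show "(\<Sum>p | p permutes I. of_int (sign p) * (M1 i (p i) 0 * M1 j (p j) 0 * ?P2 p i j)) =
      prod l (I - {i} - {j}) * ?d i j"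
      using two[OF i j, of "\<lambda>p. M1 i (p i) 0 * M1 j (p j) 0"] by simp
  qed
  also have "\<dots> = (\<Sum>i\<in>I. prod l (I - {i}) * M2 i i) +
      (\<Sum>i\<in>I. \<Sum>j\<in>I - {i}. prod l (I - {i} - {j}) * ?d i j)"
    by (rule sum.distrib)
  finally have "S = (\<Sum>i\<in>I. prod l (I - {i}) * M2 i i) +
      (\<Sum>i\<in>I. \<Sum>j\<in>I - {i}. prod l (I - {i} - {j}) * ?d i j)" .
  with d1 D0 d2 show ?thesis by blast
qed

subsection \<open>Orthonormal frames and diagonalisation\<close>

lemma orthonormal_frame_atD:
  assumes "orthonormal_frame_at x e"
  shows "e i \<bullet> e j = (if i = j then 1 else 0)" "e i \<bullet> x = 0" "x \<bullet> e i = 0" "norm (e i) = 1"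
  using assms unfolding orthonormal_frame_at_def by (auto simp: inner_commute norm_eq_1)

text \<open>A dimension count: \<open>CARD('n)\<close> orthonormal vectors span the hyperplane
  orthogonal to \<open>x\<close>.\<close>

lemma orthonormal_frame_at_expand:
  fixes x :: "'a::euclidean_space" and e :: "'n::finite \<Rightarrow> 'a"
  assumes fr: "orthonormal_frame_at x e" and x: "x \<noteq> 0" and "DIM('a) = CARD('n) + 1" and "v \<bullet> x = 0"
  shows "v = (\<Sum>i\<in>UNIV. (v \<bullet> e i) *\<^sub>R e i)"
proof -
  note on = orthonormal_frame_atD[OF fr]
  have "inj e" by (rule injI) (metis on(1) zero_neq_one)
  then have card: "card (range e) = CARD('n)" by (rule card_image)
  have "pairwise orthogonal (range e)"
    unfolding pairwise_def orthogonal_def using on by auto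
  moreover have "0 \<notin> range e"
    by (metis imageE inner_zero_left on(1) zero_neq_one)
  ultimately have ind: "independent (range e)" by (rule pairwise_orthogonal_independent)
  have "{v. x \<bullet> v = 0} \<subseteq> span (range e)"
    by (rule card_ge_dim_independent[OF _ ind])
       (use on dim_hyperplane[OF x] assms(3) in \<open>auto simp: card inner_commute\<close>)
  then have "v \<in> span (range e)" using assms(4) by (auto simp: inner_commute)
  then obtain c where c: "v = (\<Sum>y\<in>range e. c y *\<^sub>R y)"
    using span_finite[of "range e"] by auto
  then have v: "v = (\<Sum>i\<in>UNIV. c (e i) *\<^sub>R e i)"
    by (simp add: sum.reindex[OF \<open>inj e\<close>])
  have "v \<bullet> e j = c (e j)" for j
    by (subst v) (simp add: inner_sum_left on if_distrib cong: if_cong)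
  then show ?thesis using v by simp
qed

section \<open>Bilinear forms in orthonormal frames\<close>

definition qmat :: "('n \<Rightarrow> 'a::euclidean_space) \<Rightarrow> ('a \<Rightarrow> 'a \<Rightarrow> real) \<Rightarrow> real^'n^'n::finite" where
  "qmat e Q = (\<chi> i j. Q (e i) (e j))"

lemma bilinear_expand:
  fixes Q :: "'a::euclidean_space \<Rightarrow> 'a \<Rightarrow> real"
  assumes "bilinear Q"
  shows "Q (\<Sum>i\<in>I. a i *\<^sub>R e i) (\<Sum>j\<in>J. b j *\<^sub>R e' j) = (\<Sum>i\<in>I. \<Sum>j\<in>J. a i * b j * Q (e i) (e' j))"
proof -
  have l: "linear (\<lambda>u. Q u w)" "linear (Q w)" for w using assms by (auto simp: bilinear_def)
  show ?thesis
    by (simp add: linear_sum[OF l(1)] linear_sum[OF l(2)] linear_scale[OF l(1)] linear_scale[OF l(2)] sum_distrib_left mult_ac)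
       (rule sum.swap)
qed

text \<open>A change of frame is conjugation by an orthogonal matrix. The frames of the theorem are
  chosen separately at each point, and this invariance allows them to be exchanged for frames
  adapted to the proof.\<close>

lemma det_qmat_frame:
  fixes x :: "'a::euclidean_space" and e b :: "'n::finite \<Rightarrow> 'a"
  assumes e: "orthonormal_frame_at x e" and b: "orthonormal_frame_at x b"
    and x: "x \<noteq> 0" "DIM('a) = CARD('n) + 1" and Q: "bilinear Q"
  shows "det (mat t - qmat e Q) = det (mat t - qmat b Q)"
proof -
  note one = orthonormal_frame_atD[OF e]
  define O' where "O' = (\<chi> i j. e i \<bullet> b j)"
  have exp: "e i = (\<Sum>j\<in>UNIV. (e i \<bullet> b j) *\<^sub>R b j)" for i
    by (rule orthonormal_frame_at_expand[OF b x one(2)])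
  have "(\<Sum>k\<in>UNIV. (e i \<bullet> b k) * (e j \<bullet> b k)) = e i \<bullet> e j" for i j
    by (subst (3) exp) (simp add: inner_sum_right mult.commute)
  then have OO: "O' ** transpose O' = mat 1"
    by (simp add: O'_def matrix_matrix_mult_def transpose_def mat_def vec_eq_iff one)
  have "Q (e i) (e j) = (\<Sum>k\<in>UNIV. \<Sum>l\<in>UNIV. (e i \<bullet> b k) * (e j \<bullet> b l) * Q (b k) (b l))" for i j
    by (subst (1) exp, subst (2) exp, rule bilinear_expand[OF Q])
  then have "qmat e Q = O' ** qmat b Q ** transpose O'"
    by (simp add: O'_def matrix_matrix_mult_def transpose_def qmat_def vec_eq_iff sum_distrib_right)
       (subst sum.swap, simp add: mult_ac)
  moreover have "mat t = O' ** mat t ** transpose O'"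
  proof -
    have "O' ** mat t = t *\<^sub>R O'"
      by (simp add: matrix_matrix_mult_def mat_def vec_eq_iff if_distrib cong: if_cong)
    moreover have "(t *\<^sub>R O') ** transpose O' = t *\<^sub>R (O' ** transpose O')"
      by (simp add: vec_eq_iff matrix_matrix_mult_def sum_distrib_left mult_ac)
    ultimately show ?thesis
      by (simp add: OO) (simp add: vec_eq_iff mat_def)
  qed
  moreover have mult_diff: "A ** (B - C) = A ** B - A ** C" "(B - C) ** A = B ** A - C ** A"
    for A B C :: "real^'n^'n"
    by (simp_all add: vec_eq_iff matrix_matrix_mult_def right_diff_distrib left_diff_distrib sum_subtractf)
  ultimately have "mat t - qmat e Q = O' ** (mat t - qmat b Q) ** transpose O'"
    by (simp add: mult_diff)
  then have "det (mat t - qmat e Q) = det (O' ** transpose O') * det (mat t - qmat b Q)"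
    by (simp add: det_mul)
  then show ?thesis by (simp add: OO)
qed

lemma quadratic_nonneg_imp_zero:
  fixes c d :: real
  assumes "\<And>t. 0 \<le> 2 * t * c + t\<^sup>2 * d" shows "c = 0"
proof (rule ccontr)
  assume "c \<noteq> 0"
  \<comment> \<open>The minimiser of the quadratic after \<open>d\<close> is replaced by the
    positive upper bound \<open>1 + \<bar>d\<bar>\<close>; the value there is
    \<open>- c\<^sup>2 / (1 + \<bar>d\<bar>)\<close>.\<close>
  define t where "t = - c / (1 + \<bar>d\<bar>)"
  have "2 * t * c + t\<^sup>2 * d \<le> 2 * t * c + t\<^sup>2 * (1 + \<bar>d\<bar>)"
    by (intro add_left_mono mult_left_mono) auto
  also have "\<dots> = t * (2 * c + t * (1 + \<bar>d\<bar>))"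
    by (simp add: power2_eq_square algebra_simps)
  also have "t * (1 + \<bar>d\<bar>) = - c"
    by (simp add: t_def add_nonneg_eq_0_iff)
  also have "t * (2 * c + - c) < 0"
    using \<open>c \<noteq> 0\<close> by (auto simp: t_def zero_less_divide_iff zero_less_mult_iff add_pos_nonneg)
  finally show False using assms[of t] by linarith
qed

text \<open>Spectral theorem by induction on the dimension: a minimiser \<open>v\<close> of
  \<open>Q\<close> on the unit sphere of \<open>S\<close> satisfies \<open>Q v w = 0\<close> for
  every \<open>w\<close> in \<open>S\<close> orthogonal to \<open>v\<close>, by the first variation,
  and the orthogonal complement of \<open>v\<close> in \<open>S\<close> is treated in the same
  way.\<close>

lemma diagonalize_on_subspace:
  fixes Q :: "'a::euclidean_space \<Rightarrow> 'a \<Rightarrow> real"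
  assumes Q: "bilinear Q" and sym: "\<And>u v. Q u v = Q v u"
    and "subspace S" "dim S = m"
  shows "\<exists>B. B \<subseteq> S \<and> finite B \<and> card B = m \<and> (\<forall>b\<in>B. norm b = 1) \<and>
    (\<forall>b\<in>B. \<forall>c\<in>B. b \<noteq> c \<longrightarrow> b \<bullet> c = 0 \<and> Q b c = 0)"
  using assms(3,4)
proof (induction m arbitrary: S)
  case 0
  then show ?case by (intro exI[of _ "{}"]) auto
next
  case (Suc m)
  have lin: "linear (\<lambda>u. Q u w)" "linear (Q w)" for w using Q by (auto simp: bilinear_def)
  interpret Q: bounded_bilinear Q using Q by (simp add: bilinear_conv_bounded_bilinear)
  let ?K = "S \<inter> sphere 0 1"
  obtain v0 where "v0 \<in> S" "v0 \<noteq> 0"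
    using Suc.prems(2) by (metis Zero_not_Suc dim_eq_0 subsetI singleton_iff)
  then have "(1 / norm v0) *\<^sub>R v0 \<in> ?K"
    using Suc.prems(1) by (simp add: subspace_scale)
  then have "?K \<noteq> {}" by blast
  moreover have "compact ?K"
    using closed_subspace[OF Suc.prems(1)] by (intro closed_Int_compact) auto
  moreover have "continuous_on ?K (\<lambda>v. Q v v)" by (intro Q.continuous_on continuous_on_id)
  ultimately obtain v where "v \<in> ?K" and min: "\<And>u. u \<in> ?K \<Longrightarrow> Q v v \<le> Q u u"
    using continuous_attains_inf[of ?K "\<lambda>v. Q v v"] by blast
  then have v: "v \<in> S" "norm v = 1" by auto
  have ge: "Q v v * (norm u)\<^sup>2 \<le> Q u u" if "u \<in> S" for u
  proof (cases "u = 0")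
    case False
    then have "(1 / norm u) *\<^sub>R u \<in> ?K" using that Suc.prems(1) by (simp add: subspace_scale)
    from min[OF this] have "Q v v \<le> Q u u / (norm u)\<^sup>2"
      by (simp add: linear_scale[OF lin(1)] linear_scale[OF lin(2)] power2_eq_square)
    then show ?thesis using False by (simp add: pos_le_divide_eq)
  qed (simp add: Q.zero_left)
  have orth: "Q v w = 0" if w: "w \<in> S" "w \<bullet> v = 0" for w
  proof (rule quadratic_nonneg_imp_zero)
    fix t
    have "v + t *\<^sub>R w \<in> S" using v w Suc.prems(1) by (simp add: subspace_add subspace_scale)
    from ge[OF this] have "Q v v * (norm (v + t *\<^sub>R w))\<^sup>2 \<le> Q (v + t *\<^sub>R w) (v + t *\<^sub>R w)" .
    moreover have "(norm (v + t *\<^sub>R w))\<^sup>2 = 1 + t\<^sup>2 * (norm w)\<^sup>2"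
      using v w unfolding power2_norm_eq_inner
      by (simp add: inner_add_left inner_add_right inner_commute power2_eq_square norm_eq_1)
    moreover have "Q (v + t *\<^sub>R w) (v + t *\<^sub>R w) = Q v v + 2 * t * Q v w + t\<^sup>2 * Q w w"
      using sym[of w v] by (simp add: Q.add_left Q.add_right Q.scaleR_left Q.scaleR_right power2_eq_square algebra_simps)
    ultimately show "0 \<le> 2 * t * Q v w + t\<^sup>2 * (Q w w - Q v v * (norm w)\<^sup>2)"
      by (simp add: algebra_simps)
  qed
  let ?S' = "{y \<in> S. \<forall>x\<in>span {v}. orthogonal x y}"
  have "dim ?S' + dim (span {v}) = dim S"
    by (rule dim_subspace_orthogonal_to_vectors) (use v Suc.prems(1) in \<open>auto simp: span_minimal\<close>)
  moreover have "dim (span {v}) = 1" using v by (subst dim_span, subst dim_singleton) auto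
  ultimately have dim: "dim ?S' = m" using Suc.prems(2) by simp
  have S': "?S' = {y \<in> S. y \<bullet> v = 0}"
    by (auto simp: orthogonal_def span_singleton inner_commute dest: bspec[of _ _ v])
  have "subspace ?S'"
    unfolding S' using Suc.prems(1) by (auto simp: subspace_def inner_add_left)
  from Suc.IH[OF this dim] obtain B where B: "B \<subseteq> ?S'" "finite B" "card B = m" "\<forall>b\<in>B. norm b = 1"
    "\<forall>b\<in>B. \<forall>c\<in>B. b \<noteq> c \<longrightarrow> b \<bullet> c = 0 \<and> Q b c = 0" by blast
  have "v \<notin> B" using B(1) v unfolding S' by auto
  moreover have "Q v b = 0" "Q b v = 0" "b \<bullet> v = 0" "v \<bullet> b = 0" if "b \<in> B" for b
    using that B(1) orth[of b] sym[of b v] unfolding S' by (auto simp: inner_commute)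
  ultimately show ?case
    using B v unfolding S' by (intro exI[of _ "insert v B"]) auto
qed

lemma eigenframe_exists:
  fixes x :: "'a::euclidean_space" and Q :: "'a \<Rightarrow> 'a \<Rightarrow> real"
  assumes Q: "bilinear Q" and sym: "\<And>u v. Q u v = Q v u"
    and x: "x \<noteq> 0" "DIM('a) = CARD('n) + 1"
  obtains b :: "'n::finite \<Rightarrow> 'a" where "orthonormal_frame_at x b" "\<And>i j. i \<noteq> j \<Longrightarrow> Q (b i) (b j) = 0"
proof -
  have "subspace {v. x \<bullet> v = 0}" by (rule subspace_hyperplane)
  moreover have "dim {v. x \<bullet> v = 0} = CARD('n)" using dim_hyperplane[OF x(1)] x(2) by simp
  ultimately obtain B where B: "B \<subseteq> {v. x \<bullet> v = 0}" "finite B" "card B = CARD('n)" "\<forall>b\<in>B. norm b = 1"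
    "\<forall>b\<in>B. \<forall>c\<in>B. b \<noteq> c \<longrightarrow> b \<bullet> c = 0 \<and> Q b c = 0"
    using diagonalize_on_subspace[OF Q sym, of "{v. x \<bullet> v = 0}" "CARD('n)"] by blast
  then obtain b where b: "bij_betw b (UNIV::'n set) B"
    using finite_same_card_bij[of "UNIV::'n set" B] by auto
  then have inB: "b i \<in> B" and ne: "b i = b j \<longleftrightarrow> i = j" for i j
    by (auto simp: bij_betw_def inj_on_eq_iff)
  have "orthonormal_frame_at x b"
    unfolding orthonormal_frame_at_def
  proof (intro conjI allI)
    fix i j
    show "b i \<bullet> x = 0" using B(1) inB[of i] by (auto simp: inner_commute)
    show "b i \<bullet> b j = (if i = j then 1 else 0)"
      using B(4,5) inB[of i] inB[of j] ne[of i j] by (auto simp: norm_eq_1)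
  qed
  moreover have "Q (b i) (b j) = 0" if "i \<noteq> j" for i j using B inB ne that by auto
  ultimately show ?thesis using that by blast
qed

text \<open>An eigenframe supplies the eigenvalue family. The result is a polynomial in the entries
  with respect to any frame \<open>b\<close>, so sigma_k can be differentiated without following
  eigenvalues.\<close>

lemma sigma_sym_qmat:
  fixes x :: "'a::euclidean_space" and e b :: "'n::finite \<Rightarrow> 'a"
  assumes "orthonormal_frame_at x e" "orthonormal_frame_at x b"
    and x: "x \<noteq> 0" "DIM('a) = CARD('n) + 1" and Q: "bilinear Q" "\<And>u v. Q u v = Q v u"
  shows "sigma_sym k (qmat e Q) = (\<Sum>I\<in>{I. card I = k}. pminor (\<lambda>i j. Q (b i) (b j)) I)"
proof -
  obtain d :: "'n \<Rightarrow> 'a" where d: "orthonormal_frame_at x d" "\<And>i j. i \<noteq> j \<Longrightarrow> Q (d i) (d j) = 0"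
    using eigenframe_exists[OF Q x] by metis
  let ?L = "\<lambda>i. Q (d i) (d i)"
  have "det (mat t - qmat d Q) = (\<Prod>i\<in>UNIV. t - ?L i)" for t
    by (subst det_diagonal) (auto simp: mat_def qmat_def d)
  then have ev: "eigenvalue_family (qmat f Q) ?L" if "orthonormal_frame_at x f" for f
    unfolding eigenvalue_family_def using det_qmat_frame[OF that d(1) x Q(1)] by simp
  have "sigma_sym k (qmat e Q) = (\<Sum>I\<in>{I. card I = k}. prod ?L I)"
    unfolding sigma_sym_pminor[OF ev[OF assms(1)]] eigenvalue_family_sum[OF ev[OF assms(1)]] ..
  also have "\<dots> = (\<Sum>I\<in>{I. card I = k}. pminor (\<lambda>i j. Q (b i) (b j)) I)"
    unfolding eigenvalue_family_sum[OF ev[OF assms(2)]]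
    by (intro sum.cong refl pminor_cong) (simp add: qmat_def)
  finally show ?thesis .
qed

lemma qmat_quadratic:
  assumes "bilinear Q"
  shows "v \<bullet> (qmat e Q *v v) = Q (\<Sum>i\<in>UNIV. (v $ i) *\<^sub>R e i) (\<Sum>i\<in>UNIV. (v $ i) *\<^sub>R e i)"
  by (simp add: bilinear_expand[OF assms] inner_vec_def matrix_vector_mult_def qmat_def sum_distrib_left mult_ac)

lemma pos_semidef_qmat:
  fixes x :: "'a::euclidean_space" and e :: "'n::finite \<Rightarrow> 'a"
  assumes e: "orthonormal_frame_at x e" and x: "x \<noteq> 0" "DIM('a) = CARD('n) + 1" and Q: "bilinear Q"
    and "pos_semidef (qmat e Q)" "u \<bullet> x = 0"
  shows "0 \<le> Q u u"
proof -
  have "u = (\<Sum>i\<in>UNIV. ((\<chi> i. u \<bullet> e i) $ i) *\<^sub>R e i)"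
    using orthonormal_frame_at_expand[OF e x assms(6)] by simp
  with qmat_quadratic[OF Q, of "\<chi> i. u \<bullet> e i" e] assms(5) show ?thesis
    unfolding pos_semidef_def by metis
qed

lemma pos_def_qmat:
  fixes x :: "'a::euclidean_space" and e :: "'n::finite \<Rightarrow> 'a"
  assumes e: "orthonormal_frame_at x e" and Q: "bilinear Q"
    and pos: "\<And>u. u \<bullet> x = 0 \<Longrightarrow> u \<noteq> 0 \<Longrightarrow> 0 < Q u u"
  shows "pos_def (qmat e Q)"
  unfolding pos_def_def
proof (intro allI impI)
  fix v :: "real^'n" assume "v \<noteq> 0"
  note on = orthonormal_frame_atD[OF e]
  let ?u = "\<Sum>i\<in>UNIV. (v $ i) *\<^sub>R e i"
  have "?u \<bullet> e j = v $ j" for j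
    by (simp add: inner_sum_left on if_distrib cong: if_cong)
  then have "?u \<noteq> 0" using \<open>v \<noteq> 0\<close> by (metis inner_zero_left vec_eq_iff zero_index)
  moreover have "?u \<bullet> x = 0" by (simp add: inner_sum_left on)
  ultimately show "0 < v \<bullet> (qmat e Q *v v)"
    unfolding qmat_quadratic[OF Q] by (rule pos[rotated])
qed

subsection \<open>Homogeneous extensions\<close>

definition grad :: "('a::euclidean_space \<Rightarrow> real) \<Rightarrow> 'a \<Rightarrow> 'a" where
  "grad F x = (\<Sum>b\<in>Basis. dd b F x *\<^sub>R b)"

lemma grad_inner:
  assumes "F differentiable (at x)" shows "grad F x \<bullet> v = dd v F x"
proof -
  have lin: "linear (\<lambda>v. dd v F x)"
    by (rule has_derivative_linear[OF dd_has_derivative[OF assms]])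
  have "dd v F x = dd (\<Sum>b\<in>Basis. (v \<bullet> b) *\<^sub>R b) F x" by (simp add: euclidean_representation)
  also have "\<dots> = grad F x \<bullet> v"
    by (simp add: linear_sum[OF lin] linear_scale[OF lin] grad_def inner_sum_left inner_commute[of v] mult.commute)
  finally show ?thesis ..
qed

lemma grad_norm: "(norm (grad F x))\<^sup>2 = (\<Sum>b\<in>Basis. (dd b F x)\<^sup>2)"
proof -
  have "grad F x \<bullet> b = dd b F x" if "b \<in> Basis" for b
    using that by (simp add: grad_def)
  then show ?thesis
    unfolding power2_norm_eq_inner by (subst euclidean_inner) (simp add: power2_eq_square)
qed

definition hom_ext :: "('a::euclidean_space \<Rightarrow> real) \<Rightarrow> 'a \<Rightarrow> real" where
  "hom_ext g x = norm x * g (x /\<^sub>R norm x)"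

lemma hom_ext_scale: "0 < c \<Longrightarrow> hom_ext g (c *\<^sub>R x) = c * hom_ext g x"
  by (cases "x = 0") (simp_all add: hom_ext_def field_simps)

lemma hom_ext_sphere: "norm x = 1 \<Longrightarrow> hom_ext g x = g x"
  by (simp add: hom_ext_def)

lemma open_punctured: "open (- {0::'a::euclidean_space})"
  by (simp add: open_Compl)

lemma Ck_on_norm_powr: "Ck_on m (- {0::'a::euclidean_space}) (\<lambda>x. (x \<bullet> x) powr r)"
proof (rule Ck_on_powr[OF open_punctured])
  have "Ck_on m (- {0::'a}) (\<lambda>x. \<Sum>b\<in>Basis. (x \<bullet> b) * (x \<bullet> b))"
    by (intro Ck_on_sum[OF open_punctured] Ck_on_mult[OF open_punctured] Ck_on_inner[OF open_punctured])
  then show "Ck_on m (- {0::'a}) (\<lambda>x. x \<bullet> x)"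
    by (simp add: euclidean_inner[symmetric])
qed simp

lemma norm_conv_powr: "norm x = (x \<bullet> x) powr (1/2)"
  by (simp add: powr_half_sqrt norm_eq_sqrt_inner)

lemma inverse_norm_conv_powr: "x \<noteq> 0 \<Longrightarrow> inverse (norm x) = (x \<bullet> x) powr (- 1/2)"
  by (simp add: powr_minus powr_half_sqrt norm_eq_sqrt_inner)

text \<open>Near a point the extension is \<open>norm y * F (y /\<^sub>R norm y)\<close> with a
  smooth local extension \<open>F\<close>; the norm and its inverse are smooth as powers of
  \<open>y \<bullet> y\<close>.\<close>

lemma Ck_on_hom_ext:
  fixes g :: "'a::euclidean_space \<Rightarrow> real"
  assumes "smooth_on_sphere g" shows "Ck_on m (- {0}) (hom_ext g)"
proof (rule Ck_on_local[OF open_punctured])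
  fix x :: 'a assume x: "x \<in> - {0}"
  let ?n = "\<lambda>y::'a. y /\<^sub>R norm y"
  from x have "?n x \<in> sphere 0 1" by simp
  then obtain U F where U: "open U" "?n x \<in> U" "Ck_on m U F" "\<forall>y\<in>U \<inter> sphere 0 1. F y = g y"
    using assms unfolding smooth_on_sphere_def by metis
  define V where "V = (- {0}) \<inter> ?n -` U"
  have "continuous_on (- {0}) ?n" by (auto intro!: continuous_intros)
  then have V: "open V" unfolding V_def
    by (rule continuous_open_preimage[OF _ open_punctured U(1)])
  have nb: "Ck_on m V (\<lambda>y. ?n y \<bullet> b)" for b
  proof -
    have "Ck_on m (- {0}) (\<lambda>y. (y \<bullet> y) powr (- 1/2) * (y \<bullet> b))"
      by (intro Ck_on_mult[OF open_punctured] Ck_on_inner[OF open_punctured] Ck_on_norm_powr)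
    then have "Ck_on m (- {0}) (\<lambda>y. ?n y \<bullet> b)"
      by (rule Ck_on_cong[OF open_punctured, rotated]) (simp add: inverse_norm_conv_powr)
    then show ?thesis by (rule Ck_on_subset[OF V open_punctured, rotated]) (simp add: V_def)
  qed
  have "Ck_on m V (\<lambda>y. F (?n y))"
    by (rule Ck_on_compose[OF U(1) V U(3)]) (auto simp: V_def intro: nb[simplified])
  moreover have "Ck_on m V norm"
  proof -
    have "Ck_on m (- {0::'a}) norm"
      by (rule Ck_on_cong[OF open_punctured _ Ck_on_norm_powr]) (rule norm_conv_powr[symmetric])
    then show ?thesis by (rule Ck_on_subset[OF V open_punctured, rotated]) (simp add: V_def)
  qed
  ultimately have "Ck_on m V (\<lambda>y. norm y * F (?n y))" by (intro Ck_on_mult[OF V])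
  then have "Ck_on m V (hom_ext g)"
    by (rule Ck_on_cong[OF V, rotated]) (use U(4) in \<open>auto simp: V_def hom_ext_def\<close>)
  moreover have "x \<in> V" using x U(2) by (simp add: V_def)
  ultimately show "\<exists>U. open U \<and> x \<in> U \<and> Ck_on m U (hom_ext g)" using V by blast
qed

text \<open>The neighbourhood is shrunk until the local extension of \<open>f\<close> is positive on
  all of it.\<close>

lemma smooth_on_sphere_powr:
  fixes f :: "'a::euclidean_space \<Rightarrow> real"
  assumes "smooth_on_sphere f" "\<And>x. x \<in> sphere 0 1 \<Longrightarrow> 0 < f x"
  shows "smooth_on_sphere (\<lambda>x. f x powr r)"
  unfolding smooth_on_sphere_def
proof
  fix x :: 'a assume x: "x \<in> sphere 0 1"
  then obtain U F where U: "open U" "x \<in> U" "\<And>m. Ck_on m U F" "\<forall>y\<in>U \<inter> sphere 0 1. F y = f y"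
    using assms(1) unfolding smooth_on_sphere_def by metis
  define V where "V = U \<inter> F -` {0<..}"
  have V: "open V" unfolding V_def
    using Ck_on_continuous[OF U(1,3)] continuous_open_preimage[OF _ U(1) open_greaterThan] by blast
  have "x \<in> V" using x U assms(2)[OF x] by (simp add: V_def)
  moreover have "Ck_on m V (\<lambda>y. F y powr r)" for m
    by (intro Ck_on_powr[OF V] Ck_on_subset[OF V U(1) _ U(3)]) (auto simp: V_def)
  ultimately show "\<exists>U F. open U \<and> x \<in> U \<and> (\<forall>m. Ck_on m U F) \<and> (\<forall>y\<in>U \<inter> sphere 0 1. F y = f y powr r)"
    using V U(4) by (intro exI[of _ V] exI[of _ "\<lambda>y. F y powr r"]) (auto simp: V_def)
qed

subsection \<open>Derivatives within the sphere\<close>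

text \<open>A derivative within the sphere is arbitrary in the normal direction, so
  \<open>frechet_derivative\<close> there is an unspecified choice. Composition with the great
  circle through \<open>x\<close> in a tangent direction determines its value in that
  direction.\<close>

lemma has_derivative_within_sphere_unique:
  fixes X :: "'a::euclidean_space \<Rightarrow> 'b::real_normed_vector"
  assumes D: "(X has_derivative D) (at x within sphere 0 1)" "(X has_derivative D') (at x within sphere 0 1)"
    and x: "norm x = 1" and v: "v \<bullet> x = 0"
  shows "D v = D' v"
proof (cases "v = 0")
  case True
  then show ?thesis using D by (simp add: linear_0 has_derivative_linear)
next
  case False
  define u where "u = v /\<^sub>R norm v"
  have u: "norm u = 1" "u \<bullet> x = 0" "v = norm v *\<^sub>R u" using False v by (auto simp: u_def)
  define c where "c t = cos t *\<^sub>R x + sin t *\<^sub>R u" for t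
  have "c t \<bullet> c t = (cos t)\<^sup>2 + (sin t)\<^sup>2" for t
  proof -
    have "x \<bullet> x = 1" "u \<bullet> u = 1" "x \<bullet> u = 0" using u x by (simp_all add: norm_eq_1 inner_commute)
    then show ?thesis using u(2)
      by (simp add: c_def inner_add_left inner_add_right power2_eq_square)
  qed
  then have "norm (c t) = 1" for t by (simp add: norm_eq_1)
  then have sph: "range c \<subseteq> sphere 0 1" by auto
  have c': "(c has_derivative (\<lambda>s. s *\<^sub>R u)) (at 0)"
    unfolding c_def by (rule has_derivative_eq_rhs, (rule derivative_intros)+) (simp add: fun_eq_iff)
  have *: "((X \<circ> c) has_derivative (E \<circ> (\<lambda>s. s *\<^sub>R u))) (at 0)"
    if "(X has_derivative E) (at x within sphere 0 1)" for E
  proof (rule diff_chain_within[OF c'])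
    show "(X has_derivative E) (at (c 0) within range c)"
      using has_derivative_subset[OF that sph] by (simp add: c_def)
  qed
  have "D \<circ> (\<lambda>s. s *\<^sub>R u) = D' \<circ> (\<lambda>s. s *\<^sub>R u)"
    by (rule has_derivative_unique[OF *[OF D(1)] *[OF D(2)]])
  from fun_cong[OF this, of "norm v"] have "D (norm v *\<^sub>R u) = D' (norm v *\<^sub>R u)" by simp
  then show ?thesis using u by simp
qed

section \<open>Homogeneity, Euler's relation and the passage from the sphere to Euclidean
  space\<close>

lemma hom_dd_scale:
  assumes K: "\<And>x. x \<noteq> 0 \<Longrightarrow> K differentiable (at x)"
    and hom: "\<And>x. x \<noteq> 0 \<Longrightarrow> K (c *\<^sub>R x) = s * K x" and "0 < c" "x \<noteq> 0"
  shows "dd v K (c *\<^sub>R x) = s / c * dd v K x"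
proof -
  have "c *\<^sub>R x \<noteq> 0" using assms by simp
  have "((\<lambda>y. K (c *\<^sub>R y)) has_derivative (\<lambda>v. dd (c *\<^sub>R v) K (c *\<^sub>R x))) (at x)"
    by (rule has_derivative_compose[of "\<lambda>y. c *\<^sub>R y" "\<lambda>v. c *\<^sub>R v",
          OF _ dd_has_derivative[OF K[OF \<open>c *\<^sub>R x \<noteq> 0\<close>]]])
       (auto intro!: derivative_eq_intros)
  then have "dd v (\<lambda>y. K (c *\<^sub>R y)) x = dd (c *\<^sub>R v) K (c *\<^sub>R x)" by (rule dd_eqI)
  also have "\<dots> = c * dd v K (c *\<^sub>R x)"
    using linear_scale[OF has_derivative_linear[OF dd_has_derivative[OF K[OF \<open>c *\<^sub>R x \<noteq> 0\<close>]]]] by simp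
  also have "dd v (\<lambda>y. K (c *\<^sub>R y)) x = dd v (\<lambda>y. s * K y) x"
    by (rule dd_cong[OF open_punctured]) (use hom assms(4) in auto)
  also have "\<dots> = s * dd v K x"
    by (rule dd_eqI) (intro has_derivative_mult_right dd_has_derivative K assms)
  finally show ?thesis using assms(3) by (simp add: field_simps)
qed

text \<open>Differentiate the scaling law in \<open>c\<close> at 1. The scaling functions in use are
  the identity, the constant 1 and \<open>inverse\<close>, that is, degrees 1, 0 and -1.\<close>

lemma hom_euler:
  assumes K: "K differentiable (at x)"
    and hom: "\<And>c. 0 < c \<Longrightarrow> K (c *\<^sub>R x) = s c * K x" and s: "(s has_real_derivative s') (at 1)"
  shows "dd x K x = s' * K x"
proof -
  have lin: "linear (\<lambda>v. dd v K x)" by (rule has_derivative_linear[OF dd_has_derivative[OF K]])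
  have "(K has_derivative (\<lambda>v. dd v K x)) (at (1 *\<^sub>R x))" using dd_has_derivative[OF K] by simp
  then have "((\<lambda>c. K (c *\<^sub>R x)) has_derivative (\<lambda>t. dd (t *\<^sub>R x) K x)) (at 1)"
    by (rule has_derivative_compose[rotated]) (auto intro!: derivative_eq_intros)
  then have "((\<lambda>c. K (c *\<^sub>R x)) has_real_derivative dd x K x) (at 1)"
    by (simp add: has_field_derivative_def linear_scale[OF lin] mult_commute_abs)
  moreover have "((\<lambda>c. s c * K x) has_real_derivative s' * K x) (at 1)"
    by (intro DERIV_cmult_right s)
  then have "((\<lambda>c. K (c *\<^sub>R x)) has_real_derivative s' * K x) (at 1)"
    by (rule has_field_derivative_transform_within_open[of _ _ _ "{0<..}"]) (auto simp: hom)
  ultimately show ?thesis by (rule DERIV_unique)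
qed

locale homogeneous_extension =
  fixes g :: "'a::euclidean_space \<Rightarrow> real"
  assumes smooth: "smooth_on_sphere g"
begin

abbreviation "G \<equiv> hom_ext g"

lemma Ck: "Ck_on m (- {0}) G"
  by (rule Ck_on_hom_ext[OF smooth])

lemma Ck1: "Ck_on m (- {0}) (dd v G)"
  by (rule Ck_on_dd[OF open_punctured Ck])

lemma Ck2: "Ck_on m (- {0}) (dd u (dd v G))"
  by (rule Ck_on_dd[OF open_punctured Ck1])

lemma Ck3: "Ck_on m (- {0}) (dd w (dd u (dd v G)))"
  by (rule Ck_on_dd[OF open_punctured Ck2])

lemma Ck_diff: "Ck_on (Suc m) (- {0}) K \<Longrightarrow> x \<noteq> 0 \<Longrightarrow> K differentiable (at x)"
  by (simp add: Ck_on_Suc[OF open_punctured])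

lemmas diff = Ck_diff[OF Ck] Ck_diff[OF Ck1] Ck_diff[OF Ck2]

lemma grad_inner_G: "x \<noteq> 0 \<Longrightarrow> grad G x \<bullet> v = dd v G x"
  by (rule grad_inner[OF diff(1)])

lemma commute: "x \<noteq> 0 \<Longrightarrow> dd u (dd v G) x = dd v (dd u G) x"
  by (rule dd_commute[OF open_punctured Ck]) simp

lemma bilinear: assumes "x \<noteq> 0" shows "bilinear (\<lambda>u v. dd u (dd v G) x)"
proof -
  have "linear (\<lambda>u. dd u (dd v G) x)" for v
    by (rule dd_linear[OF open_punctured Ck1]) (use assms in simp)
  moreover from this have "linear (\<lambda>v. dd u (dd v G) x)" for u
    by (subst commute[OF assms])
  ultimately show ?thesis unfolding bilinear_def by blast
qed

lemma dd_scale: "0 < c \<Longrightarrow> x \<noteq> 0 \<Longrightarrow> dd v G (c *\<^sub>R x) = dd v G x"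
  using hom_dd_scale[of G c c x v] diff(1) by (simp add: hom_ext_scale)

lemma dd2_scale: "0 < c \<Longrightarrow> x \<noteq> 0 \<Longrightarrow> dd u (dd v G) (c *\<^sub>R x) = dd u (dd v G) x / c"
  using hom_dd_scale[of "dd v G" c 1 x u] diff(2) by (simp add: dd_scale)

lemma grad_scale: "0 < c \<Longrightarrow> x \<noteq> 0 \<Longrightarrow> grad G (c *\<^sub>R x) = grad G x"
  by (simp add: grad_def dd_scale)

lemma euler: "x \<noteq> 0 \<Longrightarrow> dd x G x = G x"
  using hom_euler[of G x "\<lambda>c. c" 1] diff(1) by (auto simp: hom_ext_scale)

lemma euler1: "x \<noteq> 0 \<Longrightarrow> dd x (dd v G) x = 0"
  using hom_euler[of "dd v G" x "\<lambda>c. 1" 0] diff(2) by (auto simp: dd_scale)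

lemma euler2: "x \<noteq> 0 \<Longrightarrow> dd x (dd u (dd v G)) x = - dd u (dd v G) x"
proof -
  assume x: "x \<noteq> 0"
  have "(inverse has_real_derivative -1) (at (1::real))"
    by (auto intro!: derivative_eq_intros)
  from hom_euler[OF diff(3)[OF x] _ this, of u v] show ?thesis
    using x by (simp add: dd2_scale divide_inverse mult.commute)
qed

lemma sgrad_eq:
  assumes x: "norm x = 1"
  shows "sgrad g x = grad G x - g x *\<^sub>R x"
proof -
  have x0: "x \<noteq> 0" and xx: "x \<bullet> x = 1" and Gx: "G x = g x"
    using x by (auto simp: norm_eq_1 hom_ext_sphere)
  let ?g = "grad G x - g x *\<^sub>R x"
  \<comment> \<open>The correction \<open>g x * (y \<bullet> y - 1) / 2\<close> vanishes on the
    sphere, so the corrected function still agrees with \<open>g\<close> there, and it makes the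
    Euclidean gradient at \<open>x\<close> tangent.\<close>
  have D: "((\<lambda>y. G y - g x * (y \<bullet> y) / 2 + g x / 2) has_derivative (\<lambda>v. ?g \<bullet> v)) (at x)"
  proof -
    have "?g \<bullet> v = dd v G x - g x * (x \<bullet> v + v \<bullet> x) / 2 + 0" for v
      unfolding inner_diff_left inner_scaleR_left grad_inner_G[OF x0] inner_commute[of v x] by simp
    then have "(\<lambda>v. ?g \<bullet> v) = (\<lambda>v. dd v G x - g x * (x \<bullet> v + v \<bullet> x) / 2 + 0)" by (rule ext)
    moreover have "((\<lambda>y. g x * (y \<bullet> y) / 2) has_derivative (\<lambda>v. g x * (x \<bullet> v + v \<bullet> x) / 2)) (at x)"
      by (intro bounded_linear.has_derivative[OF bounded_linear_divide] has_derivative_mult_right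
          has_derivative_inner has_derivative_ident)
    ultimately show ?thesis
      by (simp only:) (intro has_derivative_add has_derivative_diff has_derivative_const
          dd_has_derivative diff(1) x0)
  qed
  then have "((\<lambda>y. G y - g x * (y \<bullet> y) / 2 + g x / 2) has_derivative (\<lambda>v. ?g \<bullet> v)) (at x within sphere 0 1)"
    by (rule has_derivative_at_withinI)
  then have D: "(g has_derivative (\<lambda>v. ?g \<bullet> v)) (at x within sphere 0 1)"
    by (rule has_derivative_transform[rotated 2]) (use x in \<open>auto simp: hom_ext_sphere norm_eq_1\<close>)
  have tan: "?g \<bullet> x = 0"
    by (simp add: inner_diff_left grad_inner_G[OF x0] euler[OF x0] xx Gx)
  show ?thesis unfolding sgrad_def
  proof (rule the_equality)
    show "?g \<bullet> x = 0 \<and> (g has_derivative (\<lambda>v. ?g \<bullet> v)) (at x within sphere 0 1)" using tan D by blast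
    fix d assume d: "d \<bullet> x = 0 \<and> (g has_derivative (\<lambda>v. d \<bullet> v)) (at x within sphere 0 1)"
    have "(d - ?g) \<bullet> x = 0" using d tan by (simp add: inner_diff_left)
    then have "d \<bullet> (d - ?g) = ?g \<bullet> (d - ?g)"
      using has_derivative_within_sphere_unique[OF conjunct2[OF d] D x] by blast
    then have "(d - ?g) \<bullet> (d - ?g) = 0" by (subst inner_diff_left) (rule right_minus_eq[THEN iffD2])
    then show "d = ?g" unfolding inner_eq_zero_iff by (rule right_minus_eq[THEN iffD1])
  qed
qed

text \<open>By Euler's relation the radial component of the Euclidean gradient is
  \<open>g x\<close>; the rest is the spherical gradient. This rewrites the gradient factor of the
  equation.\<close>

lemma norm_grad:
  assumes x: "norm x = 1"
  shows "(norm (grad G x))\<^sup>2 = (g x)\<^sup>2 + (norm (sgrad g x))\<^sup>2"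
proof -
  have x0: "x \<noteq> 0" and xx: "x \<bullet> x = 1" and Gx: "G x = g x"
    using x by (auto simp: norm_eq_1 hom_ext_sphere)
  have "grad G x \<bullet> x = g x" by (simp add: grad_inner_G[OF x0] euler[OF x0] Gx)
  moreover from this have "x \<bullet> grad G x = g x" by (simp add: inner_commute)
  ultimately show ?thesis unfolding sgrad_eq[OF x] power2_norm_eq_inner
    by (simp add: inner_diff_left inner_diff_right xx power2_eq_square)
qed

text \<open>Differentiate the formula \<open>grad G y - G y *\<^sub>R y\<close> of the spherical
  gradient: the derivative of the factor \<open>G y\<close> gives a normal vector, which the
  projection removes, and the derivative of the factor \<open>y\<close> gives the term with
  \<open>g x\<close>.\<close>

lemma shess_eq:
  assumes x: "norm x = 1" and u: "u \<bullet> x = 0" and v: "v \<bullet> x = 0"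
  shows "shess g x u v = dd u (dd v G) x - g x * (u \<bullet> v)"
proof -
  have x0: "x \<noteq> 0" and Gx: "G x = g x" using x by (auto simp: hom_ext_sphere)
  have xv: "x \<bullet> v = 0" using v by (simp add: inner_commute)
  let ?L = "\<lambda>w. (\<Sum>b\<in>Basis. dd w (dd b G) x *\<^sub>R b) - (G x *\<^sub>R w + dd w G x *\<^sub>R x)"
  have "((\<lambda>y. grad G y - G y *\<^sub>R y) has_derivative ?L) (at x)"
    unfolding grad_def
    by (intro has_derivative_diff has_derivative_sum has_derivative_scaleR has_derivative_ident
        has_derivative_scaleR_left dd_has_derivative diff x0)
  then have "((\<lambda>y. grad G y - G y *\<^sub>R y) has_derivative ?L) (at x within sphere 0 1)"
    by (rule has_derivative_at_withinI)
  then have L: "(sgrad g has_derivative ?L) (at x within sphere 0 1)"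
    by (rule has_derivative_transform[rotated 2]) (use x in \<open>auto simp: sgrad_eq hom_ext_sphere\<close>)
  then have "(sgrad g has_derivative frechet_derivative (sgrad g) (at x within sphere 0 1)) (at x within sphere 0 1)"
    using frechet_derivative_works differentiableI by blast
  then have F: "frechet_derivative (sgrad g) (at x within sphere 0 1) u = ?L u"
    by (rule has_derivative_within_sphere_unique[OF _ L x u])
  have lin: "linear (\<lambda>v. dd u (dd v G) x)" using bilinear[OF x0] by (simp add: bilinear_def)
  have "(\<Sum>b\<in>Basis. dd u (dd b G) x *\<^sub>R b) \<bullet> v = dd u (dd (\<Sum>b\<in>Basis. (v \<bullet> b) *\<^sub>R b) G) x"
    by (simp add: linear_sum[OF lin] linear_scale[OF lin] inner_sum_left inner_commute[of v] mult.commute)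
  also have "\<dots> = dd u (dd v G) x" by (simp add: euclidean_representation)
  finally have "?L u \<bullet> v = dd u (dd v G) x - g x * (u \<bullet> v)"
    using xv by (simp add: inner_diff_left inner_add_left Gx)
  then show ?thesis
    unfolding shess_def cov_deriv_def Let_def F using xv by (simp add: inner_diff_left)
qed

lemma W_matrix_eq:
  fixes e :: "'n::finite \<Rightarrow> 'a"
  assumes x: "norm x = 1" and e: "orthonormal_frame_at x e"
  shows "W_matrix e g x = qmat e (\<lambda>u v. dd u (dd v G) x)"
  using e shess_eq[OF x] unfolding orthonormal_frame_at_def
  by (auto simp: W_matrix_def hess_matrix_def qmat_def mat_def vec_eq_iff)

end

subsection \<open>The second-order inequality at a null direction\<close>

lemma sum_offdiag_if:
  fixes f :: "'i \<Rightarrow> real"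
  assumes "finite I"
  shows "(\<Sum>j\<in>I - {i}. f j) = (\<Sum>j\<in>I. if j = i then 0 else f j)"
  using assms by (intro sum.mono_neutral_cong_left) auto

lemma sum_offdiag_swap:
  fixes f :: "'i \<Rightarrow> 'i \<Rightarrow> real"
  assumes "finite I"
  shows "(\<Sum>i\<in>I. \<Sum>j\<in>I - {i}. f i j) = (\<Sum>i\<in>I. \<Sum>j\<in>I - {i}. f j i)"
  unfolding sum_offdiag_if[OF assms] by (subst sum.swap) (auto intro!: sum.cong)

lemma square_sum_offdiag:
  fixes b :: "'i \<Rightarrow> real"
  assumes "finite I"
  shows "(\<Sum>i\<in>I. \<Sum>j\<in>I - {i}. b i * b j) = (\<Sum>i\<in>I. b i)\<^sup>2 - (\<Sum>i\<in>I. (b i)\<^sup>2)"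
proof -
  have "(\<Sum>i\<in>I. b i)\<^sup>2 = (\<Sum>i\<in>I. \<Sum>j\<in>I. b i * b j)" by (simp add: power2_eq_square sum_product)
  also have "\<dots> = (\<Sum>i\<in>I. b i * b i + (\<Sum>j\<in>I - {i}. b i * b j))"
    using assms by (intro sum.cong refl sum.remove) auto
  finally show ?thesis by (simp add: sum.distrib power2_eq_square)
qed

lemma prod_le_power:
  fixes l :: "'n::finite \<Rightarrow> real" and B :: real
  assumes "\<And>i. 0 \<le> l i" "\<And>i. l i \<le> B" "1 \<le> B"
  shows "prod l J \<le> B ^ CARD('n)"
proof -
  have "prod l J \<le> (\<Prod>i\<in>J. B)" by (rule prod_mono) (use assms in auto)
  also have "\<dots> = B ^ card J" by simp
  also have "\<dots> \<le> B ^ CARD('n)" by (rule power_increasing[OF card_mono assms(3)]) auto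
  finally show ?thesis .
qed

text \<open>
  In the application \<open>l\<close> lists the eigenvalues of \<open>D\<^sup>2H\<close>, the least of which is \<open>l o1\<close>, \<open>eta\<close> and \<open>Z\<close> consist of the
  components of \<open>D\<^sup>3H\<close> and \<open>D\<^sup>4H\<close> with one and two arguments equal to the eigenvector of \<open>o1\<close>, and \<open>ph\<close> is the
  diagonal of the Hessian of the barrier.
\<close>

locale null_direction =
  fixes l :: "'n::finite \<Rightarrow> real" and eta :: "'n \<Rightarrow> 'n \<Rightarrow> real" and Z ph :: "'n \<Rightarrow> real" and o1 :: 'n
    and k :: nat
  assumes l_ge: "\<And>i. l o1 \<le> l i" and l_nonneg: "0 \<le> l o1"
    and sym: "\<And>i j. eta i j = eta j i"
    and touch: "\<And>i w. w o1 = 0 \<Longrightarrow>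
      ph i \<le> Z i + 4 * (\<Sum>j\<in>UNIV. w j * eta i j) + 2 * (\<Sum>j\<in>UNIV. (l j - l o1) * (w j)\<^sup>2)"
    and k: "1 \<le> k"
begin

lemma l_pos [simp]: "0 \<le> l i" using l_ge[of i] l_nonneg by linarith

text \<open>The quadratic term of \<open>touch\<close> vanishes in the direction \<open>j\<close>,
  so a function affine in \<open>w j\<close> is bounded below and its slope must be zero. This
  settles the case of a multiple smallest eigenvalue.\<close>

lemma eta_null: assumes "l j = l o1" "j \<noteq> o1" shows "eta i j = 0"
proof -
  have "0 \<le> 2 * t * (2 * eta i j) + t\<^sup>2 * 0 + (Z i - ph i)" for t
  proof -
    let ?w = "\<lambda>m. if m = j then t else 0"
    have "(\<Sum>m\<in>UNIV. ?w m * eta i m) = t * eta i j"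
      by (subst sum.cong[OF refl, of _ _ "\<lambda>m. if m = j then t * eta i j else 0"]) auto
    moreover have "(\<Sum>m\<in>UNIV. (l m - l o1) * (?w m)\<^sup>2) = 0"
      using assms(1) by (intro sum.neutral) auto
    ultimately show ?thesis using touch[of ?w i] assms(2) by simp
  qed
  from this[of "- (Z i - ph i + 1) / (4 * eta i j)"] show ?thesis
    by (cases "eta i j = 0") (auto simp: field_simps)
qed

lemma l_gt: "l j \<noteq> l o1 \<Longrightarrow> 0 < l j"
  using l_ge[of j] l_nonneg by linarith

text \<open>\<open>?w\<close> minimises the right-hand side of \<open>touch\<close> and yields the
  denominators \<open>l j - l o1\<close>; these may be enlarged to \<open>l j\<close> because
  \<open>l o1\<close> is nonnegative.\<close>

lemma Z_ge: "ph i + 2 * (\<Sum>j\<in>UNIV. if l j = l o1 then 0 else (eta i j)\<^sup>2 / l j) \<le> Z i"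
proof -
  let ?w = "\<lambda>j. if l j = l o1 then 0 else - eta i j / (l j - l o1)"
  have "ph i \<le> Z i + 4 * (\<Sum>j\<in>UNIV. ?w j * eta i j) + 2 * (\<Sum>j\<in>UNIV. (l j - l o1) * (?w j)\<^sup>2)"
    by (rule touch) simp
  also have "\<dots> = Z i - 2 * (\<Sum>j\<in>UNIV. if l j = l o1 then 0 else (eta i j)\<^sup>2 / (l j - l o1))"
    unfolding sum_distrib_left diff_conv_add_uminus[of "Z i"] sum_negf[symmetric] add.assoc sum.distrib[symmetric]
    by (intro arg_cong2[of _ _ _ _ "(+)"] refl sum.cong) (auto simp: power2_eq_square)
  also have "\<dots> \<le> Z i - 2 * (\<Sum>j\<in>UNIV. if l j = l o1 then 0 else (eta i j)\<^sup>2 / l j)"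
  proof -
    have "(\<Sum>j\<in>UNIV. if l j = l o1 then 0 else (eta i j)\<^sup>2 / l j) \<le>
      (\<Sum>j\<in>UNIV. if l j = l o1 then 0 else (eta i j)\<^sup>2 / (l j - l o1))"
    proof (rule sum_mono)
      fix j
      show "(if l j = l o1 then 0 else (eta i j)\<^sup>2 / l j) \<le> (if l j = l o1 then 0 else (eta i j)\<^sup>2 / (l j - l o1))"
        using l_ge[of j] l_nonneg l_gt[of j] by (auto intro!: divide_left_mono mult_pos_pos)
    qed
    then show ?thesis by simp
  qed
  finally show ?thesis by simp
qed

text \<open>The logarithmic derivative of the \<open>i\<close>-th diagonal entry along the null
  direction, set to zero on the lowest eigenspace, where \<open>l i\<close> may vanish.\<close>

definition "bb i = (if l i = l o1 then 0 else eta i i / l i)"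

lemma eta_diag: "eta i i = l i * bb i + (if i = o1 then eta o1 o1 else 0)"
  using eta_null[of i i] l_gt[of i] by (auto simp: bb_def)

text \<open>The second derivative of the principal minor on \<open>I\<close> along the null
  direction, in the form given by \<open>pminor_second_derivative\<close>.\<close>

definition "S I = (\<Sum>i\<in>I. prod l (I - {i}) * Z i) +
  (\<Sum>i\<in>I. \<Sum>j\<in>I - {i}. prod l (I - {i} - {j}) * (eta i i * eta j j - eta i j * eta j i))"

lemma prod_remove2: "i \<in> I \<Longrightarrow> prod l I = l i * prod l (I - {i})" for I :: "'n set"
  by (rule prod.remove) auto

text \<open>This is the inverse concavity in explicit form. The lower bound for \<open>Z\<close>
  contributes \<open>2 * prod l I\<close> times the sum of the \<open>(bb i)\<^sup>2\<close> and
  squares that outweigh the negative \<open>(eta i j)\<^sup>2\<close>; the products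
  \<open>eta i i * eta j j\<close> contribute the square of the sum minus the sum of squares.
  Together the coefficient of the sum of squares is 1, and Cauchy-Schwarz over the \<open>k\<close>
  elements of \<open>I\<close> gives the factor \<open>1 + 1 / k\<close>.\<close>

lemma S_ge:
  fixes I :: "'n set"
  assumes "card I = k"
  shows "(\<Sum>i\<in>I. prod l (I - {i}) * ph i) + (1 + 1 / k) * (prod l I * (\<Sum>i\<in>I. bb i)\<^sup>2)
    - 2 * \<bar>eta o1 o1\<bar> * (\<Sum>j\<in>UNIV. \<bar>prod l (I - {o1} - {j}) * (l j * bb j)\<bar>) \<le> S I"
proof -
  let ?b1 = "(\<Sum>i\<in>I. bb i)\<^sup>2" and ?b2 = "\<Sum>i\<in>I. (bb i)\<^sup>2"
  define X where "X = (\<Sum>j\<in>UNIV. \<bar>prod l (I - {o1} - {j}) * (l j * bb j)\<bar>)"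
  define P where "P i j = prod l (I - {i} - {j})" for i j
  have P_sym: "P i j = P j i" for i j
  proof -
    have "I - {i} - {j} = I - {j} - {i}" by blast
    then show ?thesis by (simp add: P_def)
  qed
  have P_nonneg: "0 \<le> P i j" for i j by (simp add: P_def prod_nonneg)
  let ?on = "\<lambda>j. if l j = l o1 then 0 else (1::real)" and ?q = "\<lambda>i j. if l j = l o1 then 0 else (eta i j)\<^sup>2 / l j"
  let ?s2 = "\<Sum>i\<in>I. \<Sum>j\<in>I - {i}. 2 * ?on j * P i j * (eta i j)\<^sup>2" and ?si = "\<Sum>i\<in>I. \<Sum>j\<in>I - {i}. ?on i * P i j * (eta i j)\<^sup>2"
    and ?sj = "\<Sum>i\<in>I. \<Sum>j\<in>I - {i}. ?on j * P i j * (eta i j)\<^sup>2" and ?sp = "\<Sum>i\<in>I. \<Sum>j\<in>I - {i}. P i j * (eta i j * eta j i)"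
    and ?sa = "\<Sum>i\<in>I. \<Sum>j\<in>I - {i}. P i j * (eta i i * eta j j)"
  have Z: "(\<Sum>i\<in>I. prod l (I - {i}) * ph i) + 2 * (prod l I * ?b2)
     + ?s2 \<le> (\<Sum>i\<in>I. prod l (I - {i}) * Z i)"
  proof -
    have "prod l (I - {i}) * ph i + 2 * (prod l I * (bb i)\<^sup>2) + (\<Sum>j\<in>I - {i}. 2 * ?on j * P i j * (eta i j)\<^sup>2)
        \<le> prod l (I - {i}) * Z i" if i: "i \<in> I" for i
    proof -
      have "(\<Sum>j\<in>I - {i}. 2 * ?on j * P i j * (eta i j)\<^sup>2) =
          prod l (I - {i}) * (2 * (\<Sum>j\<in>I - {i}. ?q i j))"
        unfolding sum_distrib_left
      proof (rule sum.cong[OF refl])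
        fix j assume j: "j \<in> I - {i}"
        have "prod l (I - {i}) = l j * P i j" unfolding P_def by (rule prod.remove) (use j in auto)
        moreover have "l j \<noteq> 0" if "l j \<noteq> l o1" using l_gt[OF that] by simp
        ultimately show "2 * ?on j * P i j * (eta i j)\<^sup>2 =
          prod l (I - {i}) * (2 * ?q i j)" by simp
      qed
      moreover have "2 * (prod l I * (bb i)\<^sup>2) = prod l (I - {i}) * (2 * ?q i i)"
        using l_gt[of i] by (auto simp: prod_remove2[OF i] bb_def power2_eq_square)
      moreover have "(\<Sum>j\<in>I. ?q i j) \<le> (\<Sum>j\<in>UNIV. ?q i j)"
        by (rule sum_mono2) auto
      moreover have "(\<Sum>j\<in>I. ?q i j) =
        ?q i i + (\<Sum>j\<in>I - {i}. ?q i j)"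
        by (rule sum.remove[OF _ i]) simp
      moreover have "prod l (I - {i}) * (ph i + 2 * (\<Sum>j\<in>I. ?q i j)) \<le> prod l (I - {i}) * Z i"
        using Z_ge[of i] calculation(3) by (intro mult_left_mono) (auto simp: prod_nonneg)
      ultimately show ?thesis by (simp add: algebra_simps)
    qed
    then have "(\<Sum>i\<in>I. prod l (I - {i}) * ph i + 2 * (prod l I * (bb i)\<^sup>2) + (\<Sum>j\<in>I - {i}. 2 * ?on j * P i j * (eta i j)\<^sup>2))
        \<le> (\<Sum>i\<in>I. prod l (I - {i}) * Z i)" by (rule sum_mono)
    then show ?thesis by (simp add: sum.distrib sum_distrib_left)
  qed
  \<comment> \<open>Symmetrising in \<open>i\<close> and \<open>j\<close> turns the coefficient
    \<open>2 * ?on j - 1\<close> into \<open>?on i + ?on j - 1\<close>. This is negative only if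
    both indices lie in the lowest eigenspace, and then \<open>eta i j = 0\<close> because one of
    them differs from \<open>o1\<close>.\<close>
  have off: "0 \<le> ?s2 - ?sp"
  proof -
    have "?s2 =
       ?sj + ?sj"
      by (simp only: sum.distrib[symmetric]) (intro sum.cong refl, simp)
    also have "?sj = ?si"
      by (subst sum_offdiag_swap) (auto simp: P_sym sym intro!: sum.cong)
    also have "?si + ?si
       = ?si + ?sj"
      by (subst (2) sum_offdiag_swap) (auto simp: P_sym sym intro!: sum.cong)
    finally have "?s2 - ?sp
      = (\<Sum>i\<in>I. \<Sum>j\<in>I - {i}. (?on i + ?on j - 1) * P i j * (eta i j)\<^sup>2)"
      by (simp add: sum.distrib[symmetric] sum_subtractf[symmetric] algebra_simps power2_eq_square sym cong: if_cong)
    also have "\<dots> \<ge> 0"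
    proof (intro sum_nonneg)
      fix i j assume "i \<in> I" "j \<in> I - {i}"
      then have "i \<noteq> j" by auto
      then have "eta i j = 0" if "l i = l o1" "l j = l o1"
        using eta_null[OF that(1), of j] eta_null[OF that(2), of i] sym[of i j] by metis
      then show "0 \<le> (?on i + ?on j - 1) * P i j * (eta i j)\<^sup>2" by (auto simp: P_nonneg)
    qed
    finally show ?thesis .
  qed
  \<comment> \<open>Insert \<open>eta_diag\<close> in both factors. Since \<open>i\<close> and
    \<open>j\<close> differ, at most one of them is \<open>o1\<close>, so the error is linear in
    \<open>eta o1 o1\<close>.\<close>
  have cross: "prod l I * (?b1 - ?b2) - 2 * \<bar>eta o1 o1\<bar> * X \<le>
     ?sa"
  proof -
    let ?E = "\<lambda>i. if i = o1 then eta o1 o1 else 0"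
    let ?e = "\<Sum>i\<in>I. \<Sum>j\<in>I - {i}. ?E i * (P i j * (l j * bb j))"
    have "P i j * (eta i i * eta j j) = prod l I * (bb i * bb j) + (?E i * (P i j * (l j * bb j)) + ?E j * (P i j * (l i * bb i)))"
      if "i \<in> I" "j \<in> I - {i}" for i j
    proof -
      have "prod l I = l i * (l j * P i j)"
        using that prod_remove2[of i I] prod.remove[of "I - {i}" j l] by (simp add: P_def)
      then show ?thesis using that
        by (subst (1 2) eta_diag) (auto simp: algebra_simps)
    qed
    then have "?sa =
       (\<Sum>i\<in>I. \<Sum>j\<in>I - {i}. prod l I * (bb i * bb j)) + (?e +
       (\<Sum>i\<in>I. \<Sum>j\<in>I - {i}. ?E j * (P i j * (l i * bb i))))"
      by (simp only: sum.distrib[symmetric]) (intro sum.cong refl, simp)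
    also have "(\<Sum>i\<in>I. \<Sum>j\<in>I - {i}. ?E j * (P i j * (l i * bb i))) = ?e"
      by (subst sum_offdiag_swap) (auto simp: P_sym intro!: sum.cong)
    also have "(\<Sum>i\<in>I. \<Sum>j\<in>I - {i}. prod l I * (bb i * bb j)) = prod l I * (?b1 - ?b2)"
      unfolding square_sum_offdiag[OF finite[of I], symmetric] by (simp add: sum_distrib_left)
    finally have eq: "?sa =
      prod l I * (?b1 - ?b2) + 2 * ?e" by simp
    have "\<bar>?e\<bar> \<le> \<bar>eta o1 o1\<bar> * X"
    proof (cases "o1 \<in> I")
      case True
      have "?e = (\<Sum>i\<in>I. if i = o1 then eta o1 o1 * (\<Sum>j\<in>I - {o1}. P o1 j * (l j * bb j)) else 0)"
        by (intro sum.cong) (auto simp: sum_distrib_left)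
      also have "\<dots> = eta o1 o1 * (\<Sum>j\<in>I - {o1}. P o1 j * (l j * bb j))" using True by simp
      finally have "\<bar>?e\<bar> = \<bar>eta o1 o1\<bar> * \<bar>\<Sum>j\<in>I - {o1}. P o1 j * (l j * bb j)\<bar>"
        by (simp add: abs_mult)
      also have "\<dots> \<le> \<bar>eta o1 o1\<bar> * X"
      proof (rule mult_left_mono)
        have "\<bar>\<Sum>j\<in>I - {o1}. P o1 j * (l j * bb j)\<bar> \<le> (\<Sum>j\<in>I - {o1}. \<bar>P o1 j * (l j * bb j)\<bar>)" by (rule sum_abs)
        also have "\<dots> \<le> X" unfolding X_def P_def by (rule sum_mono2) auto
        finally show "\<bar>\<Sum>j\<in>I - {o1}. P o1 j * (l j * bb j)\<bar> \<le> X" .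
      qed simp
      finally show ?thesis .
    next
      case False
      then have "?e = 0" by (intro sum.neutral) auto
      moreover have "0 \<le> X" unfolding X_def by (intro sum_nonneg) auto
      ultimately show ?thesis by simp
    qed
    then show ?thesis unfolding eq by linarith
  qed
  have "S I = (\<Sum>i\<in>I. prod l (I - {i}) * Z i) + ?sa -
      ?sp"
    unfolding S_def P_def by (simp add: right_diff_distrib sum_subtractf)
  then have "(\<Sum>i\<in>I. prod l (I - {i}) * ph i) + prod l I * (?b1 + ?b2) - 2 * \<bar>eta o1 o1\<bar> * X \<le> S I"
    using Z off cross by (simp add: algebra_simps)
  moreover have "(1 + 1 / k) * (prod l I * ?b1) \<le> prod l I * (?b1 + ?b2)"
  proof -
    have "?b1 \<le> k * ?b2"
      using sum_squared_le_sum_of_squares[of bb I] assms by (simp add: mult.commute)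
    then have "?b1 / k \<le> ?b2" using k by (simp add: field_simps)
    then have "prod l I * (?b1 + ?b1 / k) \<le> prod l I * (?b1 + ?b2)"
      by (intro mult_left_mono add_left_mono) (auto simp: prod_nonneg)
    then show ?thesis by (simp add: algebra_simps)
  qed
  ultimately show ?thesis unfolding X_def by linarith
qed

text \<open>sigma_k, its derivative along the null direction, and its partial derivative in the
  \<open>i\<close>-th eigenvalue. The numbers \<open>Fd i\<close> are the coefficients of the
  linearised operator in the eigenframe.\<close>

definition "R0 = (\<Sum>I | card I = k. prod l I)"
definition "R1 = (\<Sum>I | card I = k. \<Sum>i\<in>I. prod l (I - {i}) * eta i i)"
definition "Fd i = (\<Sum>I | card I = k \<and> i \<in> I. prod l (I - {i}))"

lemma sum_Fd: "(\<Sum>I | card I = k. \<Sum>i\<in>I. prod l (I - {i}) * a i) = (\<Sum>i\<in>UNIV. Fd i * a i)"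
proof -
  have "(\<Sum>I | card I = k. \<Sum>i\<in>I. prod l (I - {i}) * a i) = (\<Sum>I | card I = k. \<Sum>i\<in>UNIV. if i \<in> I then prod l (I - {i}) * a i else 0)"
    by (rule sum.cong[OF refl]) (simp add: sum.If_cases)
  also have "\<dots> = (\<Sum>i\<in>UNIV. \<Sum>I | card I = k. if i \<in> I then prod l (I - {i}) * a i else 0)" by (rule sum.swap)
  also have "\<dots> = (\<Sum>i\<in>UNIV. Fd i * a i)"
    unfolding Fd_def sum_distrib_right
    by (intro sum.cong refl sum.mono_neutral_cong_right) auto
  finally show ?thesis .
qed

lemma Fd_nonneg: "0 \<le> Fd i" unfolding Fd_def by (intro sum_nonneg prod_nonneg) auto

lemma card_subsets_le: "real (card {I::'n set. Q I}) \<le> 2 ^ CARD('n)"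
proof -
  have "card {I::'n set. Q I} \<le> card (Pow (UNIV::'n set))" by (rule card_mono) auto
  then have "card {I::'n set. Q I} \<le> 2 ^ CARD('n)" by (simp add: card_Pow)
  then show ?thesis by (metis of_nat_le_iff of_nat_numeral of_nat_power)
qed

lemma Fd_le:
  fixes B :: real
  assumes "\<And>i. l i \<le> B" "1 \<le> B"
  shows "Fd i \<le> 2 ^ CARD('n) * B ^ CARD('n)"
proof -
  have "Fd i \<le> (\<Sum>I | card I = k \<and> i \<in> I. B ^ CARD('n))"
    unfolding Fd_def by (intro sum_mono prod_le_power assms) simp
  also have "\<dots> \<le> 2 ^ CARD('n) * B ^ CARD('n)"
    using assms(2) card_subsets_le[of "\<lambda>I. card I = k \<and> i \<in> I"] by (simp add: mult_right_mono)
  finally show ?thesis .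
qed

text \<open>Ellipticity without positive definiteness: for each \<open>k\<close>-set
  \<open>I\<close>, drop \<open>i\<close> from it if \<open>i\<close> belongs to it, and some other
  index otherwise. What is left is a product occurring in \<open>Fd i\<close>, and the dropped
  eigenvalue is at most \<open>B\<close>.\<close>

lemma R0_le_Fd:
  fixes B :: real
  assumes "\<And>i. l i \<le> B" "1 \<le> B"
  shows "R0 \<le> 2 ^ CARD('n) * B * Fd i"
proof -
  have single: "prod l (J - {i}) \<le> Fd i" if "card J = k" "i \<in> J" for J
    unfolding Fd_def by (rule member_le_sum) (use that in \<open>auto intro: prod_nonneg\<close>)
  have "prod l I \<le> B * Fd i" if I: "card I = k" for I
  proof -
    obtain j J where j: "j \<in> I" "card J = k" "i \<in> J" "J - {i} = I - {j}"
    proof (cases "i \<in> I")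
      case True
      then show ?thesis using that[of i I] I by simp
    next
      case False
      obtain j where "j \<in> I" using I k by (metis card.empty ex_in_conv not_one_le_zero)
      then show ?thesis
        using that[of j "insert i (I - {j})"] I k False by (auto simp: card_Diff_singleton)
    qed
    have "prod l I = l j * prod l (I - {j})" by (rule prod_remove2[OF j(1)])
    also have "\<dots> \<le> B * prod l (J - {i})"
      unfolding j(4) by (intro mult_right_mono assms prod_nonneg) auto
    also have "\<dots> \<le> B * Fd i" using single[OF j(2,3)] assms(2) by (intro mult_left_mono) auto
    finally show ?thesis .
  qed
  then have "R0 \<le> (\<Sum>I::'n set | card I = k. B * Fd i)" unfolding R0_def by (intro sum_mono) auto
  also have "\<dots> \<le> 2 ^ CARD('n) * (B * Fd i)"
    using assms(2) Fd_nonneg card_subsets_le[of "\<lambda>I. card I = k"] by (simp add: mult_right_mono)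
  finally show ?thesis by (simp add: mult.assoc)
qed

text \<open>Sum \<open>S_ge\<close> over all \<open>k\<close>-sets. Cauchy-Schwarz with the weights
  \<open>prod l I\<close> gives \<open>T\<^sup>2 \<le> R0 * V\<close>, and \<open>T\<close> differs
  from \<open>R1\<close> only by \<open>eta o1 o1 * Fd o1\<close>.\<close>

lemma second_order_lower_bound:
  fixes B :: real
  assumes "\<And>i. l i \<le> B" "\<And>i. \<bar>eta i i\<bar> \<le> B" "1 \<le> B" "0 < R0" "1 / B \<le> R0"
  shows "(\<Sum>i\<in>UNIV. Fd i * ph i) + (1 + 1 / k) * (R1\<^sup>2 / R0)
    - 8 * real CARD('n) * 4 ^ CARD('n) * B ^ (2 * CARD('n) + 3) * \<bar>eta o1 o1\<bar> \<le> (\<Sum>I | card I = k. S I)"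
proof -
  let ?N = "CARD('n)" and ?e = "\<bar>eta o1 o1\<bar>"
  \<comment> \<open>\<open>?U\<close> bounds twice the product of \<open>R1\<close> and
    \<open>eta o1 o1 * Fd o1\<close>; \<open>?W\<close> is \<open>?U * B\<close>, the last
    \<open>B\<close> coming from division by \<open>R0\<close>. In the final coefficient 8, twice
    \<open>?W\<close> accounts for 4 and the errors of \<open>S_ge\<close> for the other 4.\<close>
  let ?U = "2 * (?N * (2 ^ ?N * B ^ ?N * B)) * (?e * (2 ^ ?N * B ^ ?N))" and ?W = "2 * real ?N * 4 ^ ?N * B ^ (2 * ?N + 2) * ?e"
  define T where "T = (\<Sum>I | card I = k. prod l I * (\<Sum>i\<in>I. bb i))"
  define V where "V = (\<Sum>I | card I = k. prod l I * (\<Sum>i\<in>I. bb i)\<^sup>2)"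
  have lb: "\<bar>l j * bb j\<bar> \<le> B" for j
    using assms(2)[of j] assms(3) l_gt[of j] by (cases "l j = l o1") (auto simp: bb_def)
  have X: "(\<Sum>j\<in>UNIV. \<bar>prod l (I - {o1} - {j}) * (l j * bb j)\<bar>) \<le> ?N * B ^ (?N + 1)" for I :: "'n set"
  proof -
    have "(\<Sum>j\<in>UNIV. \<bar>prod l (I - {o1} - {j}) * (l j * bb j)\<bar>) \<le> (\<Sum>j\<in>(UNIV::'n set). B ^ ?N * B)"
    proof (rule sum_mono)
      fix j
      have "\<bar>prod l (I - {o1} - {j})\<bar> \<le> B ^ ?N"
        using prod_le_power[of l B] assms(1,3) by (simp add: prod_nonneg)
      then show "\<bar>prod l (I - {o1} - {j}) * (l j * bb j)\<bar> \<le> B ^ ?N * B"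
        unfolding abs_mult[of "prod l _"] using lb[of j] assms(3) by (intro mult_mono) auto
    qed
    then show ?thesis by (simp add: mult.commute mult.left_commute)
  qed
  have "(\<Sum>I | card I = k. (\<Sum>i\<in>I. prod l (I - {i}) * ph i) + (1 + 1 / k) * (prod l I * (\<Sum>i\<in>I. bb i)\<^sup>2)
      - 2 * ?e * (?N * B ^ (?N + 1))) \<le> (\<Sum>I | card I = k. S I)"
  proof (rule sum_mono)
    fix I :: "'n set" assume "I \<in> {I. card I = k}"
    then have "card I = k" by simp
    note S_ge[OF this]
    moreover have "2 * ?e * (\<Sum>j\<in>UNIV. \<bar>prod l (I - {o1} - {j}) * (l j * bb j)\<bar>) \<le> 2 * ?e * (?N * B ^ (?N + 1))"
      by (intro mult_left_mono X) auto
    ultimately show "(\<Sum>i\<in>I. prod l (I - {i}) * ph i) + (1 + 1 / k) * (prod l I * (\<Sum>i\<in>I. bb i)\<^sup>2)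
      - 2 * ?e * (?N * B ^ (?N + 1)) \<le> S I" by linarith
  qed
  then have S: "(\<Sum>i\<in>UNIV. Fd i * ph i) + (1 + 1 / k) * V - card {I::'n set. card I = k} * (2 * ?e * (?N * B ^ (?N + 1)))
      \<le> (\<Sum>I | card I = k. S I)"
    by (simp only: sum_subtractf sum.distrib sum_Fd V_def sum_distrib_left[symmetric] sum_constant)
      (simp add: mult_ac)
  have cs: "T\<^sup>2 \<le> R0 * V"
  proof -
    have "T = (\<Sum>I | card I = k. sqrt (prod l I) * (sqrt (prod l I) * (\<Sum>i\<in>I. bb i)))"
      unfolding T_def by (intro sum.cong refl) (simp add: mult.assoc[symmetric] prod_nonneg)
    also have "\<dots>\<^sup>2 \<le> (\<Sum>I | card I = k. (sqrt (prod l I))\<^sup>2) * (\<Sum>I | card I = k. (sqrt (prod l I) * (\<Sum>i\<in>I. bb i))\<^sup>2)"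
      by (rule Cauchy_Schwarz_ineq_sum)
    also have "\<dots> = R0 * V"
      unfolding R0_def V_def by (simp add: power_mult_distrib prod_nonneg)
    finally show ?thesis .
  qed
  have R1: "R1 = T + eta o1 o1 * Fd o1"
  proof -
    have "prod l (I - {i}) * eta i i = prod l I * bb i + prod l (I - {i}) * (if i = o1 then eta o1 o1 else 0)"
      if "i \<in> I" for I i
      by (subst eta_diag) (simp add: prod_remove2[OF that] algebra_simps)
    then have "R1 = (\<Sum>I | card I = k. \<Sum>i\<in>I. prod l I * bb i + prod l (I - {i}) * (if i = o1 then eta o1 o1 else 0))"
      unfolding R1_def by (intro sum.cong refl) auto
    also have "\<dots> = T + (\<Sum>i\<in>UNIV. Fd i * (if i = o1 then eta o1 o1 else 0))"
      unfolding sum.distrib sum_Fd T_def sum_distrib_left ..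
    also have "(\<Sum>i\<in>UNIV. Fd i * (if i = o1 then eta o1 o1 else 0)) = eta o1 o1 * Fd o1"
      by (subst sum.cong[OF refl, of _ _ "\<lambda>i. if i = o1 then eta o1 o1 * Fd o1 else 0"]) auto
    finally show ?thesis .
  qed
  have F: "Fd i \<le> 2 ^ ?N * B ^ ?N" for i by (rule Fd_le) (use assms in auto)
  have R1b: "\<bar>R1\<bar> \<le> ?N * (2 ^ ?N * B ^ ?N * B)"
  proof -
    have "\<bar>R1\<bar> \<le> (\<Sum>i\<in>UNIV. \<bar>Fd i * eta i i\<bar>)" unfolding R1_def sum_Fd by (rule sum_abs)
    also have "\<dots> \<le> (\<Sum>i\<in>(UNIV::'n set). 2 ^ ?N * B ^ ?N * B)"
      unfolding abs_mult by (intro sum_mono mult_mono assms) (use F Fd_nonneg assms(3) in auto)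
    finally show ?thesis by simp
  qed
  have "R1\<^sup>2 - ?U \<le> T\<^sup>2"
  proof -
    have "\<bar>R1 * (eta o1 o1 * Fd o1)\<bar> \<le> (?N * (2 ^ ?N * B ^ ?N * B)) * (?e * (2 ^ ?N * B ^ ?N))"
      unfolding abs_mult by (intro mult_mono R1b) (use F Fd_nonneg assms(3) in auto)
    moreover have "T\<^sup>2 = R1\<^sup>2 - 2 * (R1 * (eta o1 o1 * Fd o1)) + (eta o1 o1 * Fd o1)\<^sup>2"
      unfolding R1 by (simp add: power2_eq_square algebra_simps)
    moreover have "0 \<le> (eta o1 o1 * Fd o1)\<^sup>2" by simp
    ultimately show ?thesis by linarith
  qed
  also note cs
  finally have "R1\<^sup>2 / R0 - ?U / R0 \<le> V"
    using assms(4) by (simp add: diff_divide_distrib[symmetric] pos_divide_le_eq mult.commute)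
  moreover have "?U / R0 \<le>
      ?U * B"
  proof -
    have "1 / R0 \<le> B" using assms(3-5) by (simp add: field_simps)
    then have "?U * (1 / R0) \<le>
      ?U * B"
      using assms(3) by (intro mult_left_mono) auto
    then show ?thesis by simp
  qed
  ultimately have V: "R1\<^sup>2 / R0 - ?U * B \<le> V" by linarith
  have "?U * B = ?W"
  proof -
    have "(4::real) ^ ?N = 2 ^ ?N * 2 ^ ?N" by (subst power_mult_distrib[symmetric]) simp
    moreover have "B ^ (2 * ?N + 2) = B ^ ?N * B ^ ?N * B * B"
      by (simp add: power_add mult_2 power2_eq_square)
    ultimately show ?thesis by (simp only: mult_ac)
  qed
  with V have V: "R1\<^sup>2 / R0 - ?W \<le> V" by (simp only:)
  have e0: "0 \<le> ?W" using assms(3) by simp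
  have k2: "1 + 1 / real k \<le> 2" using k by simp
  have "(1 + 1 / k) * (R1\<^sup>2 / R0) - 2 * ?W \<le> (1 + 1 / k) * V"
  proof -
    have "(1 + 1 / k) * (R1\<^sup>2 / R0 - ?W) \<le> (1 + 1 / k) * V"
      by (intro mult_left_mono V) auto
    moreover have "(1 + 1 / k) * ?W \<le> 2 * ?W"
      by (rule mult_right_mono[OF k2 e0])
    ultimately show ?thesis by (simp only: right_diff_distrib)
  qed
  moreover have "2 * ?W \<le> 4 * real ?N * 4 ^ ?N * B ^ (2 * ?N + 3) * ?e"
  proof -
    have "(4 * real ?N * 4 ^ ?N) * B ^ (2 * ?N + 2) * ?e \<le> (4 * real ?N * 4 ^ ?N) * B ^ (2 * ?N + 3) * ?e"
      using assms(3) by (intro mult_right_mono mult_left_mono power_increasing) auto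
    then show ?thesis by (simp add: mult.assoc)
  qed
  moreover have "card {I::'n set. card I = k} * (2 * ?e * (?N * B ^ (?N + 1))) \<le> 4 * real ?N * 4 ^ ?N * B ^ (2 * ?N + 3) * ?e"
  proof -
    have "card {I::'n set. card I = k} * (2 * ?e * (?N * B ^ (?N + 1))) \<le> 4 ^ ?N * (2 * ?e * (?N * B ^ (2 * ?N + 3)))"
    proof (intro mult_mono order.refl power_increasing assms(3))
      have "(2::real) ^ ?N \<le> 4 ^ ?N" by (rule power_mono) auto
      then show "real (card {I::'n set. card I = k}) \<le> 4 ^ ?N"
        using card_subsets_le[of "\<lambda>I. card I = k"] by linarith
    qed (use assms(3) in auto)
    also have "\<dots> \<le> 4 * real ?N * 4 ^ ?N * B ^ (2 * ?N + 3) * ?e" using assms(3) by simp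
    finally show ?thesis .
  qed
  ultimately show ?thesis using S by linarith
qed

end

subsection \<open>One-variable calculus\<close>

lemma second_derivative_min:
  fixes g g1 :: "real \<Rightarrow> real"
  assumes T: "open T" "0 \<in> T" and g: "\<And>t. t \<in> T \<Longrightarrow> (g has_real_derivative g1 t) (at t)"
    and g1: "(g1 has_real_derivative g2) (at 0)" and min: "\<And>t. t \<in> T \<Longrightarrow> g 0 \<le> g t"
  shows "g1 0 = 0" "0 \<le> g2"
proof -
  obtain d where d: "d > 0" "ball 0 d \<subseteq> T" using T openE by blast
  then have inT: "\<bar>t\<bar> < d \<Longrightarrow> t \<in> T" for t by (auto simp: subset_iff dist_real_def)
  show g10: "g1 0 = 0"
    by (rule DERIV_local_min[OF g[OF T(2)] d(1)]) (use inT min in auto)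
  show "0 \<le> g2"
  proof (rule ccontr)
    assume "\<not> 0 \<le> g2"
    then obtain d' where d': "d' > 0" "\<And>t. 0 < t \<Longrightarrow> t < d' \<Longrightarrow> g1 t < 0"
      using DERIV_neg_dec_right[OF g1] g10 by auto
    define t where "t = min d d' / 2"
    have t: "0 < t" "t < d" "t < d'" using d d' by (auto simp: t_def min_def)
    have "\<exists>s. 0 < s \<and> s < t \<and> g t - g 0 = (t - 0) * g1 s"
      by (rule MVT2[OF t(1)]) (use t inT g in auto)
    then obtain s where "0 < s" "s < t" "g t - g 0 = t * g1 s" by auto
    moreover from this have "t * g1 s < 0" using d'(2)[of s] t by (simp add: mult_pos_neg)
    ultimately show False using min[OF inT, of t] t by simp
  qed
qed

text \<open>The left-hand side is \<open>- k * R 0 powr (1 + 1 / k)\<close> times the second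
  derivative of \<open>R powr (- 1 / k)\<close>. With the logarithmic derivative \<open>L\<close> it
  is \<open>R 0\<close> times the derivative of \<open>L\<close> minus
  \<open>(L 0)\<^sup>2 / k\<close>, where the part quadratic in the logarithmic derivatives of
  \<open>a\<close> and \<open>b\<close> is minus a square. What survives on the right involves
  \<open>b2\<close> or derivatives of \<open>d\<close>, and these will be small at a touching
  point.\<close>

lemma power_product_second_derivative:
  fixes a b d a1 b1 d1 :: "real \<Rightarrow> real" and P c :: real and k :: nat
  assumes k: "1 \<le> k" and P: "0 \<le> P" and "0 \<in> T"
    and pos: "\<And>s. s \<in> T \<Longrightarrow> 0 < a s" "\<And>s. s \<in> T \<Longrightarrow> 0 < b s" "\<And>s. s \<in> T \<Longrightarrow> 0 < d s"
    and der: "\<And>s. s \<in> T \<Longrightarrow> (a has_real_derivative a1 s) (at s)"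
      "\<And>s. s \<in> T \<Longrightarrow> (b has_real_derivative b1 s) (at s)"
      "\<And>s. s \<in> T \<Longrightarrow> (d has_real_derivative d1 s) (at s)"
    and der2: "(a1 has_real_derivative a2) (at 0)" "(b1 has_real_derivative b2) (at 0)"
      "(d1 has_real_derivative d2) (at 0)"
    and a2: "0 \<le> a2"
  defines "R \<equiv> \<lambda>s. a s powr (- (k + P)) * b s powr P * d s powr c"
  shows "\<exists>R1 R2. (\<forall>s\<in>T. (R has_real_derivative R1 s) (at s)) \<and> (R1 has_real_derivative R2) (at 0) \<and>
    R2 - (1 + 1 / k) * ((R1 0)\<^sup>2 / R 0) \<le> R 0 * (P * b2 / b 0 + c * (d2 / d 0 - (d1 0 / d 0)\<^sup>2)
      + 2 / k * ((k + P) * (a1 0 / a 0) - P * (b1 0 / b 0)) * (c * d1 0 / d 0))"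
proof -
  define L where "L s = - (k + P) * (a1 s / a s) + P * (b1 s / b s) + c * (d1 s / d s)" for s
  have R: "(R has_real_derivative R s * L s) (at s)" if s: "s \<in> T" for s
  proof -
    have pw: "((\<lambda>s. g s powr r) has_real_derivative r * (g' / g s) * g s powr r) (at s)"
      if "(g has_real_derivative g') (at s)" "0 < g s" for g :: "real \<Rightarrow> real" and g' r
    proof -
      have "((\<lambda>s. g s powr r) has_real_derivative r * g s powr (r - of_nat 1) * g') (at s)"
        by (rule DERIV_fun_powr[OF that(1,2)])
      then show ?thesis
        by (rule DERIV_cong) (use that(2) in \<open>simp add: powr_diff\<close>)
    qed
    note pws = pw[OF der(1)[OF s] pos(1)[OF s], of "- (k + P)"] pw[OF der(2)[OF s] pos(2)[OF s], of P]
      pw[OF der(3)[OF s] pos(3)[OF s], of c]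
    show ?thesis unfolding R_def
      by (rule DERIV_cong[OF DERIV_mult[OF DERIV_mult[OF pws(1,2)] pws(3)]]) (simp add: L_def algebra_simps)
  qed
  let ?A = "a1 0 / a 0" and ?B = "b1 0 / b 0" and ?D = "d1 0 / d 0"
  define L2 where "L2 = - (k + P) * (a2 / a 0 - ?A\<^sup>2) + P * (b2 / b 0 - ?B\<^sup>2) + c * (d2 / d 0 - ?D\<^sup>2)"
  have L: "(L has_real_derivative L2) (at 0)"
  proof -
    have q: "((\<lambda>s. g1 s / g s) has_real_derivative g2 / g 0 - (g1 0 / g 0)\<^sup>2) (at 0)"
      if "(g has_real_derivative g1 0) (at 0)" "(g1 has_real_derivative g2) (at 0)" "0 < g 0" for g g1 g2
      by (rule DERIV_cong[OF DERIV_divide[OF that(2,1)]]) (use that(3) in \<open>simp_all add: power2_eq_square field_simps\<close>)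
    show ?thesis unfolding L_def[abs_def] L2_def
      by (intro DERIV_add DERIV_cmult q der der2 pos assms)
  qed
  have RL: "((\<lambda>s. R s * L s) has_real_derivative R 0 * L 0 * L 0 + L2 * R 0) (at 0)"
    by (rule DERIV_mult[OF R[OF assms(3)] L])
  have R0: "0 < R 0" using pos[OF assms(3)] by (simp add: R_def)
  have K: "0 < k + P" "(0::real) < k" using k P by auto
  define t where "t = c * ?D"
  have L0: "L 0 = - (k + P) * ?A + P * ?B + t" by (simp add: L_def t_def)
  \<comment> \<open>This reflects the joint convexity of \<open>a^(1 + P/k) b^(- P/k)\<close>.\<close>
  have quad: "(k + P) * ?A\<^sup>2 - P * ?B\<^sup>2 - (L 0)\<^sup>2 / k =
      - (P * (k + P) * (?A - ?B)\<^sup>2) / k + 2 / k * ((k + P) * ?A - P * ?B) * t - t\<^sup>2 / k"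
  proof -
    have "(m + P) * A\<^sup>2 - P * B\<^sup>2 - (- (m + P) * A + P * B + t)\<^sup>2 / m =
      - (P * (m + P) * (A - B)\<^sup>2) / m + 2 / m * ((m + P) * A - P * B) * t - t\<^sup>2 / m" if "0 < m" for A B m :: real
      using that by (simp add: power2_eq_square field_simps)
    then show ?thesis unfolding L0 using K(2) by blast
  qed
  have "L2 - (L 0)\<^sup>2 / k = - ((k + P) * (a2 / a 0)) + ((k + P) * ?A\<^sup>2 - P * ?B\<^sup>2 - (L 0)\<^sup>2 / k)
      + P * b2 / b 0 + c * (d2 / d 0 - ?D\<^sup>2)"
    by (simp add: L2_def algebra_simps add_divide_distrib)
  also have "\<dots> \<le> 0 + 2 / k * ((k + P) * ?A - P * ?B) * t + P * b2 / b 0 + c * (d2 / d 0 - ?D\<^sup>2)"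
  proof -
    have "0 \<le> (k + P) * (a2 / a 0)" using K a2 pos(1)[OF assms(3)] by simp
    moreover have "0 \<le> P * (k + P) * (?A - ?B)\<^sup>2 / k" using K P by simp
    moreover have "0 \<le> t\<^sup>2 / k" by simp
    ultimately show ?thesis unfolding quad by linarith
  qed
  finally have LL: "L2 - (L 0)\<^sup>2 / k \<le> P * b2 / b 0 + c * (d2 / d 0 - ?D\<^sup>2) + 2 / k * ((k + P) * ?A - P * ?B) * t"
    by simp
  have "R 0 * L 0 * L 0 + L2 * R 0 - (1 + 1 / k) * ((R 0 * L 0)\<^sup>2 / R 0) = R 0 * (L2 - (L 0)\<^sup>2 / k)"
    using R0 by (simp add: power2_eq_square algebra_simps)
  also have "\<dots> \<le> R 0 * (P * b2 / b 0 + c * (d2 / d 0 - ?D\<^sup>2) + 2 / k * ((k + P) * ?A - P * ?B) * t)"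
    using LL R0 by (intro mult_left_mono) auto
  finally have "R 0 * L 0 * L 0 + L2 * R 0 - (1 + 1 / k) * ((R 0 * L 0)\<^sup>2 / R 0) \<le>
     R 0 * (P * b2 / b 0 + c * (d2 / d 0 - ?D\<^sup>2) + 2 / k * ((k + P) * ?A - P * ?B) * (c * d1 0 / d 0))"
    by (simp add: t_def)
  with R RL show ?thesis
    by (intro exI[of _ "\<lambda>s. R s * L s"] exI[of _ "R 0 * L 0 * L 0 + L2 * R 0"]) auto
qed

text \<open>With \<open>r t = (1 + t\<^sup>2)^(-1/2)\<close> all derivatives are polynomials in \<open>t\<close> and \<open>r t\<close>.\<close>

lemma touching_profile_derivatives:
  fixes psi psi1 psi2 :: "real \<Rightarrow> real" and tau beta W xv xw :: real
  assumes psi: "\<And>s. (psi has_real_derivative psi1 s) (at s)" "\<And>s. (psi1 has_real_derivative psi2 s) (at s)"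
  defines "r \<equiv> \<lambda>t::real. (1 + t\<^sup>2) powr (- 1/2)"
  defines "N \<equiv> \<lambda>t. (1 + t\<^sup>2) * (1 + t\<^sup>2 * W) - (t * xv + t\<^sup>2 * xw)\<^sup>2"
  shows "\<exists>Q1. (\<forall>t. ((\<lambda>t. r t ^ 3 * N t * psi ((tau + t * beta) * r t)) has_real_derivative Q1 t) (at t)) \<and>
    Q1 0 = psi1 tau * beta \<and>
    (Q1 has_real_derivative psi2 tau * beta\<^sup>2 - psi1 tau * tau + (- 1 + 2 * W - 2 * xv\<^sup>2) * psi tau) (at 0)"
proof -
  have r: "(r has_real_derivative - t * r t ^ 3) (at t)" for t
  proof -
    have pos: "0 < 1 + t\<^sup>2" by (simp add: add_pos_nonneg)
    have "((\<lambda>t. 1 + t\<^sup>2) has_real_derivative 2 * t) (at t)" by (auto intro!: derivative_eq_intros)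
    then have "(r has_real_derivative (- 1/2) * (1 + t\<^sup>2) powr (- 1/2 - of_nat 1) * (2 * t)) (at t)"
      unfolding r_def by (rule DERIV_fun_powr) (rule pos)
    moreover have "r t ^ 3 = (1 + t\<^sup>2) powr (- 1/2 - of_nat 1)"
      using pos by (simp add: r_def powr_realpow[symmetric] powr_powr)
    ultimately show ?thesis by (simp add: mult.commute)
  qed
  have r0: "r 0 = 1" by (simp add: r_def)
  define s where "s t = (tau + t * beta) * r t" for t
  define s1 where "s1 t = beta * r t + (tau + t * beta) * (- t * r t ^ 3)" for t
  define A where "A t = r t ^ 3 * N t" for t
  define N1 where "N1 t = 2 * t * (1 + t\<^sup>2 * W) + (1 + t\<^sup>2) * (2 * t * W) - 2 * (t * xv + t\<^sup>2 * xw) * (xv + 2 * t * xw)" for t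
  define A1 where "A1 t = 3 * r t ^ 2 * (- t * r t ^ 3) * N t + r t ^ 3 * N1 t" for t
  have s: "(s has_real_derivative s1 t) (at t)" for t
    unfolding s_def[abs_def] s1_def by (auto intro!: derivative_eq_intros r)
  have N: "(N has_real_derivative N1 t) (at t)" for t
    unfolding N_def N1_def by (auto intro!: derivative_eq_intros)
  have A: "(A has_real_derivative A1 t) (at t)" for t
    unfolding A_def[abs_def] A1_def by (auto intro!: derivative_eq_intros r N)
  have N2: "(N1 has_real_derivative 2 + 2 * W - 2 * xv\<^sup>2) (at 0)"
    unfolding N1_def[abs_def] by (auto intro!: derivative_eq_intros simp: power2_eq_square)
  have A2: "(A1 has_real_derivative - 1 + 2 * W - 2 * xv\<^sup>2) (at 0)"
    unfolding A1_def[abs_def] by (auto intro!: derivative_eq_intros r N N2 simp: r0 N_def N1_def power2_eq_square)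
  have s2: "(s1 has_real_derivative - tau) (at 0)"
    unfolding s1_def[abs_def] by (auto intro!: derivative_eq_intros r simp: r0)
  have ps: "((\<lambda>t. psi (s t)) has_real_derivative psi1 (s t) * s1 t) (at t)"
    "((\<lambda>t. psi1 (s t)) has_real_derivative psi2 (s t) * s1 t) (at t)" for t
    by (rule DERIV_chain2[OF psi(1) s], rule DERIV_chain2[OF psi(2) s])
  define Q1 where "Q1 t = A1 t * psi (s t) + A t * (psi1 (s t) * s1 t)" for t
  have "((\<lambda>t. A t * psi (s t)) has_real_derivative Q1 t) (at t)" for t
    unfolding Q1_def by (auto intro!: derivative_eq_intros A ps)
  moreover have v0: "A 0 = 1" "A1 0 = 0" "s 0 = tau" "s1 0 = beta"
    by (simp_all add: A_def A1_def s_def s1_def r0 N_def N1_def)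
  moreover have "(Q1 has_real_derivative psi2 tau * beta\<^sup>2 - psi1 tau * tau + (- 1 + 2 * W - 2 * xv\<^sup>2) * psi tau) (at 0)"
    unfolding Q1_def[abs_def]
    by (rule DERIV_cong, (rule derivative_intros A A2 ps s2 DERIV_mult DERIV_add)+) (simp add: v0 power2_eq_square algebra_simps)
  ultimately show ?thesis
    by (intro exI[of _ Q1]) (simp add: A_def[abs_def] s_def[abs_def] Q1_def r0)
qed

subsection \<open>Second variation at a touching point\<close>

context homogeneous_extension
begin

lemma dd_cong_punctured: "x \<noteq> 0 \<Longrightarrow> (\<And>y. y \<noteq> 0 \<Longrightarrow> F y = F' y) \<Longrightarrow> dd v F x = dd v F' x"
  by (rule dd_cong[OF open_punctured]) auto

lemma commute3: "x \<noteq> 0 \<Longrightarrow> dd u (dd v (dd w G)) x = dd v (dd u (dd w G)) x"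
  by (rule dd_commute[OF open_punctured Ck1]) simp

lemma commute3': "x \<noteq> 0 \<Longrightarrow> dd u (dd v (dd w G)) x = dd u (dd w (dd v G)) x"
  by (rule dd_cong_punctured[OF _ commute])

lemma commute4:
  assumes "x \<noteq> 0"
  shows "dd v (dd v (dd u (dd u G))) x = dd u (dd u (dd v (dd v G))) x"
proof -
  have "dd v (dd v (dd u (dd u G))) x = dd v (dd u (dd v (dd u G))) x"
    by (rule dd_cong_punctured[OF assms commute3])
  also have "\<dots> = dd u (dd v (dd v (dd u G))) x"
    by (rule dd_commute[OF open_punctured Ck2]) (use assms in simp)
  also have "\<dots> = dd u (dd v (dd u (dd v G))) x"
    by (rule dd_cong_punctured[OF assms commute3'])
  also have "\<dots> = dd u (dd u (dd v (dd v G))) x"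
    by (rule dd_cong_punctured[OF assms commute3])
  finally show ?thesis .
qed

lemma linear2: "x \<noteq> 0 \<Longrightarrow> linear (\<lambda>u. dd u (dd v G) x)" "x \<noteq> 0 \<Longrightarrow> linear (\<lambda>v. dd u (dd v G) x)"
  using bilinear[of x] by (simp_all add: bilinear_def)

lemma linear3: assumes "x \<noteq> 0" shows "linear (\<lambda>w. dd u (dd v (dd w G)) x)"
proof -
  have "linear (\<lambda>w. dd w (dd u (dd v G)) x)"
    by (rule dd_linear[OF open_punctured Ck2]) (use assms in simp)
  moreover have "dd w (dd u (dd v G)) x = dd u (dd v (dd w G)) x" for w
    using commute3[OF assms, of w u v] commute3'[OF assms, of u w v] by simp
  ultimately show ?thesis by simp
qed

lemma radial_kernel: "x \<noteq> 0 \<Longrightarrow> dd x (dd v G) x = 0" "x \<noteq> 0 \<Longrightarrow> dd v (dd x G) x = 0"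
  using euler1[of x v] commute[of x v x] by auto

text \<open>The bound extends from tangent vectors on the sphere to all \<open>y\<close> and
  \<open>V\<close> because the Hessian is homogeneous of degree -1 and has the radial direction in
  its kernel. The middle factor is \<open>(norm y)\<^sup>2\<close> times the squared length of the
  tangential part of \<open>V\<close>.\<close>

lemma quadratic_lower_bound:
  assumes low: "\<And>x u. norm x = 1 \<Longrightarrow> u \<bullet> x = 0 \<Longrightarrow> psi (x \<bullet> z) * (norm u)\<^sup>2 \<le> dd u (dd u G) x"
    and y: "y \<noteq> 0"
  shows "inverse (norm y) ^ 3 * ((norm y)\<^sup>2 * (norm V)\<^sup>2 - (y \<bullet> V)\<^sup>2) * psi (y \<bullet> z * inverse (norm y)) \<le> dd V (dd V G) y"
proof -
  define x where "x = y /\<^sub>R norm y"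
  have x: "norm x = 1" "x \<noteq> 0" "y = norm y *\<^sub>R x" using y by (auto simp: x_def)
  then have xx: "x \<bullet> x = 1" by (simp add: norm_eq_1)
  define u where "u = V - (x \<bullet> V) *\<^sub>R x"
  have Vx: "V \<bullet> x = x \<bullet> V" by (rule inner_commute)
  have ux: "u \<bullet> x = 0" by (simp add: u_def inner_diff_left xx Vx)
  note lin = linear2(1)[OF x(2)] linear2(2)[OF x(2)]
  have "dd u (dd u G) x = dd V (dd V G) x"
    by (simp add: u_def linear_diff[OF lin(1)] linear_diff[OF lin(2)] linear_scale[OF lin(1)]
        linear_scale[OF lin(2)] radial_kernel[OF x(2)])
  moreover have "dd V (dd V G) y = dd V (dd V G) x / norm y"
    by (subst x(3), subst dd2_scale) (use x y in auto)
  moreover have "(norm u)\<^sup>2 = (norm V)\<^sup>2 - (x \<bullet> V)\<^sup>2"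
    unfolding power2_norm_eq_inner u_def
    by (simp add: inner_diff_left inner_diff_right xx power2_eq_square Vx)
  ultimately have "psi (x \<bullet> z) * ((norm V)\<^sup>2 - (x \<bullet> V)\<^sup>2) / norm y \<le> dd V (dd V G) y"
    using low[OF x(1) ux] y by (simp add: divide_right_mono)
  moreover have "psi (x \<bullet> z) * ((norm V)\<^sup>2 - (x \<bullet> V)\<^sup>2) / norm y =
    inverse (norm y) ^ 3 * ((norm y)\<^sup>2 * (norm V)\<^sup>2 - (y \<bullet> V)\<^sup>2) * psi (y \<bullet> z * inverse (norm y))"
  proof -
    have *: "x \<bullet> V = y \<bullet> V * inverse (norm y)" "x \<bullet> z = y \<bullet> z * inverse (norm y)"
      by (simp_all add: x_def)
    have "c * (v - (q * inverse m)\<^sup>2) / m = inverse m ^ 3 * (m\<^sup>2 * v - q\<^sup>2) * c"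
      if "m \<noteq> 0" for c v q m :: real
      using that by (simp add: power2_eq_square power3_eq_cube field_simps)
    then show ?thesis unfolding * using y by simp
  qed
  ultimately show ?thesis by simp
qed

text \<open>Move the point along \<open>x0 + t *\<^sub>R xi\<close> and the vector along
  \<open>v + t *\<^sub>R w\<close>; the Hessian form minus the barrier then has a minimum at
  \<open>t = 0\<close>. The mixed term \<open>2 * t * dd v (dd w G)\<close> gives the coefficient 4,
  and \<open>t\<^sup>2 * dd w (dd w G)\<close> gives the coefficient 2. The condition
  \<open>dd v (dd w G) x0 = 0\<close> removes \<open>w\<close> from the first-order
  identity.\<close>

lemma touching_second_order:
  assumes psi: "\<And>s. (psi has_real_derivative psi1 s) (at s)" "\<And>s. (psi1 has_real_derivative psi2 s) (at s)"
    and low: "\<And>x u. norm x = 1 \<Longrightarrow> u \<bullet> x = 0 \<Longrightarrow> psi (x \<bullet> z) * (norm u)\<^sup>2 \<le> dd u (dd u G) x"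
    and x0: "norm x0 = 1" and v: "norm v = 1" "v \<bullet> x0 = 0" and xi: "norm xi = 1" "xi \<bullet> x0 = 0"
    and w: "w \<bullet> x0 = 0" "w \<bullet> v = 0" "dd v (dd w G) x0 = 0"
    and eq: "dd v (dd v G) x0 = psi (x0 \<bullet> z)"
  shows "dd xi (dd v (dd v G)) x0 = psi1 (x0 \<bullet> z) * (xi \<bullet> z)"
    "psi2 (x0 \<bullet> z) * (xi \<bullet> z)\<^sup>2 - psi1 (x0 \<bullet> z) * (x0 \<bullet> z) + (- 1 + 2 * (norm w)\<^sup>2 - 2 * (xi \<bullet> v)\<^sup>2) * psi (x0 \<bullet> z)
      \<le> dd xi (dd xi (dd v (dd v G))) x0 + 4 * dd xi (dd v (dd w G)) x0 + 2 * dd w (dd w G) x0"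
proof -
  have in0: "x0 \<bullet> x0 = 1" "xi \<bullet> xi = 1" "x0 \<bullet> xi = 0" "v \<bullet> v = 1" "x0 \<bullet> v = 0" "x0 \<bullet> w = 0" "v \<bullet> w = 0"
    using x0 xi v w by (simp_all add: norm_eq_1 inner_commute)
  define y where "y t = x0 + t *\<^sub>R xi" for t
  have y0: "y t \<noteq> 0" for t
  proof
    assume "y t = 0"
    then have "x0 \<bullet> y t = 0" by simp
    then show False by (simp add: y_def inner_add_right in0)
  qed
  have ny: "(norm (y t))\<^sup>2 = 1 + t\<^sup>2" for t
    using xi(2) unfolding power2_norm_eq_inner
    by (simp add: y_def inner_add_left inner_add_right in0 power2_eq_square)
  have inv: "inverse (norm (y t)) = (1 + t\<^sup>2) powr (- 1/2)" for t
    using inverse_norm_conv_powr[OF y0, of t] ny[of t] by (simp add: power2_norm_eq_inner)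
  let ?V = "\<lambda>t. v + t *\<^sub>R w"
  define q where "q t = ((1 + t\<^sup>2) powr (- 1/2)) ^ 3 *
      ((1 + t\<^sup>2) * (1 + t\<^sup>2 * (norm w)\<^sup>2) - (t * (xi \<bullet> v) + t\<^sup>2 * (xi \<bullet> w))\<^sup>2) *
      psi ((x0 \<bullet> z + t * (xi \<bullet> z)) * (1 + t\<^sup>2) powr (- 1/2))" for t
  obtain Q1 where Q: "\<And>t. (q has_real_derivative Q1 t) (at t)"
    "Q1 0 = psi1 (x0 \<bullet> z) * (xi \<bullet> z)"
    "(Q1 has_real_derivative psi2 (x0 \<bullet> z) * (xi \<bullet> z)\<^sup>2 - psi1 (x0 \<bullet> z) * (x0 \<bullet> z) +
       (- 1 + 2 * (norm w)\<^sup>2 - 2 * (xi \<bullet> v)\<^sup>2) * psi (x0 \<bullet> z)) (at 0)"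
    using touching_profile_derivatives[OF psi, of "norm w ^ 2" "xi \<bullet> v" "xi \<bullet> w" "x0 \<bullet> z" "xi \<bullet> z"]
    unfolding q_def[abs_def] by blast
  have q_le: "q t \<le> dd (?V t) (dd (?V t) G) (y t)" for t
  proof -
    have "(norm (?V t))\<^sup>2 = 1 + t\<^sup>2 * (norm w)\<^sup>2"
      unfolding power2_norm_eq_inner using w(2)
      by (simp add: inner_add_left inner_add_right in0 power2_eq_square)
    moreover have "y t \<bullet> ?V t = t * (xi \<bullet> v) + t\<^sup>2 * (xi \<bullet> w)"
      by (simp add: y_def inner_add_left inner_add_right in0 power2_eq_square algebra_simps)
    moreover have "y t \<bullet> z = x0 \<bullet> z + t * (xi \<bullet> z)" by (simp add: y_def inner_add_left)
    ultimately show ?thesis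
      using quadratic_lower_bound[OF low y0, of t "?V t"] by (simp add: q_def inv ny)
  qed
  have exp: "dd (?V t) (dd (?V t) G) (y t) = dd v (dd v G) (y t) + 2 * t * dd v (dd w G) (y t) + t\<^sup>2 * dd w (dd w G) (y t)" for t
  proof -
    note lin = linear2(1)[OF y0[of t]] linear2(2)[OF y0[of t]]
    show ?thesis
      by (simp add: linear_add[OF lin(1)] linear_add[OF lin(2)] linear_scale[OF lin(1)] linear_scale[OF lin(2)]
          commute[OF y0, of w v] power2_eq_square algebra_simps)
  qed
  have E: "((\<lambda>t. dd a (dd b G) (y t)) has_real_derivative dd xi (dd a (dd b G)) (y t)) (at t)" for a b t
    unfolding y_def by (rule dd_line[OF open_punctured Ck2]) (use y0 in \<open>simp add: y_def\<close>)
  have E': "((\<lambda>t. dd xi (dd a (dd b G)) (y t)) has_real_derivative dd xi (dd xi (dd a (dd b G))) (y t)) (at t)" for a b t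
    unfolding y_def by (rule dd_line[OF open_punctured Ck3]) (use y0 in \<open>simp add: y_def\<close>)
  let ?g = "\<lambda>t. dd v (dd v G) (y t) + 2 * t * dd v (dd w G) (y t) + t\<^sup>2 * dd w (dd w G) (y t) - q t"
  let ?g1 = "\<lambda>t. dd xi (dd v (dd v G)) (y t) + (2 * dd v (dd w G) (y t) + 2 * t * dd xi (dd v (dd w G)) (y t))
      + (2 * t * dd w (dd w G) (y t) + t\<^sup>2 * dd xi (dd w (dd w G)) (y t)) - Q1 t"
  let ?q2 = "psi2 (x0 \<bullet> z) * (xi \<bullet> z)\<^sup>2 - psi1 (x0 \<bullet> z) * (x0 \<bullet> z) + (- 1 + 2 * (norm w)\<^sup>2 - 2 * (xi \<bullet> v)\<^sup>2) * psi (x0 \<bullet> z)"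
  have g: "(?g has_real_derivative ?g1 t) (at t)" for t
    by (auto intro!: derivative_eq_intros E Q(1))
  have yy: "y 0 = x0" by (simp add: y_def)
  have g1: "(?g1 has_real_derivative dd xi (dd xi (dd v (dd v G))) x0 + 4 * dd xi (dd v (dd w G)) x0 + 2 * dd w (dd w G) x0 - ?q2) (at 0)"
    by (rule DERIV_cong, (rule derivative_intros E E' Q(3))+) (simp add: yy)
  have "q 0 = psi (x0 \<bullet> z)" by (simp add: q_def)
  then have g0: "?g 0 = 0" using eq by (simp add: yy)
  have min: "?g 0 \<le> ?g t" for t unfolding g0 using q_le[of t] exp[of t] by simp
  note res = second_derivative_min[OF open_UNIV UNIV_I g g1 min]
  from res(1) show "dd xi (dd v (dd v G)) x0 = psi1 (x0 \<bullet> z) * (xi \<bullet> z)"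
    using w(3) by (simp add: yy Q(2))
  from res(2) show "?q2 \<le> dd xi (dd xi (dd v (dd v G))) x0 + 4 * dd xi (dd v (dd w G)) x0 + 2 * dd w (dd w G) x0"
    by simp
qed

text \<open>Since \<open>psi (x0 \<bullet> z)\<close> is the eigenvalue of \<open>b o1\<close>, the
  term \<open>2 * (norm w)\<^sup>2 * psi (x0 \<bullet> z)\<close> moves to the other side and turns
  \<open>l j\<close> into \<open>l j - l o1\<close>. The coefficient -3 is the worst case of
  \<open>- 1 - 2 * (b i \<bullet> b o1)\<^sup>2\<close>.\<close>

lemma null_direction_at_touching:
  fixes b :: "'n::finite \<Rightarrow> 'a"
  assumes psi: "\<And>s. (psi has_real_derivative psi1 s) (at s)" "\<And>s. (psi1 has_real_derivative psi2 s) (at s)"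
    and low: "\<And>x u. norm x = 1 \<Longrightarrow> u \<bullet> x = 0 \<Longrightarrow> psi (x \<bullet> z) * (norm u)\<^sup>2 \<le> dd u (dd u G) x"
    and x0: "norm x0 = 1" and b: "orthonormal_frame_at x0 b"
    and diag: "\<And>i j. i \<noteq> j \<Longrightarrow> dd (b i) (dd (b j) G) x0 = 0"
    and eq: "dd (b o1) (dd (b o1) G) x0 = psi (x0 \<bullet> z)" and nonneg: "0 \<le> psi (x0 \<bullet> z)" and k: "1 \<le> k"
  shows "null_direction (\<lambda>i. dd (b i) (dd (b i) G) x0) (\<lambda>i j. dd (b i) (dd (b j) (dd (b o1) G)) x0)
    (\<lambda>i. dd (b i) (dd (b i) (dd (b o1) (dd (b o1) G))) x0)
    (\<lambda>i. psi2 (x0 \<bullet> z) * (b i \<bullet> z)\<^sup>2 - psi1 (x0 \<bullet> z) * (x0 \<bullet> z) - 3 * psi (x0 \<bullet> z)) o1 k"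
    and "dd (b i) (dd (b o1) (dd (b o1) G)) x0 = psi1 (x0 \<bullet> z) * (b i \<bullet> z)"
proof -
  have x00: "x0 \<noteq> 0" using x0 by auto
  note on = orthonormal_frame_atD[OF b]
  let ?l = "\<lambda>i. dd (b i) (dd (b i) G) x0"
  let ?t = "x0 \<bullet> z"
  let ?eta = "\<lambda>i j. dd (b i) (dd (b j) (dd (b o1) G)) x0"
  have sumw: "(\<Sum>j\<in>UNIV. w j *\<^sub>R b j) \<bullet> b m = w m" "(\<Sum>j\<in>UNIV. w j *\<^sub>R b j) \<bullet> x0 = 0" for w m
    by (simp_all add: inner_sum_left on if_distrib cong: if_cong)
  have Mw: "dd (b m) (dd (\<Sum>j\<in>UNIV. w j *\<^sub>R b j) G) x0 = w m * ?l m" for w m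
  proof -
    have "dd (b m) (dd (\<Sum>j\<in>UNIV. w j *\<^sub>R b j) G) x0 = (\<Sum>j\<in>UNIV. w j * dd (b m) (dd (b j) G) x0)"
      by (simp add: linear_sum[OF linear2(2)[OF x00]] linear_scale[OF linear2(2)[OF x00]])
    also have "\<dots> = (\<Sum>j\<in>UNIV. if j = m then w m * ?l m else 0)"
      by (intro sum.cong) (auto simp: diag)
    finally show ?thesis by simp
  qed
  show "dd (b i) (dd (b o1) (dd (b o1) G)) x0 = psi1 (?t) * (b i \<bullet> z)" for i
    by (rule touching_second_order(1)[OF psi low x0 on(4) on(2) on(4) on(2), of 0])
       (use eq linear_0[OF linear2(2)[OF x00]] in auto)
  show "null_direction ?l ?eta (\<lambda>i. dd (b i) (dd (b i) (dd (b o1) (dd (b o1) G))) x0)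
    (\<lambda>i. psi2 (?t) * (b i \<bullet> z)\<^sup>2 - psi1 (?t) * (?t) - 3 * psi (?t)) o1 k"
  proof
    show "?l o1 \<le> ?l i" for i using low[OF x0 on(2), of i] on(4)[of i] eq by simp
    show "0 \<le> ?l o1" using eq nonneg by simp
    show "?eta i j = ?eta j i" for i j by (rule commute3[OF x00])
    show "1 \<le> k" by (rule k)
    fix i and w :: "'n \<Rightarrow> real" assume w0: "w o1 = 0"
    define W where "W = (\<Sum>j\<in>UNIV. w j *\<^sub>R b j)"
    have nW: "(norm W)\<^sup>2 = (\<Sum>j\<in>UNIV. (w j)\<^sup>2)"
      unfolding power2_norm_eq_inner
      by (subst (2) W_def) (simp add: inner_sum_right sumw(1)[of w, folded W_def] power2_eq_square)
    have WW: "dd W (dd W G) x0 = (\<Sum>j\<in>UNIV. ?l j * (w j)\<^sup>2)"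
    proof -
      have "dd W (dd W G) x0 = (\<Sum>j\<in>UNIV. w j * dd (b j) (dd W G) x0)"
        by (subst (1) W_def) (simp add: linear_sum[OF linear2(1)[OF x00]] linear_scale[OF linear2(1)[OF x00]])
      then show ?thesis by (simp add: Mw[of _ w, folded W_def] power2_eq_square mult_ac)
    qed
    have xW: "dd (b i) (dd (b o1) (dd W G)) x0 = (\<Sum>j\<in>UNIV. w j * ?eta i j)"
    proof -
      have "dd (b i) (dd (b o1) (dd W G)) x0 = (\<Sum>j\<in>UNIV. w j * dd (b i) (dd (b o1) (dd (b j) G)) x0)"
        by (simp add: W_def linear_sum[OF linear3[OF x00]] linear_scale[OF linear3[OF x00]])
      then show ?thesis by (simp add: commute3'[OF x00, of "b i" "b o1"])
    qed
    have "psi2 (?t) * (b i \<bullet> z)\<^sup>2 - psi1 (?t) * (?t) + (- 1 + 2 * (norm W)\<^sup>2 - 2 * (b i \<bullet> b o1)\<^sup>2) * psi (?t)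
      \<le> dd (b i) (dd (b i) (dd (b o1) (dd (b o1) G))) x0 + 4 * dd (b i) (dd (b o1) (dd W G)) x0 + 2 * dd W (dd W G) x0"
      by (rule touching_second_order(2)[OF psi low x0 on(4) on(2) on(4) on(2)])
         (use eq w0 sumw[of w, folded W_def] Mw[of o1 w, folded W_def] in auto)
    moreover have "- 3 * psi (?t) + 2 * (norm W)\<^sup>2 * psi (?t) \<le> (- 1 + 2 * (norm W)\<^sup>2 - 2 * (b i \<bullet> b o1)\<^sup>2) * psi (?t)"
    proof -
      have "(b i \<bullet> b o1)\<^sup>2 \<le> 1" by (simp add: on)
      then have "(- 3 + 2 * (norm W)\<^sup>2) * psi (?t) \<le> (- 1 + 2 * (norm W)\<^sup>2 - 2 * (b i \<bullet> b o1)\<^sup>2) * psi (?t)"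
        by (intro mult_right_mono nonneg) simp
      then show ?thesis by (simp add: algebra_simps)
    qed
    moreover have "2 * (\<Sum>j\<in>UNIV. (?l j - ?l o1) * (w j)\<^sup>2) = 2 * dd W (dd W G) x0 - 2 * (norm W)\<^sup>2 * psi (?t)"
      unfolding WW nW eq by (simp add: left_diff_distrib sum_subtractf sum_distrib_left mult_ac right_diff_distrib)
    ultimately show "psi2 (?t) * (b i \<bullet> z)\<^sup>2 - psi1 (?t) * (?t) - 3 * psi (?t)
      \<le> dd (b i) (dd (b i) (dd (b o1) (dd (b o1) G))) x0 + 4 * (\<Sum>j\<in>UNIV. w j * ?eta i j) + 2 * (\<Sum>j\<in>UNIV. (?l j - ?l o1) * (w j)\<^sup>2)"
      unfolding xW by linarith
  qed
qed

text \<open>The frame at \<open>x0\<close> can be kept along the whole line. A frame at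
  \<open>y /\<^sub>R norm y\<close> arises by rotating only \<open>b o1\<close>, and modulo the
  radial kernel the rotated vector is \<open>norm y\<close> times \<open>b o1\<close>; this costs
  the factor \<open>1 + s\<^sup>2\<close> in the minors containing \<open>o1\<close>. The power of
  \<open>norm y\<close> reflects the degree -1 of the Hessian.\<close>

lemma sigma_sym_on_line:
  fixes b e :: "'n::finite \<Rightarrow> 'a" and o1 :: 'n and s :: real
  assumes x0: "norm x0 = 1" and b: "orthonormal_frame_at x0 b" and dim: "DIM('a) = CARD('n) + 1"
  defines "y \<equiv> x0 + s *\<^sub>R b o1"
  assumes e: "orthonormal_frame_at (y /\<^sub>R norm y) e"
  shows "sigma_sym k (W_matrix e g (y /\<^sub>R norm y)) = norm y ^ k *
    (\<Sum>I | card I = k. (if o1 \<in> I then 1 + s\<^sup>2 else 1) * pminor (\<lambda>i j. dd (b i) (dd (b j) G) y) I)"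
proof -
  have "x0 \<bullet> x0 = 1" using x0 by (simp add: norm_eq_1)
  note on = orthonormal_frame_atD[OF b] this
  define r where "r = norm y"
  have r2: "r\<^sup>2 = 1 + s\<^sup>2"
    unfolding r_def power2_norm_eq_inner by (simp add: y_def inner_add_left inner_add_right on power2_eq_square)
  have "0 < 1 + s\<^sup>2" by (simp add: add_pos_nonneg)
  then have r: "0 < r" using r2 by (metis norm_ge_zero r_def zero_less_power2 less_eq_real_def)
  then have y: "y \<noteq> 0" by (simp add: r_def)
  define x where "x = y /\<^sub>R r"
  have x: "norm x = 1" "x \<noteq> 0" "y = r *\<^sub>R x" using r by (auto simp: x_def r_def)
  define b' where "b' i = (if i = o1 then (b o1 - s *\<^sub>R x0) /\<^sub>R r else b i)" for i
  have frb': "orthonormal_frame_at x b'"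
    unfolding orthonormal_frame_at_def
  proof (intro conjI allI)
    fix i j
    have "b' i \<bullet> y = 0" by (simp add: b'_def y_def inner_add_right inner_diff_left on)
    then show "b' i \<bullet> x = 0" by (simp add: x_def)
    have "(b o1 - s *\<^sub>R x0) \<bullet> (b o1 - s *\<^sub>R x0) = r\<^sup>2"
      unfolding r2 by (simp add: inner_diff_left inner_diff_right on power2_eq_square)
    then have "((b o1 - s *\<^sub>R x0) /\<^sub>R r) \<bullet> ((b o1 - s *\<^sub>R x0) /\<^sub>R r) = 1"
      unfolding inner_scaleR_left inner_scaleR_right using r by (simp only:) (simp add: power2_eq_square field_simps)
    then show "b' i \<bullet> b' j = (if i = j then 1 else 0)"
      by (cases "i = o1 \<and> j = o1") (auto simp: b'_def on inner_diff_left inner_diff_right)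
  qed
  \<comment> \<open>The factor \<open>r\<close> due to homogeneity is split evenly between row and
    column, as \<open>pminor_scale\<close> requires.\<close>
  let ?c = "\<lambda>i. sqrt r * (if i = o1 then r else 1)"
  have entry: "dd (b' i) (dd (b' j) G) x = ?c i * ?c j * dd (b i) (dd (b j) G) y" for i j
  proof -
    note lin = linear2(1)[OF y] linear2(2)[OF y]
    have b': "b' i = (if i = o1 then r else 1) *\<^sub>R b i - (if i = o1 then s / r else 0) *\<^sub>R y" for i
    proof (cases "i = o1")
      case True
      have "b o1 - s *\<^sub>R x0 = (1 + s\<^sup>2) *\<^sub>R b o1 - s *\<^sub>R y"
        by (simp add: y_def algebra_simps power2_eq_square)
      then have "(b o1 - s *\<^sub>R x0) /\<^sub>R r = (inverse r * r\<^sup>2) *\<^sub>R b o1 - (inverse r * s) *\<^sub>R y"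
        by (simp add: r2 scaleR_diff_right)
      then show ?thesis using True r by (simp add: b'_def power2_eq_square divide_inverse mult.commute)
    qed (simp add: b'_def)
    have "dd (b' i) (dd (b' j) G) y = (if i = o1 then r else 1) * (if j = o1 then r else 1) * dd (b i) (dd (b j) G) y"
      unfolding b' linear_diff[OF lin(1)] linear_diff[OF lin(2)] linear_scale[OF lin(1)] linear_scale[OF lin(2)]
      by (simp add: radial_kernel[OF y])
    moreover have "dd (b' i) (dd (b' j) G) y = dd (b' i) (dd (b' j) G) x / r"
      by (subst x(3)) (rule dd2_scale[OF r x(2)])
    ultimately have "dd (b' i) (dd (b' j) G) x = r * ((if i = o1 then r else 1) * (if j = o1 then r else 1) * dd (b i) (dd (b j) G) y)"
      using r by (simp add: field_simps)
    also have "\<dots> = (sqrt r * sqrt r) * ((if i = o1 then r else 1) * (if j = o1 then r else 1) * dd (b i) (dd (b j) G) y)"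
      using r by simp
    finally show ?thesis by (simp only: mult_ac)
  qed
  have frame_e: "orthonormal_frame_at x e" using e by (simp add: x_def r_def)
  have "sigma_sym k (W_matrix e g x) = sigma_sym k (qmat e (\<lambda>u v. dd u (dd v G) x))"
    by (simp only: W_matrix_eq[OF x(1) frame_e])
  also have "\<dots> = (\<Sum>I | card I = k. pminor (\<lambda>i j. dd (b' i) (dd (b' j) G) x) I)"
    by (rule sigma_sym_qmat[OF frame_e frb' x(2) dim bilinear[OF x(2)] commute[OF x(2)]])
  also have "\<dots> = (\<Sum>I | card I = k. r ^ k * ((if o1 \<in> I then 1 + s\<^sup>2 else 1) * pminor (\<lambda>i j. dd (b i) (dd (b j) G) y) I))"
  proof (rule sum.cong[OF refl])
    fix I :: "'n set" assume I: "I \<in> {I. card I = k}"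
    have "(\<Prod>i\<in>I. ?c i)\<^sup>2 = (\<Prod>i\<in>I. r * (if i = o1 then r\<^sup>2 else 1))"
      unfolding prod_power_distrib by (intro prod.cong refl) (use r in \<open>auto simp: power_mult_distrib\<close>)
    also have "\<dots> = r ^ k * (if o1 \<in> I then 1 + s\<^sup>2 else 1)"
      using I by (simp add: prod.distrib r2)
    finally show "pminor (\<lambda>i j. dd (b' i) (dd (b' j) G) x) I =
        r ^ k * ((if o1 \<in> I then 1 + s\<^sup>2 else 1) * pminor (\<lambda>i j. dd (b i) (dd (b j) G) y) I)"
      unfolding entry by (subst pminor_scale) (simp_all add: mult.assoc)
  qed
  also have "\<dots> = r ^ k * (\<Sum>I | card I = k. (if o1 \<in> I then 1 + s\<^sup>2 else 1) * pminor (\<lambda>i j. dd (b i) (dd (b j) G) y) I)"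
    by (simp add: sum_distrib_left)
  finally show ?thesis by (simp add: x_def r_def)
qed

end

subsection \<open>The equation along a line\<close>

lemma orthonormal_frame_parseval:
  fixes x :: "'a::euclidean_space" and b :: "'n::finite \<Rightarrow> 'a"
  assumes b: "orthonormal_frame_at x b" and x: "norm x = 1" and "DIM('a) = CARD('n) + 1"
  shows "(norm v)\<^sup>2 = (\<Sum>i\<in>UNIV. (v \<bullet> b i)\<^sup>2) + (v \<bullet> x)\<^sup>2"
proof -
  have "x \<bullet> x = 1" using x by (simp add: norm_eq_1)
  note on = orthonormal_frame_atD[OF b] this
  define u where "u = v - (v \<bullet> x) *\<^sub>R x"
  have "u \<bullet> x = 0" by (simp add: u_def inner_diff_left on)
  from orthonormal_frame_at_expand[OF b _ assms(3) this] x
  have "u = (\<Sum>i\<in>UNIV. (u \<bullet> b i) *\<^sub>R b i)" by force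
  moreover have "u \<bullet> b i = v \<bullet> b i" for i by (simp add: u_def inner_diff_left on)
  ultimately have v: "v = (\<Sum>i\<in>UNIV. (v \<bullet> b i) *\<^sub>R b i) + (v \<bullet> x) *\<^sub>R x"
    by (simp add: u_def eq_diff_eq diff_eq_eq)
  have "v \<bullet> v = (\<Sum>i\<in>UNIV. (v \<bullet> b i) * (v \<bullet> b i)) + (v \<bullet> x) * (v \<bullet> x)"
    by (subst (2) v) (simp add: inner_add_right inner_sum_right)
  then show ?thesis unfolding power2_norm_eq_inner by (simp add: power2_eq_square)
qed

context homogeneous_extension
begin

lemma abs_dd_le:
  fixes K :: "'a \<Rightarrow> real"
  assumes K: "Ck_on (Suc m) (- {0}) K" and x: "x \<noteq> 0" and u: "norm u = 1"
  shows "\<bar>dd u K x\<bar> \<le> (\<Sum>b\<in>Basis. \<bar>dd b K x\<bar>)"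
proof -
  have lin: "linear (\<lambda>v. dd v K x)" by (rule dd_linear[OF open_punctured K]) (use x in simp)
  have "dd u K x = dd (\<Sum>b\<in>Basis. (u \<bullet> b) *\<^sub>R b) K x" by (simp add: euclidean_representation)
  also have "\<dots> = (\<Sum>b\<in>Basis. (u \<bullet> b) * dd b K x)"
    by (simp add: linear_sum[OF lin] linear_scale[OF lin])
  also have "\<bar>\<dots>\<bar> \<le> (\<Sum>b\<in>Basis. \<bar>(u \<bullet> b) * dd b K x\<bar>)" by (rule sum_abs)
  also have "\<dots> \<le> (\<Sum>b\<in>Basis. \<bar>dd b K x\<bar>)"
  proof (rule sum_mono)
    fix b :: 'a assume "b \<in> Basis"
    then have "\<bar>u \<bullet> b\<bar> \<le> 1" using Basis_le_norm[of b u] u by simp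
    then show "\<bar>(u \<bullet> b) * dd b K x\<bar> \<le> \<bar>dd b K x\<bar>"
      unfolding abs_mult by (rule mult_left_le_one_le[rotated 2]) auto
  qed
  finally show ?thesis .
qed

text \<open>Sums over basis directions are continuous, hence bounded on the sphere. Commuting the
  derivatives brings each given unit direction to the outermost place in turn, where
  \<open>abs_dd_le\<close> exchanges it for basis directions.\<close>

lemma derivatives_bounded:
  "\<exists>B. \<forall>x u v w. norm x = 1 \<longrightarrow> norm u = 1 \<longrightarrow> norm v = 1 \<longrightarrow> norm w = 1 \<longrightarrow>
     \<bar>dd u G x\<bar> \<le> B \<and> \<bar>dd u (dd v G) x\<bar> \<le> B \<and> \<bar>dd u (dd v (dd w G)) x\<bar> \<le> B"
proof -
  have bounded: "\<exists>B. \<forall>x\<in>sphere 0 1. F x \<le> B" if "continuous_on (- {0}) F" for F :: "'a \<Rightarrow> real"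
  proof -
    have "continuous_on (sphere 0 1) F" by (rule continuous_on_subset[OF that]) auto
    then have "bounded (F ` sphere 0 1)"
      by (intro compact_imp_bounded compact_continuous_image) auto
    then obtain B where "\<forall>y\<in>F ` sphere 0 1. norm y \<le> B" unfolding bounded_iff by blast
    then have "\<forall>x\<in>sphere 0 1. \<bar>F x\<bar> \<le> B" by (simp del: mem_sphere)
    then show ?thesis by (meson abs_le_D1)
  qed
  let ?F1 = "\<lambda>x. \<Sum>b\<in>Basis. \<bar>dd b G x\<bar>"
  let ?F2 = "\<lambda>x. \<Sum>b\<in>Basis. \<Sum>b'\<in>Basis. \<bar>dd b' (dd b G) x\<bar>"
  let ?F3 = "\<lambda>x. \<Sum>b\<in>Basis. \<Sum>b'\<in>Basis. \<Sum>b''\<in>Basis. \<bar>dd b'' (dd b' (dd b G)) x\<bar>"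
  have c: "continuous_on (- {0}) (dd u G)" "continuous_on (- {0}) (dd u (dd v G))"
    "continuous_on (- {0}) (dd u (dd v (dd w G)))" for u v w
    using Ck1[of 0] Ck2[of 0] Ck3[of 0] by simp_all
  have "\<exists>B. \<forall>x\<in>sphere 0 1. ?F1 x \<le> B" "\<exists>B. \<forall>x\<in>sphere 0 1. ?F2 x \<le> B" "\<exists>B. \<forall>x\<in>sphere 0 1. ?F3 x \<le> B"
    by (intro bounded continuous_intros c)+
  then obtain B1 B2 B3 where "\<forall>x\<in>sphere 0 1. ?F1 x \<le> B1" "\<forall>x\<in>sphere 0 1. ?F2 x \<le> B2"
    "\<forall>x\<in>sphere 0 1. ?F3 x \<le> B3" by blast
  then have B: "?F1 x \<le> B1" "?F2 x \<le> B2" "?F3 x \<le> B3" if "norm x = 1" for x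
    using that by simp_all
  have le: "\<bar>dd u G x\<bar> \<le> ?F1 x \<and> \<bar>dd u (dd v G) x\<bar> \<le> ?F2 x \<and> \<bar>dd u (dd v (dd w G)) x\<bar> \<le> ?F3 x"
    if x: "norm x = 1" and u: "norm u = 1" "norm v = 1" "norm w = 1" for x u v w
  proof (intro conjI)
    have x0: "x \<noteq> 0" using x by auto
    note a = abs_dd_le[OF Ck[of "Suc 0"] x0] abs_dd_le[OF Ck1[of "Suc 0"] x0] abs_dd_le[OF Ck2[of "Suc 0"] x0]
    show "\<bar>dd u G x\<bar> \<le> ?F1 x" by (rule a(1)[OF u(1)])
    have "\<bar>dd u (dd v G) x\<bar> \<le> (\<Sum>b\<in>Basis. \<bar>dd v (dd b G) x\<bar>)"
      using a(2)[OF u(1), of v] by (simp only: commute[OF x0, of _ v])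
    also have "\<dots> \<le> ?F2 x" by (intro sum_mono a(2) u)
    finally show "\<bar>dd u (dd v G) x\<bar> \<le> ?F2 x" .
    have "\<bar>dd u (dd v (dd w G)) x\<bar> \<le> (\<Sum>b\<in>Basis. \<bar>dd b (dd v (dd w G)) x\<bar>)" by (rule a(3)[OF u(1)])
    also have "\<dots> = (\<Sum>b\<in>Basis. \<bar>dd v (dd w (dd b G)) x\<bar>)"
    proof -
      have "dd b (dd v (dd w G)) x = dd v (dd w (dd b G)) x" for b
        using commute3[OF x0, of b v w] commute3'[OF x0, of v b w] by simp
      then show ?thesis by simp
    qed
    also have "\<dots> \<le> (\<Sum>b\<in>Basis. \<Sum>b'\<in>Basis. \<bar>dd b' (dd w (dd b G)) x\<bar>)" by (intro sum_mono a(3) u)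
    also have "\<dots> = (\<Sum>b\<in>Basis. \<Sum>b'\<in>Basis. \<bar>dd w (dd b' (dd b G)) x\<bar>)"
      by (intro sum.cong refl arg_cong[of _ _ abs] commute3[OF x0])
    also have "\<dots> \<le> ?F3 x" by (intro sum_mono a(3) u)
    finally show "\<bar>dd u (dd v (dd w G)) x\<bar> \<le> ?F3 x" .
  qed
  show ?thesis
  proof (intro exI[of _ "max B1 (max B2 B3)"] allI impI)
    fix x u v w :: 'a assume x: "norm x = 1" and u: "norm u = 1" "norm v = 1" "norm w = 1"
    from le[OF x u] B[OF x]
    show "\<bar>dd u G x\<bar> \<le> max B1 (max B2 B3) \<and> \<bar>dd u (dd v G) x\<bar> \<le> max B1 (max B2 B3) \<and>
      \<bar>dd u (dd v (dd w G)) x\<bar> \<le> max B1 (max B2 B3)" by linarith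
  qed
qed

lemma pminor_on_line:
  fixes b :: "'i \<Rightarrow> 'a"
  assumes y: "\<And>s. x + s *\<^sub>R v \<noteq> 0" and "finite I"
    and diag: "\<And>i j. i \<noteq> j \<Longrightarrow> dd (b i) (dd (b j) G) x = 0"
  shows "\<exists>D. (\<forall>t. ((\<lambda>t. pminor (\<lambda>i j. dd (b i) (dd (b j) G) (x + t *\<^sub>R v)) I) has_real_derivative D t) (at t)) \<and>
    D 0 = (\<Sum>i\<in>I. prod (\<lambda>i. dd (b i) (dd (b i) G) x) (I - {i}) * dd (b i) (dd (b i) (dd v G)) x) \<and>
    (D has_real_derivative (\<Sum>i\<in>I. prod (\<lambda>i. dd (b i) (dd (b i) G) x) (I - {i}) * dd (b i) (dd (b i) (dd v (dd v G))) x) +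
      (\<Sum>i\<in>I. \<Sum>j\<in>I - {i}. prod (\<lambda>i. dd (b i) (dd (b i) G) x) (I - {i} - {j}) *
        (dd (b i) (dd (b i) (dd v G)) x * dd (b j) (dd (b j) (dd v G)) x
         - dd (b i) (dd (b j) (dd v G)) x * dd (b j) (dd (b i) (dd v G)) x))) (at 0)"
proof -
  have x: "x \<noteq> 0" using y[of 0] by simp
  have line: "((\<lambda>s. K (x + s *\<^sub>R v)) has_real_derivative dd v K (x + s *\<^sub>R v)) (at s)"
    if "Ck_on (Suc 0) (- {0}) K" for K s
    by (rule dd_line[OF open_punctured that]) (use y in simp)
  have line0: "((\<lambda>s. K (x + s *\<^sub>R v)) has_real_derivative dd v K x) (at 0)"
    if "Ck_on (Suc 0) (- {0}) K" for K
    using line[OF that, of 0] by simp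
  have e1: "dd v (dd (b i) (dd (b j) G)) x = dd (b i) (dd (b j) (dd v G)) x" for i j
    using commute3[OF x, of v "b i" "b j"] commute3'[OF x, of "b i" v "b j"] by simp
  have e2: "dd v (dd v (dd (b i) (dd (b i) G))) x = dd (b i) (dd (b i) (dd v (dd v G))) x" for i
    by (rule commute4[OF x])
  note sd = pminor_second_derivative[OF assms(2) UNIV_I,
      where M = "\<lambda>i j t. dd (b i) (dd (b j) G) (x + t *\<^sub>R v)" and l = "\<lambda>i. dd (b i) (dd (b i) G) x"
        and ?M1.0 = "\<lambda>i j t. dd v (dd (b i) (dd (b j) G)) (x + t *\<^sub>R v)"
        and ?M2.0 = "\<lambda>i j. dd v (dd v (dd (b i) (dd (b j) G))) x", OF line[OF Ck2] line0[OF Ck3]]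
  show ?thesis using sd diag by (simp add: e1 e2)
qed

end

lemma sphere_positive_bounds:
  fixes F :: "'a::euclidean_space \<Rightarrow> real"
  assumes "continuous_on (sphere 0 1) F" "\<And>x. norm x = 1 \<Longrightarrow> 0 < F x"
  shows "\<exists>B\<ge>1. \<forall>x. norm x = 1 \<longrightarrow> 1 / B \<le> F x \<and> F x \<le> B"
proof -
  have ne: "sphere (0::'a) 1 \<noteq> {}" by simp
  obtain x1 where x1: "x1 \<in> sphere 0 1" "\<And>x. x \<in> sphere 0 1 \<Longrightarrow> F x1 \<le> F x"
    using continuous_attains_inf[OF compact_sphere ne assms(1)] by blast
  obtain x2 where x2: "x2 \<in> sphere 0 1" "\<And>x. x \<in> sphere 0 1 \<Longrightarrow> F x \<le> F x2"
    using continuous_attains_sup[OF compact_sphere ne assms(1)] by blast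
  define B where "B = max 1 (max (1 / F x1) (F x2))"
  have "0 < F x1" using x1(1) assms(2) by simp
  moreover have "1 / F x1 \<le> B" "0 < B" by (auto simp: B_def)
  ultimately have "1 / B \<le> F x1" by (simp add: field_simps)
  moreover have "F x2 \<le> B" "1 \<le> B" by (auto simp: B_def)
  ultimately show ?thesis using x1(2) x2(2)
    by (intro exI[of _ B]) (auto, (meson mem_sphere_0 order_trans)+)
qed

text \<open>In the application \<open>P = p - 1\<close>, \<open>c = (k + 1 - q) / 2\<close> and \<open>phi\<close> is \<open>f\<close> to the power \<open>- 1 / (k + P)\<close>.\<close>

locale curvature_problem = H: homogeneous_extension h + F: homogeneous_extension phi
  for h phi :: "'a::euclidean_space \<Rightarrow> real" +
  fixes k :: nat and P c :: real and e :: "'a \<Rightarrow> 'n::finite \<Rightarrow> 'a"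
  assumes dim: "DIM('a) = CARD('n) + 1" and k: "1 \<le> k" and P: "0 \<le> P"
    and e: "\<And>x. norm x = 1 \<Longrightarrow> orthonormal_frame_at x (e x)"
    and h_pos: "\<And>x. norm x = 1 \<Longrightarrow> 0 < h x" and phi_pos: "\<And>x. norm x = 1 \<Longrightarrow> 0 < phi x"
    and phi_convex: "\<And>x u. norm x = 1 \<Longrightarrow> u \<bullet> x = 0 \<Longrightarrow> 0 \<le> dd u (dd u F.G) x"
    and equation: "\<And>x. norm x = 1 \<Longrightarrow> sigma_sym k (W_matrix (e x) h x) =
      phi x powr (- (k + P)) * h x powr P * ((norm (grad H.G x))\<^sup>2) powr c"
begin

lemma pos: "y \<noteq> 0 \<Longrightarrow> 0 < F.G y" "y \<noteq> 0 \<Longrightarrow> 0 < H.G y" "y \<noteq> 0 \<Longrightarrow> 0 < (norm (grad H.G y))\<^sup>2"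
proof -
  assume y: "y \<noteq> 0"
  show "0 < F.G y" "0 < H.G y"
    using y h_pos[of "y /\<^sub>R norm y"] phi_pos[of "y /\<^sub>R norm y"] by (auto simp: hom_ext_def)
  then have "grad H.G y \<bullet> y \<noteq> 0" using H.grad_inner_G[OF y] H.euler[OF y] by simp
  then show "0 < (norm (grad H.G y))\<^sup>2" by auto
qed

text \<open>The right-hand side of the equation off the sphere. It is homogeneous of degree
  \<open>- k\<close>, like sigma_k of the Hessian of \<open>H.G\<close>, so the powers of
  \<open>norm y\<close> cancel in \<open>equation_on_line\<close>.\<close>

definition R :: "'a \<Rightarrow> real" where
  "R y = F.G y powr (- (k + P)) * H.G y powr P * ((norm (grad H.G y))\<^sup>2) powr c"

lemma equation_on_line:
  fixes b :: "'n \<Rightarrow> 'a"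
  assumes x0: "norm x0 = 1" and b: "orthonormal_frame_at x0 b"
  shows "(\<Sum>I | card I = k. (if o1 \<in> I then 1 + s\<^sup>2 else 1) *
      pminor (\<lambda>i j. dd (b i) (dd (b j) H.G) (x0 + s *\<^sub>R b o1)) I) = R (x0 + s *\<^sub>R b o1)"
proof -
  define y where "y = x0 + s *\<^sub>R b o1"
  have "x0 \<bullet> y = 1"
    using x0 b unfolding orthonormal_frame_at_def by (simp add: y_def inner_add_right norm_eq_1 inner_commute)
  then have y: "y \<noteq> 0" by auto
  define x where "x = y /\<^sub>R norm y"
  have x: "norm x = 1" "x = inverse (norm y) *\<^sub>R y" using y by (auto simp: x_def)
  have ny: "0 < norm y" using y by simp
  have G: "F.G x = F.G y / norm y" "H.G x = H.G y / norm y" "grad H.G x = grad H.G y"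
    using ny y by (simp_all add: x(2) hom_ext_scale H.grad_scale divide_inverse mult.commute)
  have "norm y ^ k * (\<Sum>I | card I = k. (if o1 \<in> I then 1 + s\<^sup>2 else 1) *
      pminor (\<lambda>i j. dd (b i) (dd (b j) H.G) y) I) = sigma_sym k (W_matrix (e x) h x)"
    using H.sigma_sym_on_line[OF x0 b dim, of s o1 "e x" k] e[OF x(1)] by (simp add: x_def y_def)
  also have "\<dots> = (F.G y / norm y) powr (- (k + P)) * (H.G y / norm y) powr P * ((norm (grad H.G y))\<^sup>2) powr c"
    using equation[OF x(1)] G hom_ext_sphere[OF x(1), of phi] hom_ext_sphere[OF x(1), of h] by simp
  also have "\<dots> = norm y powr (k + P) * norm y powr (- P) * R y"
  proof -
    have "(u / norm y) powr t = u powr t * norm y powr (- t)" if "0 < u" for u t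
      using that ny by (simp add: powr_divide powr_minus) (simp add: divide_inverse)
    from this[OF pos(1)[OF y]] this[OF pos(2)[OF y]] show ?thesis by (simp add: R_def add.commute)
  qed
  also have "norm y powr (k + P) * norm y powr (- P) = norm y ^ k"
    using ny by (simp add: powr_add[symmetric] powr_realpow)
  finally show ?thesis using y unfolding y_def by simp
qed

text \<open>The equation is differentiated twice along \<open>b o1\<close>, once as a sum of minors
  and once as a product of powers; uniqueness of derivatives joins the two bounds. Every term on the
  right carries \<open>mu\<close> or \<open>m\<close>, because \<open>b o1\<close> is an eigenvector
  with eigenvalue \<open>mu\<close> and the third derivatives with two arguments \<open>b o1\<close>
  and one argument \<open>b i\<close> are \<open>m * (b i \<bullet> z)\<close>.\<close>

lemma touching_estimate:
  fixes b :: "'n \<Rightarrow> 'a"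
  assumes psi: "\<And>s. (psi has_real_derivative psi1 s) (at s)" "\<And>s. (psi1 has_real_derivative psi2 s) (at s)"
    and low: "\<And>x u. norm x = 1 \<Longrightarrow> u \<bullet> x = 0 \<Longrightarrow> psi (x \<bullet> z) * (norm u)\<^sup>2 \<le> dd u (dd u H.G) x"
    and x0: "norm x0 = 1" and b: "orthonormal_frame_at x0 b"
    and diag: "\<And>i j. i \<noteq> j \<Longrightarrow> dd (b i) (dd (b j) H.G) x0 = 0"
    and eq: "dd (b o1) (dd (b o1) H.G) x0 = psi (x0 \<bullet> z)" and nonneg: "0 \<le> psi (x0 \<bullet> z)"
    and B: "1 \<le> B" "\<And>i. \<bar>dd (b i) (dd (b i) H.G) x0\<bar> \<le> B"
      "\<And>i. \<bar>dd (b i) (dd (b i) (dd (b o1) H.G)) x0\<bar> \<le> B" "1 / B \<le> R x0"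
  defines "mu \<equiv> psi (x0 \<bullet> z)" and "m \<equiv> psi1 (x0 \<bullet> z)" and "d \<equiv> (norm (grad H.G x0))\<^sup>2"
  defines "Fd \<equiv> null_direction.Fd (\<lambda>i. dd (b i) (dd (b i) H.G) x0) k"
  shows "(\<Sum>i\<in>UNIV. Fd i * (psi2 (x0 \<bullet> z) * (b i \<bullet> z)\<^sup>2 - m * (x0 \<bullet> z) - 3 * mu))
      - 8 * real CARD('n) * 4 ^ CARD('n) * B ^ (2 * CARD('n) + 3) * \<bar>m * (b o1 \<bullet> z)\<bar>
    \<le> R x0 * (P * mu / h x0
      + c * ((2 * mu\<^sup>2 + 2 * m * (\<Sum>i\<in>UNIV. dd (b i) H.G x0 * (b i \<bullet> z)) - 2 * h x0 * mu) / d - (2 * mu * dd (b o1) H.G x0 / d)\<^sup>2)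
      + 2 / k * ((k + P) * (dd (b o1) F.G x0 / phi x0) - P * (dd (b o1) H.G x0 / h x0)) * (c * (2 * mu * dd (b o1) H.G x0) / d))" (is ?estimate)
    and "0 \<le> Fd i" and "Fd i \<le> 2 ^ CARD('n) * B ^ CARD('n)" and "R x0 \<le> 2 ^ CARD('n) * B * Fd i"
proof -
  let ?v = "b o1"
  let ?l = "\<lambda>i. dd (b i) (dd (b i) H.G) x0"
  let ?eta = "\<lambda>i j. dd (b i) (dd (b j) (dd ?v H.G)) x0"
  let ?Z = "\<lambda>i. dd (b i) (dd (b i) (dd ?v (dd ?v H.G))) x0"
  let ?ph = "\<lambda>i. psi2 (x0 \<bullet> z) * (b i \<bullet> z)\<^sup>2 - psi1 (x0 \<bullet> z) * (x0 \<bullet> z) - 3 * psi (x0 \<bullet> z)"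
  have nd: "null_direction ?l ?eta ?Z ?ph o1 k"
    by (rule H.null_direction_at_touching[OF psi low x0 b diag eq nonneg k])
  have eta1: "dd (b i) (dd ?v (dd ?v H.G)) x0 = m * (b i \<bullet> z)" for i
    unfolding m_def by (rule H.null_direction_at_touching(2)[OF psi low x0 b diag eq nonneg k])
  interpret nd: null_direction ?l ?eta ?Z ?ph o1 k by (rule nd)
  note on = orthonormal_frame_atD[OF b]
  have x00: "x0 \<noteq> 0" using x0 by auto
  define y where "y s = x0 + s *\<^sub>R ?v" for s
  have y0: "y s \<noteq> 0" for s
  proof
    assume "y s = 0"
    then have "x0 \<bullet> y s = 0" by simp
    then show False using x0 by (simp add: y_def inner_add_right on norm_eq_1)
  qed
  have yy: "y 0 = x0" by (simp add: y_def)
  have line: "((\<lambda>s. K (y s)) has_real_derivative dd ?v K (y s)) (at s)" if "Ck_on (Suc 0) (- {0}) K" for K s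
    unfolding y_def by (rule dd_line[OF open_punctured that]) (use y0 in \<open>simp add: y_def\<close>)
  define fac where "fac I s = (if o1 \<in> I then 1 + s\<^sup>2 else 1)" for I and s :: real
  define fac1 where "fac1 I s = (if o1 \<in> I then 2 * s else 0)" for I and s :: real
  define pm where "pm I s = pminor (\<lambda>i j. dd (b i) (dd (b j) H.G) (y s)) I" for I s
  have "\<forall>I. \<exists>D. (\<forall>t. (pm I has_real_derivative D t) (at t)) \<and>
      D 0 = (\<Sum>i\<in>I. prod ?l (I - {i}) * ?eta i i) \<and> (D has_real_derivative nd.S I) (at 0)"
    using H.pminor_on_line[of x0 ?v _ b, folded y_def, OF y0 finite diag] unfolding nd.S_def pm_def[abs_def] by (rule allI)
  from choice[OF this] obtain D where D: "\<And>I t. (pm I has_real_derivative D I t) (at t)"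
    "\<And>I. D I 0 = (\<Sum>i\<in>I. prod ?l (I - {i}) * ?eta i i)" "\<And>I. (D I has_real_derivative nd.S I) (at 0)"
    by blast
  have pm0: "pm I 0 = prod ?l I" for I
    unfolding pm_def by (subst pminor_diag) (auto simp: yy diag)
  have Req: "R (y s) = (\<Sum>I | card I = k. fac I s * pm I s)" for s
    using equation_on_line[OF x0 b, of o1 s] by (simp add: fac_def pm_def y_def)
  have fac': "(fac I has_real_derivative fac1 I s) (at s)" "(fac1 I has_real_derivative (if o1 \<in> I then 2 else 0)) (at s)" for I s
    unfolding fac_def[abs_def] fac1_def[abs_def] by (auto intro!: derivative_eq_intros)
  let ?R1 = "\<lambda>s. \<Sum>I | card I = k. fac1 I s * pm I s + D I s * fac I s"
  have R1: "((\<lambda>s. R (y s)) has_real_derivative ?R1 s) (at s)" for s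
    unfolding Req by (intro DERIV_sum DERIV_mult fac' D)
  have R2: "(?R1 has_real_derivative (\<Sum>I | card I = k. ((if o1 \<in> I then 2 else 0) * pm I 0 + D I 0 * fac1 I 0) + (nd.S I * fac I 0 + fac1 I 0 * D I 0))) (at 0)"
    by (intro DERIV_sum DERIV_add DERIV_mult fac' D)
  have fac0: "fac I 0 = 1" "fac1 I 0 = 0" for I by (simp_all add: fac_def fac1_def)
  have R0: "R x0 = nd.R0" using Req[of 0] by (simp add: yy fac0 pm0 nd.R0_def)
  have R10: "?R1 0 = nd.R1" by (simp add: fac0 D(2) nd.R1_def)
  let ?a1 = "\<lambda>s. dd ?v F.G (y s)" and ?b1 = "\<lambda>s. dd ?v H.G (y s)"
  \<comment> \<open>The squared gradient is expanded in the constant orthonormal basis of the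
    \<open>b i\<close> together with \<open>x0\<close>, which does not move along the line.\<close>
  define d1 where "d1 s = (\<Sum>i\<in>UNIV. 2 * dd (b i) H.G (y s) * dd ?v (dd (b i) H.G) (y s)) +
     2 * dd x0 H.G (y s) * dd ?v (dd x0 H.G) (y s)" for s
  define d2 where "d2 = (\<Sum>i\<in>UNIV. 2 * (dd ?v (dd (b i) H.G) x0)\<^sup>2 + 2 * dd (b i) H.G x0 * dd ?v (dd ?v (dd (b i) H.G)) x0) +
     (2 * (dd ?v (dd x0 H.G) x0)\<^sup>2 + 2 * dd x0 H.G x0 * dd ?v (dd ?v (dd x0 H.G)) x0)"
  have dsum: "(norm (grad H.G (y s)))\<^sup>2 = (\<Sum>i\<in>UNIV. (dd (b i) H.G (y s))\<^sup>2) + (dd x0 H.G (y s))\<^sup>2" for s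
    using orthonormal_frame_parseval[OF b x0 dim, of "grad H.G (y s)"] by (simp add: H.grad_inner_G[OF y0])
  have d1: "((\<lambda>s. (norm (grad H.G (y s)))\<^sup>2) has_real_derivative d1 s) (at s)" for s
    unfolding dsum d1_def
    by (auto intro!: derivative_eq_intros line H.Ck1 simp: mult_ac)
  have d2: "(d1 has_real_derivative d2) (at 0)"
    unfolding d1_def[abs_def] d2_def
    by (rule DERIV_cong, (rule derivative_intros line H.Ck1 H.Ck2)+)
       (simp add: yy power2_eq_square sum_distrib_left algebra_simps)
  have Mv: "dd ?v (dd (b i) H.G) x0 = (if i = o1 then mu else 0)" for i
    using diag[of o1 i] eq by (auto simp: mu_def)
  have hx: "H.G x0 = h x0" "F.G x0 = phi x0" using x0 by (simp_all add: hom_ext_sphere)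
  have rad: "dd ?v (dd x0 H.G) x0 = 0" "dd x0 H.G x0 = h x0"
    using H.radial_kernel(2)[OF x00] H.euler[OF x00] hx by simp_all
  \<comment> \<open>A radial third argument can be commuted to the outside, where Euler's relation
    in degree -1 gives minus the second derivative.\<close>
  have rad2: "dd ?v (dd ?v (dd x0 H.G)) x0 = - mu"
    using H.commute3'[OF x00, of ?v ?v x0] H.commute3[OF x00, of ?v x0 ?v] H.euler2[OF x00, of ?v ?v] Mv[of o1] by simp
  have "dd ?v (dd ?v (dd (b i) H.G)) x0 = m * (b i \<bullet> z)" for i
    using H.commute3'[OF x00, of ?v ?v "b i"] H.commute3[OF x00, of ?v "b i" ?v] eta1[of i] by simp
  then have d2': "d2 = 2 * mu\<^sup>2 + 2 * m * (\<Sum>i\<in>UNIV. dd (b i) H.G x0 * (b i \<bullet> z)) - 2 * h x0 * mu"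
    unfolding d2_def Mv rad rad2
    by (simp add: sum.distrib sum_distrib_left if_distrib[of "\<lambda>x. x\<^sup>2"] if_distrib[of "\<lambda>x. 2 * x"] mult_ac cong: if_cong)
  have d1': "d1 0 = 2 * mu * dd ?v H.G x0"
    unfolding d1_def yy Mv rad by (simp add: if_distrib cong: if_cong)
  let ?d = "\<lambda>s. (norm (grad H.G (y s)))\<^sup>2"
  let ?r = "\<lambda>s. F.G (y s) powr (- (k + P)) * H.G (y s) powr P * ?d s powr c"
  have "\<exists>R1 R2. (\<forall>s\<in>UNIV. (?r has_real_derivative R1 s) (at s)) \<and> (R1 has_real_derivative R2) (at 0) \<and>
    R2 - (1 + 1 / k) * ((R1 0)\<^sup>2 / ?r 0) \<le> ?r 0 *
      (P * mu / H.G (y 0) + c * (d2 / ?d 0 - (d1 0 / ?d 0)\<^sup>2)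
      + 2 / k * ((k + P) * (?a1 0 / F.G (y 0)) - P * (?b1 0 / H.G (y 0))) * (c * d1 0 / ?d 0))"
  proof (rule power_product_second_derivative[OF k P UNIV_I, where a = "\<lambda>s. F.G (y s)" and b = "\<lambda>s. H.G (y s)" and d = ?d])
    show "(?a1 has_real_derivative dd ?v (dd ?v F.G) x0) (at 0)" using line[OF F.Ck1, of ?v 0] by (simp add: yy)
    show "(?b1 has_real_derivative mu) (at 0)" using line[OF H.Ck1, of ?v 0] Mv[of o1] by (simp add: yy)
    show "0 \<le> dd ?v (dd ?v F.G) x0" by (rule phi_convex[OF x0 on(2)])
  qed (use pos y0 d1 d2 line[OF F.Ck] line[OF H.Ck] in auto)
  then obtain r1 r2 where r: "\<And>s. ((\<lambda>s. R (y s)) has_real_derivative r1 s) (at s)" "(r1 has_real_derivative r2) (at 0)"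
    "r2 - (1 + 1 / k) * ((r1 0)\<^sup>2 / R x0) \<le> R x0 *
      (P * mu / h x0 + c * (d2 / d - (d1 0 / d)\<^sup>2)
      + 2 / k * ((k + P) * (dd ?v F.G x0 / phi x0) - P * (dd ?v H.G x0 / h x0)) * (c * d1 0 / d))"
    unfolding R_def[symmetric] unfolding yy d_def[symmetric] hx by blast
  have r1: "r1 = ?R1" using DERIV_unique[OF r(1) R1] by blast
  have "r2 = (\<Sum>I | card I = k. ((if o1 \<in> I then 2 else 0) * pm I 0 + D I 0 * fac1 I 0) + (nd.S I * fac I 0 + fac1 I 0 * D I 0))"
    using DERIV_unique[OF r(2)[unfolded r1] R2] .
  also have "\<dots> = (\<Sum>I | card I = k. (if o1 \<in> I then 2 else 0) * prod ?l I + nd.S I)"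
    by (simp add: fac0 pm0)
  \<comment> \<open>The factors \<open>1 + s\<^sup>2\<close> leave behind only the nonnegative terms
    \<open>2 * prod l I\<close>, which are dropped.\<close>
  also have "\<dots> \<ge> (\<Sum>I | card I = k. nd.S I)"
    by (intro sum_mono) (auto intro!: prod_nonneg)
  finally have r2: "(\<Sum>I | card I = k. nd.S I) \<le> r2" .
  have lB: "?l i \<le> B" for i using B(2)[of i] by linarith
  have "0 < R x0" using pos[OF x00] by (simp add: R_def)
  then have "(\<Sum>i\<in>UNIV. nd.Fd i * ?ph i) + (1 + 1 / k) * (nd.R1\<^sup>2 / nd.R0)
    - 8 * real CARD('n) * 4 ^ CARD('n) * B ^ (2 * CARD('n) + 3) * \<bar>?eta o1 o1\<bar> \<le> (\<Sum>I | card I = k. nd.S I)"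
    using B(4) unfolding R0 by (intro nd.second_order_lower_bound lB B(1,3))
  moreover have "(r1 0)\<^sup>2 / R x0 = nd.R1\<^sup>2 / nd.R0" unfolding r1 R10 R0 ..
  note r(3)[unfolded this]
  ultimately have "(\<Sum>i\<in>UNIV. nd.Fd i * ?ph i)
    - 8 * real CARD('n) * 4 ^ CARD('n) * B ^ (2 * CARD('n) + 3) * \<bar>?eta o1 o1\<bar> \<le> R x0 *
      (P * mu / h x0 + c * (d2 / d - (d1 0 / d)\<^sup>2)
      + 2 / k * ((k + P) * (dd ?v F.G x0 / phi x0) - P * (dd ?v H.G x0 / h x0)) * (c * d1 0 / d))"
    using r2 by linarith
  then show ?estimate
    unfolding d2' d1' eta1 Fd_def m_def mu_def by simp
  show "0 \<le> Fd i" unfolding Fd_def by (rule nd.Fd_nonneg)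
  show "Fd i \<le> 2 ^ CARD('n) * B ^ CARD('n)" unfolding Fd_def by (rule nd.Fd_le[OF lB B(1)])
  show "R x0 \<le> 2 ^ CARD('n) * B * Fd i" unfolding Fd_def R0 by (rule nd.R0_le_Fd[OF lB B(1)])
qed

end

subsection \<open>Uniform bounds\<close>

context homogeneous_extension
begin

lemma quadratic_expand:
  assumes "x \<noteq> 0"
  shows "dd u (dd u G) x = (\<Sum>b\<in>Basis. \<Sum>b'\<in>Basis. (u \<bullet> b) * (u \<bullet> b') * dd b (dd b' G) x)"
  using bilinear_expand[OF bilinear[OF assms], of "\<lambda>b. u \<bullet> b" "\<lambda>b. b" Basis "\<lambda>b. u \<bullet> b" "\<lambda>b. b" Basis]
  by (simp add: euclidean_representation)

lemma continuous_on_quadratic: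
  assumes "K \<subseteq> {p. norm (fst p) = 1}"
  shows "continuous_on K (\<lambda>p. dd (snd p) (dd (snd p) G) (fst p))"
proof -
  have "continuous_on K (\<lambda>p. \<Sum>b\<in>Basis. \<Sum>b'\<in>Basis. (snd p \<bullet> b) * (snd p \<bullet> b') * dd b (dd b' G) (fst p))"
  proof (intro continuous_intros)
    fix b b' :: 'a
    show "continuous_on K (\<lambda>p. dd b (dd b' G) (fst p))"
      by (rule continuous_on_compose2[of "- {0}" "dd b (dd b' G)"])
         (use Ck2[of 0 b b'] assms in \<open>auto intro!: continuous_intros\<close>)
  qed
  then show ?thesis
  proof (rule continuous_on_eq)
    fix p assume "p \<in> K"
    then have "fst p \<noteq> 0" using assms by auto
    from quadratic_expand[OF this, of "snd p"]
    show "(\<Sum>b\<in>Basis. \<Sum>b'\<in>Basis. (snd p \<bullet> b) * (snd p \<bullet> b') * dd b (dd b' G) (fst p)) =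
        dd (snd p) (dd (snd p) G) (fst p)" ..
  qed
qed

lemma quadratic_scale: "x \<noteq> 0 \<Longrightarrow> dd (a *\<^sub>R u) (dd (a *\<^sub>R u) G) x = a\<^sup>2 * dd u (dd u G) x"
  by (simp add: linear_scale[OF linear2(1)] linear_scale[OF linear2(2)] power2_eq_square)

text \<open>At a minimum of \<open>g\<close> on the sphere its extension touches a multiple of the norm from above.\<close>

lemma quadratic_ge_at_minimum:
  assumes x: "norm x = 1" and min: "\<And>y. norm y = 1 \<Longrightarrow> g x \<le> g y" and u: "norm u = 1" "u \<bullet> x = 0"
  shows "g x \<le> dd u (dd u G) x"
proof -
  define y where "y t = x + t *\<^sub>R u" for t
  have in0: "x \<bullet> x = 1" "u \<bullet> u = 1" "x \<bullet> u = 0" using x u by (simp_all add: norm_eq_1 inner_commute)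
  have yy: "y t \<bullet> y t = 1 + t\<^sup>2" for t
    using u(2) by (simp add: y_def inner_add_left inner_add_right in0 power2_eq_square)
  have p: "0 < 1 + t\<^sup>2" for t :: real by (simp add: add_pos_nonneg)
  have y0: "y t \<noteq> 0" for t using yy[of t] p[of t] by auto
  let ?r = "\<lambda>t. (1 + t\<^sup>2) powr (1/2)"
  have nr: "norm (y t) = ?r t" for t by (simp add: norm_conv_powr yy)
  have der: "((\<lambda>t. (1 + t\<^sup>2) powr a) has_real_derivative 2 * a * t * (1 + t\<^sup>2) powr (a - 1)) (at t)" for a t :: real
  proof -
    have "((\<lambda>t. 1 + t\<^sup>2) has_real_derivative 2 * t) (at t)" by (auto intro!: derivative_eq_intros)
    from DERIV_fun_powr[OF this p, of a] show ?thesis by (simp add: mult_ac)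
  qed
  have g: "((\<lambda>t. G (y t) - g x * ?r t) has_real_derivative dd u G (y t) - g x * (t * (1 + t\<^sup>2) powr (- 1/2))) (at t)" for t
  proof -
    have "((\<lambda>t. G (y t)) has_real_derivative dd u G (y t)) (at t)"
      unfolding y_def by (rule dd_line[OF open_punctured Ck]) (use y0 in \<open>simp add: y_def\<close>)
    then show ?thesis using der[of "1/2" t] by (intro DERIV_diff DERIV_cmult) auto
  qed
  have "((\<lambda>t. dd u G (y t)) has_real_derivative dd u (dd u G) (y 0)) (at 0)"
    unfolding y_def by (rule dd_line[OF open_punctured Ck1]) (use y0[of 0] in \<open>simp add: y_def\<close>)
  moreover have "((\<lambda>t. t * (1 + t\<^sup>2) powr (- 1/2)) has_real_derivative 1) (at 0)"
    by (rule DERIV_cong[OF DERIV_mult[OF DERIV_ident der]]) simp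
  ultimately have g1: "((\<lambda>t. dd u G (y t) - g x * (t * (1 + t\<^sup>2) powr (- 1/2))) has_real_derivative dd u (dd u G) (y 0) - g x * 1) (at 0)"
    by (intro DERIV_diff DERIV_cmult)
  have "G (y t) - g x * ?r t \<ge> 0" for t
  proof -
    have "g x \<le> g (y t /\<^sub>R norm (y t))" by (rule min) (use y0 in simp)
    then have "norm (y t) * g x \<le> norm (y t) * g (y t /\<^sub>R norm (y t))" by (rule mult_left_mono) simp
    then show ?thesis by (simp add: hom_ext_def nr mult.commute)
  qed
  moreover have "G (y 0) - g x * ?r 0 = 0" using x by (simp add: y_def hom_ext_sphere)
  ultimately have "G (y 0) - g x * ?r 0 \<le> G (y t) - g x * ?r t" for t by simp
  from second_derivative_min(2)[OF open_UNIV UNIV_I g g1 this] show ?thesis by (simp add: y_def)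
qed

end

context curvature_problem
begin

text \<open>Compactness gives one constant that depends on neither the barrier nor the touching
  point.\<close>

lemma uniform_bounds:
  "\<exists>B\<ge>1. (\<forall>x u v w. norm x = 1 \<longrightarrow> norm u = 1 \<longrightarrow> norm v = 1 \<longrightarrow> norm w = 1 \<longrightarrow>
      \<bar>dd u H.G x\<bar> \<le> B \<and> \<bar>dd u (dd v H.G) x\<bar> \<le> B \<and> \<bar>dd u (dd v (dd w H.G)) x\<bar> \<le> B \<and> \<bar>dd u F.G x\<bar> \<le> B) \<and>
    (\<forall>x. norm x = 1 \<longrightarrow> 1 / B \<le> h x \<and> h x \<le> B \<and> 1 / B \<le> phi x \<and> 1 / B \<le> (norm (grad H.G x))\<^sup>2 \<and> 1 / B \<le> R x \<and> R x \<le> B)"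
proof -
  have cH: "continuous_on (sphere 0 1) H.G" and cF: "continuous_on (sphere 0 1) F.G"
    using H.Ck[of 0] F.Ck[of 0] by (auto intro: continuous_on_subset)
  have c1: "continuous_on (sphere 0 1) (dd b H.G)" for b
    by (rule continuous_on_subset[of "- {0}"]) (use H.Ck1[of 0 b] in auto)
  have cd: "continuous_on (sphere 0 1) (\<lambda>x. (norm (grad H.G x))\<^sup>2)"
    unfolding grad_norm by (intro continuous_on_sum continuous_on_power c1)
  have p: "0 < H.G x" "0 < F.G x" "0 < (norm (grad H.G x))\<^sup>2" "0 < R x" if "norm x = 1" for x
  proof -
    from that have "x \<noteq> 0" by auto
    then have q: "0 < F.G x" "0 < H.G x" "0 < (norm (grad H.G x))\<^sup>2"
      by (fact pos)+
    show "0 < H.G x" "0 < F.G x" "0 < (norm (grad H.G x))\<^sup>2" by (fact q)+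
    show "0 < R x" unfolding R_def using q by (intro mult_pos_pos) simp_all
  qed
  have ne: "F.G x \<noteq> 0" "H.G x \<noteq> 0" "(norm (grad H.G x))\<^sup>2 \<noteq> 0" if "x \<in> sphere 0 1" for x
  proof -
    from that have n: "norm x = 1" by simp
    show "F.G x \<noteq> 0" "H.G x \<noteq> 0" "(norm (grad H.G x))\<^sup>2 \<noteq> 0"
      using p(1)[OF n] p(2)[OF n] p(3)[OF n] by simp_all
  qed
  have cR: "continuous_on (sphere 0 1) R"
    unfolding R_def[abs_def]
    by (intro continuous_on_mult continuous_on_powr continuous_on_const cH cF cd ballI ne)
  obtain B1 where B1: "1 \<le> B1" "\<And>x. norm x = 1 \<Longrightarrow> 1 / B1 \<le> H.G x \<and> H.G x \<le> B1"
    using sphere_positive_bounds[OF cH p(1)] by auto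
  obtain B2 where B2: "1 \<le> B2" "\<And>x. norm x = 1 \<Longrightarrow> 1 / B2 \<le> F.G x \<and> F.G x \<le> B2"
    using sphere_positive_bounds[OF cF p(2)] by auto
  obtain B3 where B3: "1 \<le> B3" "\<And>x. norm x = 1 \<Longrightarrow> 1 / B3 \<le> (norm (grad H.G x))\<^sup>2 \<and> (norm (grad H.G x))\<^sup>2 \<le> B3"
    using sphere_positive_bounds[OF cd p(3)] by auto
  obtain B4 where B4: "1 \<le> B4" "\<And>x. norm x = 1 \<Longrightarrow> 1 / B4 \<le> R x \<and> R x \<le> B4"
    using sphere_positive_bounds[OF cR p(4)] by auto
  obtain B5 where B5: "\<And>x u v w. \<lbrakk>norm x = 1; norm u = 1; norm v = 1; norm w = 1\<rbrakk> \<Longrightarrow>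
     \<bar>dd u H.G x\<bar> \<le> B5 \<and> \<bar>dd u (dd v H.G) x\<bar> \<le> B5 \<and> \<bar>dd u (dd v (dd w H.G)) x\<bar> \<le> B5"
    using H.derivatives_bounded by metis
  obtain B6 where B6: "\<And>x u v w. \<lbrakk>norm x = 1; norm u = 1; norm v = 1; norm w = 1\<rbrakk> \<Longrightarrow>
     \<bar>dd u F.G x\<bar> \<le> B6 \<and> \<bar>dd u (dd v F.G) x\<bar> \<le> B6 \<and> \<bar>dd u (dd v (dd w F.G)) x\<bar> \<le> B6"
    using F.derivatives_bounded by metis
  define B where "B = max B1 (max B2 (max B3 (max B4 (max B5 B6))))"
  have B: "B1 \<le> B" "B2 \<le> B" "B3 \<le> B" "B4 \<le> B" "B5 \<le> B" "B6 \<le> B" by (auto simp: B_def)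
  have inv: "1 / B \<le> 1 / A" if "1 \<le> A" "A \<le> B" for A
    using that by (intro divide_left_mono mult_pos_pos) auto
  show ?thesis
  proof (intro exI[of _ B] conjI allI impI)
    show "1 \<le> B" using B1 B by linarith
  next
    fix x u v w :: 'a assume n: "norm x = 1" "norm u = 1" "norm v = 1" "norm w = 1"
    from B5[OF n] B6[OF n] B
    show "\<bar>dd u H.G x\<bar> \<le> B" "\<bar>dd u (dd v H.G) x\<bar> \<le> B" "\<bar>dd u (dd v (dd w H.G)) x\<bar> \<le> B" "\<bar>dd u F.G x\<bar> \<le> B"
      by linarith+
  next
    fix x :: 'a assume n: "norm x = 1"
    note G = hom_ext_sphere[OF n, of h] hom_ext_sphere[OF n, of phi]
    show "1 / B \<le> h x" "h x \<le> B" "1 / B \<le> phi x" "1 / B \<le> (norm (grad H.G x))\<^sup>2" "1 / B \<le> R x" "R x \<le> B"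
      using B1(2)[OF n] B2(2)[OF n] B3(2)[OF n] B4(2)[OF n] B inv[OF B1(1) B(1)] inv[OF B2(1) B(2)]
        inv[OF B3(1) B(3)] inv[OF B4(1) B(4)] unfolding G by linarith+
  qed
qed

text \<open>Quantifying over all such data is what makes the constant of
  \<open>touching_parameter_bound\<close> independent of the barrier. \<open>E\<close> is the size
  of the exponential part of the barrier at the touching point; \<open>psi\<close> also contains an
  additive constant, so its value is only bounded by \<open>E\<close>.\<close>

definition touching where
  "touching psi psi1 psi2 z x0 (b :: 'n \<Rightarrow> 'a) o1 al E \<longleftrightarrow>
    (\<forall>s. (psi has_real_derivative psi1 s) (at s) \<and> (psi1 has_real_derivative psi2 s) (at s)) \<and>
    (\<forall>x u. norm x = 1 \<longrightarrow> u \<bullet> x = 0 \<longrightarrow> psi (x \<bullet> z) * (norm u)\<^sup>2 \<le> dd u (dd u H.G) x) \<and>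
    norm x0 = 1 \<and> norm z = 1 \<and> orthonormal_frame_at x0 b \<and> (\<forall>i j. i \<noteq> j \<longrightarrow> dd (b i) (dd (b j) H.G) x0 = 0) \<and>
    dd (b o1) (dd (b o1) H.G) x0 = psi (x0 \<bullet> z) \<and> 0 \<le> psi (x0 \<bullet> z) \<and> psi (x0 \<bullet> z) \<le> E \<and>
    psi1 (x0 \<bullet> z) = al * E \<and> psi2 (x0 \<bullet> z) = al\<^sup>2 * E \<and> 1 \<le> al \<and> 0 < E \<and> E \<le> 1"

text \<open>The barrier is an exponential, so that at the touching point its value, its first and its second
  derivative are of the orders \<open>E\<close>, \<open>\<alpha> E\<close> and \<open>\<alpha>\<^sup>2 E\<close>; the second derivative has to be absorbed by the others.\<close>

lemma touching_parameter_bound: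
  "\<exists>C. \<forall>psi psi1 psi2 z x0 b o1 al E. touching psi psi1 psi2 z x0 b o1 al E \<longrightarrow> al * (1 - (x0 \<bullet> z)\<^sup>2) \<le> C"
proof -
  obtain B where B1: "1 \<le> B"
    and BH: "\<And>x u v w. \<lbrakk>norm x = 1; norm u = 1; norm v = 1; norm w = 1\<rbrakk> \<Longrightarrow>
      \<bar>dd u H.G x\<bar> \<le> B \<and> \<bar>dd u (dd v H.G) x\<bar> \<le> B \<and> \<bar>dd u (dd v (dd w H.G)) x\<bar> \<le> B \<and> \<bar>dd u F.G x\<bar> \<le> B"
    and Bx: "\<And>x. norm x = 1 \<Longrightarrow> 1 / B \<le> h x \<and> h x \<le> B \<and> 1 / B \<le> phi x \<and> 1 / B \<le> (norm (grad H.G x))\<^sup>2 \<and> 1 / B \<le> R x \<and> R x \<le> B"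
    using uniform_bounds by metis
  let ?N = "real CARD('n)"
  \<comment> \<open>\<open>Fmax\<close> and \<open>Fmin\<close> enclose the coefficients of the
    linearised operator; \<open>Fmin\<close> results from \<open>1 / B \<le> R x0\<close> and
    \<open>R x0 \<le> 2 ^ CARD('n) * B * Fd i\<close>.\<close>
  define Fmax where "Fmax = (2::real) ^ CARD('n) * B ^ CARD('n)"
  define Fmin where "Fmin = 1 / (2 ^ CARD('n) * B * B)"
  define M0 where "M0 = 8 * ?N * 4 ^ CARD('n) * B ^ (2 * CARD('n) + 3)"
  \<comment> \<open>\<open>C1\<close> bounds the bracket of \<open>touching_estimate\<close> divided
    by \<open>al * E\<close>. Its three summands belong to the term with \<open>P * mu / h\<close>,
    to the derivatives of the squared gradient, and to the mixed term.\<close>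
  let ?C2 = "(2 + 2 * (?N * B) + 2 * B) * B + 4 * (B * B) * (B * B)" and ?C3 = "(k + P) * (B * B) + P * (B * B)"
  define C1 where "C1 = P * B + \<bar>c\<bar> * ?C2
    + 2 * (?C3 * (\<bar>c\<bar> * (2 * B * B)))"
  have Fmin: "0 < Fmin" using B1 by (simp add: Fmin_def)
  have M0: "0 \<le> M0" using B1 by (simp add: M0_def)
  have main: "al * (1 - (x0 \<bullet> z)\<^sup>2) \<le> (4 * ?N * Fmax + M0 + B * C1) / Fmin"
    if t: "touching psi psi1 psi2 z x0 b o1 al E" for psi psi1 psi2 z x0 b o1 al E
  proof -
    from t have psi: "\<And>s. (psi has_real_derivative psi1 s) (at s)" "\<And>s. (psi1 has_real_derivative psi2 s) (at s)"
      and x0: "norm x0 = 1" and z: "norm z = 1" and b: "orthonormal_frame_at x0 b"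
      and mu: "0 \<le> psi (x0 \<bullet> z)" "psi (x0 \<bullet> z) \<le> E" and p1: "psi1 (x0 \<bullet> z) = al * E"
      and p2: "psi2 (x0 \<bullet> z) = al\<^sup>2 * E" and al: "1 \<le> al" and E: "0 < E" "E \<le> 1"
      unfolding touching_def by auto
    note nb = orthonormal_frame_atD(4)[OF b]
    define mu' where "mu' = psi (x0 \<bullet> z)"
    define tau where "tau = x0 \<bullet> z"
    define w where "w = dd (b o1) H.G x0"
    define d where "d = (norm (grad H.G x0))\<^sup>2"
    define S where "S = (\<Sum>i\<in>UNIV. dd (b i) H.G x0 * (b i \<bullet> z))"
    define a where "a = dd (b o1) F.G x0"
    let ?A = "2 * mu'\<^sup>2 + 2 * (al * E) * S - 2 * h x0 * mu'"
    let ?D = "?A / d - (2 * mu' * w / d)\<^sup>2" and ?Q = "(k + P) * (a / phi x0) - P * (w / h x0)"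
    let ?Y = "P * mu' / h x0 + c * ?D + 2 / k * ?Q * (c * (2 * mu' * w) / d)"
    define Fd where "Fd = null_direction.Fd (\<lambda>i. dd (b i) (dd (b i) H.G) x0) k"
    let ?L = "\<Sum>i\<in>UNIV. Fd i * (al\<^sup>2 * E * (b i \<bullet> z)\<^sup>2 - al * E * tau - 3 * mu')"
    have te: "?L - M0 * \<bar>al * E * (b o1 \<bullet> z)\<bar>
      \<le> R x0 * ?Y"
      and Fd: "\<And>i. 0 \<le> Fd i" "\<And>i. Fd i \<le> Fmax" "\<And>i. R x0 \<le> 2 ^ CARD('n) * B * Fd i"
      using touching_estimate[OF psi, of z x0 b o1 B] t B1 BH[OF x0 nb nb nb] Bx[OF x0]
      unfolding touching_def Fd_def p1 p2 mu'_def tau_def w_def d_def S_def a_def M0_def Fmax_def by auto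
    have be: "\<bar>b i \<bullet> z\<bar> \<le> 1" for i using Cauchy_Schwarz_ineq2[of "b i" z] nb z by simp
    have tau: "\<bar>tau\<bar> \<le> 1" unfolding tau_def using Cauchy_Schwarz_ineq2[of x0 z] x0 z by simp
    have aE: "0 < al * E" "E \<le> al * E" using al E by auto
    have mu0: "0 \<le> mu'" "mu' \<le> E" using mu by (auto simp: mu'_def)
    have dpos: "1 / B \<le> d" "1 / B \<le> h x0" "1 / B \<le> phi x0" "h x0 \<le> B" using Bx[OF x0] by (auto simp: d_def)
    have Bp: "0 < B" "0 < 1 / B" using B1 by auto
    have pos: "0 < d" "0 < h x0" "0 < phi x0" using dpos Bp by linarith+
    have div: "\<bar>v / q\<bar> \<le> V * B" if "\<bar>v\<bar> \<le> V" "1 / B \<le> q" for v q V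
    proof -
      have "0 < q" using that(2) Bp by linarith
      have "1 / q \<le> B" using that(2) \<open>0 < q\<close> Bp by (simp add: field_simps)
      then have "\<bar>v\<bar> * (1 / q) \<le> V * B" by (rule mult_mono[OF that(1)]) (use that \<open>0 < q\<close> in auto)
      then show ?thesis using \<open>0 < q\<close> by simp
    qed
    have wB: "\<bar>w\<bar> \<le> B" "\<bar>a\<bar> \<le> B" using BH[OF x0 nb nb nb, of o1] by (auto simp: w_def a_def)
    have SB: "\<bar>S\<bar> \<le> ?N * B"
    proof -
      have "\<bar>S\<bar> \<le> (\<Sum>i\<in>UNIV. \<bar>dd (b i) H.G x0 * (b i \<bullet> z)\<bar>)" unfolding S_def by (rule sum_abs)
      also have "\<dots> \<le> (\<Sum>i\<in>(UNIV::'n set). B * 1)"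
        unfolding abs_mult by (intro sum_mono mult_mono be) (use BH[OF x0 nb nb nb] Bp in auto)
      finally show ?thesis by simp
    qed
    have lhs: "al\<^sup>2 * E * Fmin * (1 - tau\<^sup>2) - 4 * (al * E) * (?N * Fmax) \<le>
        ?L"
    proof -
      have Fge: "Fmin \<le> Fd i" for i
      proof -
        have "1 / B \<le> 2 ^ CARD('n) * B * Fd i" using Fd(3)[of i] Bx[OF x0] by linarith
        then show ?thesis using Bp by (simp add: Fmin_def field_simps)
      qed
      have "al\<^sup>2 * E * Fmin * (b i \<bullet> z)\<^sup>2 - 4 * (al * E) * Fmax \<le>
          Fd i * (al\<^sup>2 * E * (b i \<bullet> z)\<^sup>2 - al * E * tau - 3 * mu')" for i
      proof -
        have "Fmin * (al\<^sup>2 * E * (b i \<bullet> z)\<^sup>2) \<le> Fd i * (al\<^sup>2 * E * (b i \<bullet> z)\<^sup>2)"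
          by (rule mult_right_mono[OF Fge]) (use E in simp)
        moreover have "Fd i * (al * E * tau + 3 * mu') \<le> Fmax * (4 * (al * E))"
        proof -
          have "al * E * tau \<le> al * E * 1" using tau aE(1) by (intro mult_left_mono) auto
          then have "al * E * tau + 3 * mu' \<le> 4 * (al * E)" using mu0(2) aE(2) by linarith
          then have "Fd i * (al * E * tau + 3 * mu') \<le> Fd i * (4 * (al * E))" by (rule mult_left_mono) (rule Fd(1))
          also have "\<dots> \<le> Fmax * (4 * (al * E))" by (rule mult_right_mono[OF Fd(2)]) (use aE in simp)
          finally show ?thesis .
        qed
        ultimately show ?thesis by (simp add: algebra_simps)
      qed
      then have "(\<Sum>i\<in>(UNIV::'n set). al\<^sup>2 * E * Fmin * (b i \<bullet> z)\<^sup>2 - 4 * (al * E) * Fmax) \<le>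
          ?L" by (rule sum_mono)
      \<comment> \<open>The tangential part of \<open>z\<close> has squared length
        \<open>1 - tau\<^sup>2\<close>; with ellipticity this turns the second derivative of the
        barrier into the term of order \<open>al\<^sup>2 * E\<close>.\<close>
      moreover have "(\<Sum>i\<in>UNIV. (b i \<bullet> z)\<^sup>2) = 1 - tau\<^sup>2"
        using orthonormal_frame_parseval[OF b x0 dim, of z] z by (simp add: tau_def inner_commute)
      ultimately show ?thesis
        by (simp add: sum_subtractf sum_distrib_left[symmetric] mult_ac)
    qed
    have rhs: "?Y \<le> (al * E) * C1"
    proof -
      \<comment> \<open>Here \<open>E \<le> 1\<close> makes a term quadratic in the barrier as small
        as a linear one.\<close>
      have mm: "mu' * mu' \<le> al * E"
      proof -
        have "mu' * mu' \<le> E * 1" using mu0 E by (intro mult_mono) auto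
        then show ?thesis using aE by simp
      qed
      have t1: "P * mu' / h x0 \<le> (al * E) * (P * B)"
      proof -
        have "\<bar>mu' / h x0\<bar> \<le> (al * E) * B" by (rule div) (use mu0 aE dpos in auto)
        then have "P * (mu' / h x0) \<le> P * ((al * E) * B)" by (intro mult_left_mono P) (rule abs_le_D1)
        then show ?thesis by (simp add: mult_ac)
      qed
      have muw: "\<bar>mu' * w\<bar> \<le> (al * E) * B"
        unfolding abs_mult by (rule mult_mono) (use mu0 aE wB in auto)
      have t2: "c * ?D
        \<le> (al * E) * (\<bar>c\<bar> * ?C2)"
      proof -
        have n1: "\<bar>?A\<bar> \<le> (al * E) * (2 + 2 * (?N * B) + 2 * B)"
        proof -
          have "\<bar>(al * E) * S\<bar> \<le> (al * E) * (?N * B)"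
            unfolding abs_mult[of "al * E"] using SB aE by (intro mult_mono) auto
          moreover have "\<bar>h x0 * mu'\<bar> \<le> B * (al * E)"
            unfolding abs_mult by (rule mult_mono) (use mu0 aE dpos pos in auto)
          moreover have "0 \<le> mu' * mu'" by simp
          moreover have "(al * E) * (2 + 2 * (?N * B) + 2 * B) = 2 * (al * E) + 2 * ((al * E) * (?N * B)) + 2 * (B * (al * E))"
            by (simp add: algebra_simps)
          moreover have "?A = 2 * (mu' * mu') + 2 * ((al * E) * S) - 2 * (h x0 * mu')"
            by (simp add: power2_eq_square)
          ultimately show ?thesis using mm by linarith
        qed
        have "\<bar>?A / d\<bar> \<le> (al * E) * (2 + 2 * (?N * B) + 2 * B) * B"
          by (rule div[OF n1 dpos(1)])
        moreover have "(2 * mu' * w / d)\<^sup>2 \<le> (al * E) * (4 * (B * B) * (B * B))"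
        proof -
          have "\<bar>w / d\<bar> \<le> B * B" by (rule div[OF wB(1) dpos(1)])
          then have "(w / d)\<^sup>2 \<le> (B * B)\<^sup>2" by (metis abs_ge_zero power2_abs power_mono)
          then have "(4 * (mu' * mu')) * (w / d)\<^sup>2 \<le> (4 * (al * E)) * (B * B)\<^sup>2"
            by (rule mult_mono[rotated]) (use mm aE in auto)
          then show ?thesis by (simp add: power2_eq_square mult_ac)
        qed
        moreover have "0 \<le> (2 * mu' * w / d)\<^sup>2" by simp
        ultimately have "\<bar>?D\<bar>
          \<le> (al * E) * (2 + 2 * (?N * B) + 2 * B) * B + (al * E) * (4 * (B * B) * (B * B))" by linarith
        then have "\<bar>c\<bar> * \<bar>?D\<bar>
          \<le> \<bar>c\<bar> * ((al * E) * (2 + 2 * (?N * B) + 2 * B) * B + (al * E) * (4 * (B * B) * (B * B)))"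
          by (rule mult_left_mono) simp
        then have "\<bar>c * ?D\<bar>
          \<le> (al * E) * (\<bar>c\<bar> * ?C2)"
          unfolding abs_mult[of c] by (simp add: algebra_simps)
        then show ?thesis by linarith
      qed
      have t3: "2 / k * ?Q * (c * (2 * mu' * w) / d)
        \<le> (al * E) * (2 * (?C3 * (\<bar>c\<bar> * (2 * B * B))))"
      proof -
        have "\<bar>a / phi x0\<bar> \<le> B * B" "\<bar>w / h x0\<bar> \<le> B * B" using div wB dpos by blast+
        then have "\<bar>(k + P) * (a / phi x0)\<bar> \<le> (k + P) * (B * B)" "\<bar>P * (w / h x0)\<bar> \<le> P * (B * B)"
          unfolding abs_mult[of "k + P"] abs_mult[of P] using P by (auto simp del: abs_divide intro!: mult_left_mono)
        then have q: "\<bar>?Q\<bar> \<le> ?C3" by linarith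
        have "\<bar>(mu' * w) / d\<bar> \<le> (al * E) * B * B" by (rule div[OF muw dpos(1)])
        then have "2 * \<bar>c\<bar> * \<bar>(mu' * w) / d\<bar> \<le> 2 * \<bar>c\<bar> * ((al * E) * B * B)" by (rule mult_left_mono) simp
        then have r: "\<bar>c * (2 * mu' * w) / d\<bar> \<le> (al * E) * (\<bar>c\<bar> * (2 * B * B))"
          by (simp add: abs_mult mult_ac)
        have k2: "\<bar>2 / real k\<bar> \<le> 2" using k by (simp add: field_simps)
        have "\<bar>2 / k * ?Q * (c * (2 * mu' * w) / d)\<bar> \<le>
          2 * ?C3 * ((al * E) * (\<bar>c\<bar> * (2 * B * B)))"
          unfolding abs_mult[of "2 / k * _"] abs_mult[of "2 / k"]
          by (intro mult_mono k2 q r) (use P Bp in auto)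
        from abs_le_D1[OF this] show ?thesis by (simp only: mult_ac)
      qed
      show ?thesis using t1 t2 t3 unfolding C1_def by (simp only: distrib_left)
    qed
    have C1: "0 \<le> C1" unfolding C1_def using P Bp by simp
    have "R x0 * ?Y \<le> R x0 * ((al * E) * C1)"
      by (rule mult_left_mono[OF rhs]) (use Bx[OF x0] Bp in linarith)
    also have "\<dots> \<le> B * ((al * E) * C1)"
      by (rule mult_right_mono) (use Bx[OF x0] aE C1 in auto)
    finally have R: "R x0 * ?Y \<le> B * ((al * E) * C1)" .
    have "M0 * \<bar>al * E * (b o1 \<bullet> z)\<bar> \<le> M0 * (al * E * 1)"
      unfolding abs_mult[of "al * E"] by (intro mult_left_mono mult_mono be M0) (use aE in auto)
    then have "al\<^sup>2 * E * Fmin * (1 - tau\<^sup>2) \<le> (al * E) * (4 * ?N * Fmax + M0 + B * C1)"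
      using lhs te R by (simp add: algebra_simps)
    \<comment> \<open>One factor \<open>al\<close> is left after cancelling \<open>al * E\<close>:
      the second derivative of the barrier is larger than all errors by this factor.\<close>
    then have "(al * E) * (al * (1 - tau\<^sup>2) * Fmin) \<le> (al * E) * (4 * ?N * Fmax + M0 + B * C1)"
      by (simp add: power2_eq_square mult_ac)
    then have "al * (1 - tau\<^sup>2) * Fmin \<le> 4 * ?N * Fmax + M0 + B * C1"
      using aE(1) by (simp only: mult_le_cancel_left_pos)
    then show ?thesis using Fmin by (simp add: pos_le_divide_eq tau_def)
  qed
  show ?thesis by (rule exI[of _ "(4 * ?N * Fmax + M0 + B * C1) / Fmin"]) (use main in blast)
qed

end

subsection \<open>The strong minimum principle\<close>

context curvature_problem
begin

text \<open>The unit tangent bundle. Its compactness provides minima of the Hessian form in point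
  and vector jointly.\<close>

definition tangents :: "('a \<times> 'a) set" where
  "tangents = {p. norm (fst p) = 1 \<and> norm (snd p) = 1 \<and> snd p \<bullet> fst p = 0}"

lemma compact_tangents: "compact tangents"
proof -
  have "closed {p::'a \<times> 'a. snd p \<bullet> fst p = 0}"
    by (intro closed_Collect_eq continuous_intros)
  then have "compact ((sphere 0 1 \<times> sphere 0 1) \<inter> {p::'a \<times> 'a. snd p \<bullet> fst p = 0})"
    by (intro compact_Int_closed compact_Times compact_sphere)
  moreover have "tangents = (sphere 0 1 \<times> sphere 0 1) \<inter> {p. snd p \<bullet> fst p = 0}"
    by (auto simp: tangents_def)
  ultimately show ?thesis by simp
qed

abbreviation "M p \<equiv> dd (snd p) (dd (snd p) H.G) (fst p)"

lemma continuous_on_M: "continuous_on tangents M"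
  by (rule H.continuous_on_quadratic) (auto simp: tangents_def)

text \<open>If the form had a zero, \<open>M - beta\<close> would have a negative minimum
  \<open>m1\<close> on the unit tangent bundle, and \<open>psi = beta + m1\<close> would touch the
  form there. The touching point lies in the strip \<open>cc - s < x \<bullet> z < cc + s\<close>:
  below it \<open>psi\<close> is negative while \<open>M\<close> is not, and above it
  \<open>M \<ge> m0 > psi\<close>. The strip keeps away from both poles, so
  \<open>touching_parameter_bound\<close> fails for large \<open>al\<close>.\<close>

lemma positive_definite:
  assumes psd: "\<And>x u. norm x = 1 \<Longrightarrow> u \<bullet> x = 0 \<Longrightarrow> 0 \<le> dd u (dd u H.G) x"
    and p: "p \<in> tangents"
  shows "0 < M p"
proof (rule ccontr)
  assume "\<not> 0 < M p"
  have M_nonneg: "0 \<le> M q" if "q \<in> tangents" for q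
    using psd that by (auto simp: tangents_def)
  define Z where "Z = fst ` {q \<in> tangents. M q = 0}"
  have compact_zeros: "compact {q \<in> tangents. M q \<in> S}" if "closed S" for S :: "real set"
  proof -
    have "closedin (top_of_set tangents) (tangents \<inter> M -` S)"
      by (rule continuous_closedin_preimage[OF continuous_on_M that])
    then have "compact (tangents \<inter> M -` S)" by (rule closedin_compact[OF compact_tangents])
    moreover have "tangents \<inter> M -` S = {q \<in> tangents. M q \<in> S}" by blast
    ultimately show ?thesis by simp
  qed
  have "compact {q \<in> tangents. M q = 0}" using compact_zeros[of "{0}"] by simp
  then have Z: "compact Z" unfolding Z_def
    by (rule compact_continuous_image[rotated]) (intro continuous_intros)
  have "p \<in> {q \<in> tangents. M q = 0}" using p M_nonneg[OF p] \<open>\<not> 0 < M p\<close> by auto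
  then have "Z \<noteq> {}" unfolding Z_def by blast
  have Z1: "norm x = 1" if "x \<in> Z" for x using that by (auto simp: Z_def tangents_def)
  have attains: "\<exists>x\<in>Z. \<forall>x'\<in>Z. x' \<bullet> z \<le> x \<bullet> z" for z
    by (rule continuous_attains_sup[OF Z \<open>Z \<noteq> {}\<close>]) (intro continuous_intros)
  have "\<exists>x\<in>sphere 0 1. \<forall>y\<in>sphere 0 1. h x \<le> h y"
  proof (rule continuous_attains_inf)
    have "continuous_on (sphere 0 1) H.G" using H.Ck[of 0] by (auto intro: continuous_on_subset)
    then show "continuous_on (sphere 0 1) h" by (rule continuous_on_eq) (simp add: hom_ext_sphere)
  qed auto
  then obtain x1 where x1: "norm x1 = 1" "\<And>y. norm y = 1 \<Longrightarrow> h x1 \<le> h y" by auto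
  have "x1 \<notin> Z"
  proof
    assume "x1 \<in> Z"
    then obtain u where "(x1, u) \<in> tangents" "M (x1, u) = 0" by (auto simp: Z_def)
    then show False
      using H.quadratic_ge_at_minimum[OF x1, of u] h_pos[OF x1(1)] by (auto simp: tangents_def)
  qed
  have inner_bound: "\<bar>x \<bullet> z\<bar> \<le> 1" if "norm x = 1" "norm z = 1" for x z :: 'a
    using Cauchy_Schwarz_ineq2[of x z] that by simp
  have antipode: "x = y" if "x \<bullet> y = 1" "norm x = 1" "norm y = 1" for x y :: 'a
  proof -
    have "(x - y) \<bullet> (x - y) = 0"
      using that by (simp add: inner_diff_left inner_diff_right inner_commute norm_eq_1)
    then show ?thesis by simp
  qed
  \<comment> \<open>The largest value of \<open>x \<bullet> z\<close> on the zero set must differ from \<open>\<plusminus>1\<close>, so that touching occurs away from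
    the critical points of the barrier.\<close>
  obtain z xz where z: "norm z = 1" and xz: "xz \<in> Z" "\<And>x. x \<in> Z \<Longrightarrow> x \<bullet> z \<le> xz \<bullet> z" and cz: "\<bar>xz \<bullet> z\<bar> < 1"
  proof -
    obtain x2 where x2: "x2 \<in> Z" "\<And>x. x \<in> Z \<Longrightarrow> x \<bullet> x1 \<le> x2 \<bullet> x1" using attains by blast
    have "x2 \<bullet> x1 \<noteq> 1" using antipode[OF _ Z1[OF x2(1)] x1(1)] x2(1) \<open>x1 \<notin> Z\<close> by auto
    show ?thesis
    proof (cases "x2 \<bullet> x1 = - 1")
      case False
      then show ?thesis using that[OF x1(1) x2] inner_bound[OF Z1[OF x2(1)] x1(1)] \<open>x2 \<bullet> x1 \<noteq> 1\<close> by linarith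
    next
      case True
      \<comment> \<open>In this case the zero set is the single point \<open>- x1\<close>, and any
        unit tangent vector there can serve as \<open>z\<close>, with largest value 0.\<close>
      have only: "x = - x1" if "x \<in> Z" for x
      proof -
        have "x \<bullet> x1 = - 1"
          using x2(2)[OF that] True inner_bound[OF Z1[OF that] x1(1)] by linarith
        then show ?thesis using antipode[of "- x" x1] Z1[OF that] x1(1) by (simp add: minus_equation_iff)
      qed
      obtain v where "(x2, v) \<in> tangents" using x2(1) by (auto simp: Z_def)
      then have v: "norm v = 1" "v \<bullet> x2 = 0" by (auto simp: tangents_def)
      have "x \<bullet> v = 0" if "x \<in> Z" for x using only[OF that] only[OF x2(1)] v(2) by (simp add: inner_commute)
      then show ?thesis using that[OF v(1) x2(1)] x2(1) by auto
    qed
  qed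
  obtain C where C: "\<And>psi psi1 psi2 z x0 b o1 al E. touching psi psi1 psi2 z x0 b o1 al E \<Longrightarrow> al * (1 - (x0 \<bullet> z)\<^sup>2) \<le> C"
    using touching_parameter_bound by metis
  define cc where "cc = xz \<bullet> z"
  \<comment> \<open>Half the distance from \<open>\<bar>cc\<bar>\<close> to 1, so that the strip of
    half-width \<open>s\<close> around \<open>cc\<close> lies within
    \<open>\<bar>t\<bar> \<le> rho\<close> with \<open>rho < 1\<close>.\<close>
  define s where "s = (1 - \<bar>cc\<bar>) / 2"
  define rho where "rho = \<bar>cc\<bar> + s"
  have s: "0 < s" and rho: "0 \<le> rho" "rho < 1" using cz by (auto simp: s_def rho_def cc_def field_simps)
  have rho2: "0 < 1 - rho\<^sup>2" using power_strict_mono[OF rho(2,1), of 2] by simp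
  \<comment> \<open>Chosen so that \<open>al * (1 - rho\<^sup>2)\<close> exceeds \<open>C\<close>,
    against the bound at any touching point in the strip.\<close>
  define al where "al = 1 + \<bar>C\<bar> / (1 - rho\<^sup>2)"
  have "al * (1 - rho\<^sup>2) = (1 - rho\<^sup>2) + \<bar>C\<bar>" using rho2 by (simp add: al_def distrib_right)
  then have al: "1 \<le> al" "C < al * (1 - rho\<^sup>2)" using rho2 by (auto simp: al_def)
  \<comment> \<open>The zero set stays in \<open>x \<bullet> z \<le> cc\<close>, so the form is
    positive on the compact cap beyond \<open>cc + s\<close>.\<close>
  obtain m0 where m0: "0 < m0" "\<And>q. q \<in> tangents \<Longrightarrow> cc + s \<le> fst q \<bullet> z \<Longrightarrow> m0 \<le> M q"
  proof -
    let ?K = "{q \<in> tangents. cc + s \<le> fst q \<bullet> z}"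
    have "closed {q::'a \<times> 'a. cc + s \<le> fst q \<bullet> z}" by (intro closed_Collect_le continuous_intros)
    then have "compact (tangents \<inter> {q. cc + s \<le> fst q \<bullet> z})" by (rule compact_Int_closed[OF compact_tangents])
    moreover have "tangents \<inter> {q. cc + s \<le> fst q \<bullet> z} = ?K" by auto
    ultimately have K: "compact ?K" by simp
    have pos: "0 < M q" if "q \<in> ?K" for q
    proof -
      have "M q \<noteq> 0"
      proof
        assume "M q = 0"
        then have "fst q \<in> Z" using that by (auto simp: Z_def)
        then show False using xz(2) that s unfolding cc_def by force
      qed
      then show ?thesis using M_nonneg[of q] that by auto
    qed
    show ?thesis
    proof (cases "?K = {}")
      case True
      then show ?thesis by (intro that[of 1]) (simp, blast)
    next
      case False
      obtain q0 where "q0 \<in> ?K" "\<forall>q\<in>?K. M q0 \<le> M q"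
        using continuous_attains_inf[OF K False continuous_on_subset[OF continuous_on_M]] by auto
      then show ?thesis using that[of "M q0"] pos by auto
    qed
  qed
  \<comment> \<open>The factor \<open>exp (- al)\<close> normalises the exponential on the sphere,
    where \<open>x \<bullet> z \<le> 1\<close>. The minimum serves two ends: \<open>beta\<close>
    stays below \<open>m0\<close> on the cap, and the size \<open>?E\<close> at the touching point
    is at most 1.\<close>
  define eps where "eps = min 1 (m0 / 2) * exp (- al)"
  have eps: "0 < eps" using m0 by (simp add: eps_def)
  \<comment> \<open>The subtracted constant makes \<open>beta\<close> vanish at
    \<open>cc - s\<close>; hence it is positive at \<open>cc\<close>, where the form has a
    zero.\<close>
  define beta where "beta t = eps * (exp (al * t) - exp (al * (cc - s)))" for t
  have exp_le: "eps * exp (al * t) \<le> min 1 (m0 / 2)" if "t \<le> 1" for t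
  proof -
    have "al * t \<le> al * 1" using that al(1) by (intro mult_left_mono) auto
    then have "exp (al * t) \<le> exp al" by simp
    then have "eps * exp (al * t) \<le> eps * exp al" by (intro mult_left_mono) (use eps in auto)
    then show ?thesis by (simp add: eps_def mult.assoc exp_add[symmetric])
  qed
  have "tangents \<noteq> {}" using p by blast
  moreover have "continuous_on tangents (\<lambda>q. M q - beta (fst q \<bullet> z))"
    unfolding beta_def by (intro continuous_intros continuous_on_M)
  ultimately obtain q0 where q0: "q0 \<in> tangents" "\<And>q. q \<in> tangents \<Longrightarrow> M q0 - beta (fst q0 \<bullet> z) \<le> M q - beta (fst q \<bullet> z)"
    using continuous_attains_inf[OF compact_tangents] by blast
  define x0 where "x0 = fst q0"
  define u0 where "u0 = snd q0"
  have x0: "norm x0 = 1" "norm u0 = 1" "u0 \<bullet> x0 = 0" using q0(1) by (auto simp: tangents_def x0_def u0_def)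
  have x00: "x0 \<noteq> 0" using x0 by auto
  \<comment> \<open>The vertical shift that makes the barrier touch from below; it is negative
    because \<open>M - beta\<close> is negative at the zero over \<open>xz\<close>.\<close>
  define m1 where "m1 = M q0 - beta (x0 \<bullet> z)"
  have "m1 < 0"
  proof -
    obtain qz where qz: "qz \<in> tangents" "M qz = 0" "fst qz = xz" using xz(1) by (auto simp: Z_def)
    have "0 < beta cc" using eps s al(1) by (simp add: beta_def)
    then show ?thesis using q0(2)[OF qz(1)] qz by (simp add: m1_def x0_def cc_def)
  qed
  define psi where "psi t = beta t + m1" for t
  have eq0: "M q0 = psi (x0 \<bullet> z)" by (simp add: psi_def m1_def)
  define tau where "tau = x0 \<bullet> z"
  have tau1: "tau \<le> 1" using inner_bound[OF x0(1) z] by (simp add: tau_def)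
  have "cc - s < tau"
  proof (rule ccontr)
    assume "\<not> cc - s < tau"
    then have "beta tau \<le> 0" using eps al(1) by (simp add: beta_def mult_le_0_iff)
    then show False using M_nonneg[OF q0(1)] eq0 \<open>m1 < 0\<close> by (simp add: psi_def tau_def)
  qed
  moreover have "tau < cc + s"
  proof (rule ccontr)
    assume "\<not> tau < cc + s"
    then have "m0 \<le> M q0" using m0(2)[OF q0(1)] by (simp add: tau_def x0_def)
    moreover have "beta tau < m0"
    proof -
      have "beta tau < eps * exp (al * tau)" using eps by (simp add: beta_def)
      also have "\<dots> \<le> m0 / 2" using exp_le[OF tau1] by simp
      finally show ?thesis using m0(1) by simp
    qed
    ultimately show False using eq0 \<open>m1 < 0\<close> by (simp add: psi_def tau_def)
  qed
  ultimately have "\<bar>tau\<bar> \<le> rho" by (simp add: rho_def abs_le_iff) linarith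
  then have tau2: "tau\<^sup>2 \<le> rho\<^sup>2" by (metis abs_ge_zero power2_abs power_mono)
  have low: "psi (x \<bullet> z) * (norm u)\<^sup>2 \<le> dd u (dd u H.G) x" if x: "norm x = 1" and u: "u \<bullet> x = 0" for x u
  proof (cases "u = 0")
    case True
    have "x \<noteq> 0" using x by auto
    then show ?thesis using H.quadratic_scale[of x 0 0] True by simp
  next
    case False
    have "x \<noteq> 0" using x by auto
    have "(x, u /\<^sub>R norm u) \<in> tangents" using x u False by (simp add: tangents_def)
    from q0(2)[OF this] have "psi (x \<bullet> z) \<le> inverse (norm u) ^ 2 * dd u (dd u H.G) x"
      using H.quadratic_scale[OF \<open>x \<noteq> 0\<close>, of "inverse (norm u)" u] by (simp add: psi_def m1_def x0_def)
    then show ?thesis using False by (simp add: field_simps)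
  qed
  obtain b :: "'n \<Rightarrow> 'a" where b: "orthonormal_frame_at x0 b" "\<And>i j. i \<noteq> j \<Longrightarrow> dd (b i) (dd (b j) H.G) x0 = 0"
    using eigenframe_exists[OF H.bilinear[OF x00] H.commute[OF x00] x00 dim] by metis
  \<comment> \<open>The minimiser \<open>u0\<close> need not belong to the eigenframe. But
    \<open>M q0\<close> is the average of the eigenvalues with weights
    \<open>(u0 \<bullet> b i)\<^sup>2\<close>, all of them at least \<open>psi tau\<close>, so an
    eigenvalue with positive weight equals \<open>psi tau\<close>.\<close>
  obtain o1 where o1: "dd (b o1) (dd (b o1) H.G) x0 = psi tau"
  proof -
    let ?l = "\<lambda>i. dd (b i) (dd (b i) H.G) x0"
    note nb = orthonormal_frame_atD(4,2)[OF b(1)]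
    have lge: "psi tau \<le> ?l i" for i using low[OF x0(1) nb(2), of i] by (simp add: nb tau_def)
    have "u0 = (\<Sum>i\<in>UNIV. (u0 \<bullet> b i) *\<^sub>R b i)"
      by (rule orthonormal_frame_at_expand[OF b(1) x00 dim x0(3)])
    then have "M q0 = (\<Sum>i\<in>UNIV. \<Sum>j\<in>UNIV. (u0 \<bullet> b i) * (u0 \<bullet> b j) * dd (b i) (dd (b j) H.G) x0)"
      using bilinear_expand[OF H.bilinear[OF x00], of "\<lambda>i. u0 \<bullet> b i" b UNIV "\<lambda>i. u0 \<bullet> b i" b UNIV]
      by (simp add: x0_def[symmetric] u0_def[symmetric])
    also have "\<dots> = (\<Sum>i\<in>UNIV. \<Sum>j\<in>UNIV. if j = i then (u0 \<bullet> b i)\<^sup>2 * ?l i else 0)"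
      by (intro sum.cong refl) (auto simp: b(2) power2_eq_square)
    finally have Ml: "M q0 = (\<Sum>i\<in>UNIV. (u0 \<bullet> b i)\<^sup>2 * ?l i)" by simp
    have one: "(\<Sum>i\<in>UNIV. (u0 \<bullet> b i)\<^sup>2) = 1"
      using orthonormal_frame_parseval[OF b(1) x0(1) dim, of u0] x0 by simp
    have "(\<Sum>i\<in>UNIV. (u0 \<bullet> b i)\<^sup>2 * (?l i - psi tau)) = M q0 - psi tau * (\<Sum>i\<in>UNIV. (u0 \<bullet> b i)\<^sup>2)"
      unfolding Ml by (simp add: right_diff_distrib sum_subtractf sum_distrib_left mult.commute)
    then have "(\<Sum>i\<in>UNIV. (u0 \<bullet> b i)\<^sup>2 * (?l i - psi tau)) = 0" using one eq0 by (simp add: tau_def)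
    then have "\<forall>i\<in>UNIV. (u0 \<bullet> b i)\<^sup>2 * (?l i - psi tau) = 0"
      by (subst (asm) sum_nonneg_eq_0_iff) (use lge in auto)
    moreover obtain i where "(u0 \<bullet> b i)\<^sup>2 \<noteq> 0" using one by (metis sum.neutral zero_neq_one)
    ultimately show ?thesis using that[of i] by auto
  qed
  let ?E = "eps * exp (al * tau)"
  have "(psi has_real_derivative eps * (al * exp (al * s))) (at s)" for s
    unfolding psi_def[abs_def] beta_def[abs_def] by (auto intro!: derivative_eq_intros)
  moreover have "((\<lambda>s. eps * (al * exp (al * s))) has_real_derivative eps * (al\<^sup>2 * exp (al * s))) (at s)" for s
    by (auto intro!: derivative_eq_intros simp: power2_eq_square)
  moreover have "psi tau \<le> ?E"
  proof -
    have "beta tau \<le> ?E" using eps by (simp add: beta_def)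
    then show ?thesis using \<open>m1 < 0\<close> by (simp add: psi_def)
  qed
  moreover have "?E \<le> 1" using exp_le[OF tau1] by simp
  ultimately have "touching psi (\<lambda>s. eps * (al * exp (al * s))) (\<lambda>s. eps * (al\<^sup>2 * exp (al * s))) z x0 b o1 al ?E"
    unfolding touching_def
    using low x0(1) z b o1 M_nonneg[OF q0(1)] eq0 al(1) eps by (simp add: tau_def)
  from C[OF this] have "al * (1 - (x0 \<bullet> z)\<^sup>2) \<le> C" .
  moreover have "al * (1 - rho\<^sup>2) \<le> al * (1 - (x0 \<bullet> z)\<^sup>2)"
    using tau2 al(1) by (intro mult_left_mono) (auto simp: tau_def)
  ultimately show False using al(2) by linarith
qed

end

theorem theorem3p4:
  fixes k n :: nat and p q :: real
    and f h :: "'a::euclidean_space \<Rightarrow> real"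
    and e :: "'a \<Rightarrow> 'n::finite \<Rightarrow> 'a"
  assumes "DIM('a) = n + 1" and "CARD('n) = n"
    and "\<And>x. x \<in> sphere 0 1 \<Longrightarrow> orthonormal_frame_at x (e x)"
    and "1 \<le> k" and "k < n" and "1 \<le> p"
    and "smooth_on_sphere f" and "\<And>x. x \<in> sphere 0 1 \<Longrightarrow> 0 < f x"
    and "\<And>x. x \<in> sphere 0 1 \<Longrightarrow>
           pos_semidef (W_matrix (e x) (\<lambda>y. f y powr (- 1 / (real k + p - 1))) x)"
    and "smooth_on_sphere h" and "\<And>x. x \<in> sphere 0 1 \<Longrightarrow> 0 < h x"
    and "\<And>x. x \<in> sphere 0 1 \<Longrightarrow>
           sigma_sym k (W_matrix (e x) h x) =
             f x * h x powr (p - 1) *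
             ((h x)\<^sup>2 + (norm (sgrad h x))\<^sup>2) powr ((real k + 1 - q) / 2)"
    and "\<And>x. x \<in> sphere 0 1 \<Longrightarrow> pos_semidef (W_matrix (e x) h x)"
  shows "\<forall>x\<in>sphere 0 1. pos_def (W_matrix (e x) h x)"
proof
  fix x :: 'a assume x: "x \<in> sphere 0 1"
  define phi where "phi = (\<lambda>y. f y powr (- 1 / (real k + p - 1)))"
  have dim: "DIM('a) = CARD('n) + 1" using assms(1,2) by simp
  have frame: "orthonormal_frame_at y (e y)" if "norm y = 1" for y using assms(3) that by simp
  interpret H: homogeneous_extension h by standard (rule assms(10))
  interpret F: homogeneous_extension phi
    unfolding phi_def by standard (rule smooth_on_sphere_powr[OF assms(7,8)])
  \<comment> \<open>Applied to \<open>phi\<close> this is the convexity of its extension; applied to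
    \<open>h\<close> it is the semidefiniteness from which the minimum principle starts.\<close>
  have psd: "0 \<le> dd u (dd u (hom_ext g)) y"
    if "homogeneous_extension g" "\<And>x. x \<in> sphere 0 1 \<Longrightarrow> pos_semidef (W_matrix (e x) g x)"
      "norm y = 1" "u \<bullet> y = 0" for g :: "'a \<Rightarrow> real" and y u
  proof -
    interpret G: homogeneous_extension g by (rule that(1))
    have "y \<noteq> 0" using that(3) by auto
    have "pos_semidef (qmat (e y) (\<lambda>u v. dd u (dd v (hom_ext g)) y))"
      using that(2)[of y] that(3) G.W_matrix_eq[OF that(3) frame[OF that(3)]] by simp
    from pos_semidef_qmat[OF frame[OF that(3)] \<open>y \<noteq> 0\<close> dim G.bilinear[OF \<open>y \<noteq> 0\<close>] this that(4)]
    show ?thesis .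
  qed
  interpret curvature_problem h phi k "p - 1" "(real k + 1 - q) / 2" e
  proof
    fix y :: 'a assume y: "norm y = 1"
    show "orthonormal_frame_at y (e y)" by (rule frame[OF y])
    show "0 < h y" "0 < phi y" using assms(8)[of y] assms(11)[of y] y by (simp_all add: phi_def)
    show "0 \<le> dd u (dd u F.G) y" if "u \<bullet> y = 0" for u
      by (rule psd[OF F.homogeneous_extension_axioms _ y that]) (use assms(9) in \<open>simp add: phi_def\<close>)
    have "phi y powr (- (real k + (p - 1))) = f y"
    proof -
      define r where "r = real k + p - 1"
      have "0 < r" using assms(4,6) by (simp add: r_def)
      then have "(f y powr (- 1 / r)) powr (- r) = f y"
        using assms(8)[of y] y by (simp add: powr_powr)
      moreover have "real k + (p - 1) = r" by (simp add: r_def)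
      ultimately show ?thesis by (simp only: phi_def r_def[symmetric])
    qed
    then show "sigma_sym k (W_matrix (e y) h y) = phi y powr (- (real k + (p - 1))) * h y powr (p - 1) *
        ((norm (grad H.G y))\<^sup>2) powr ((real k + 1 - q) / 2)"
      using assms(12)[of y] y by (simp add: H.norm_grad)
  qed (use dim assms(4,6) in auto)
  have nx: "norm x = 1" and x0: "x \<noteq> 0" using x by auto
  have "pos_def (qmat (e x) (\<lambda>u v. dd u (dd v H.G) x))"
  proof (rule pos_def_qmat[OF frame[OF nx] H.bilinear[OF x0]])
    fix u assume u: "u \<bullet> x = 0" "u \<noteq> 0"
    have "(x, u /\<^sub>R norm u) \<in> tangents" using nx u by (simp add: tangents_def)
    then have "0 < M (x, u /\<^sub>R norm u)"
      by (rule positive_definite[rotated]) (rule psd[OF H.homogeneous_extension_axioms assms(13)])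
    then have "0 < (inverse (norm u))\<^sup>2 * dd u (dd u H.G) x"
      unfolding fst_conv snd_conv H.quadratic_scale[OF x0] .
    then show "0 < dd u (dd u H.G) x" using u(2) by (simp add: zero_less_mult_iff)
  qed
  then show "pos_def (W_matrix (e x) h x)" by (simp add: H.W_matrix_eq[OF nx frame[OF nx]])
qed

end
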